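(* Let $\lambda>0$, $\lambda\neq1$, and let $\mu_\lambda$ be a standard probability measure on $\mathbb{R}$ with $\alpha_1^\lambda\neq0$. The following are equivalent. (A) There are a region $S$ and functions $u_\lambda,f_\lambda$ such that $\mu_\lambda$ has a generating function of ultraspherical type with parameter $\lambda$ on $S$ with functions $u_\lambda,f_\lambda$, the interchange condition on $S$ holds, and $f_\lambda(z)-\frac{(\lambda+1)\omega_2^\lambda z+\alpha_1^\lambda}{2}=\frac{E_\lambda(z)}{z}$ on $S$ for some polynomial $E_\lambda$ (notions defined in the context). (B) $\lambda>1/2$ and either (i) $\alpha_1^\lambda>0$ and for all $n\ge0$ $$P_n^\lambda(x)=\left[\frac{2\lambda}{\sqrt{2\lambda-1}}\right]^np_n^{\lambda-1/2,\lambda-3/2}\!\left(\frac{\sqrt{2\lambda-1}\,x-1}{2\lambda}\right),$$ i.e. $\mu_\lambda$ has density proportional to $\left(1-\frac{\sqrt{2\lambda-1}x-1}{2\lambda}\right)^{\lambda-1/2}\left(1+\frac{\sqrt{2\lambda-1}x-1}{2\lambda}\right)^{\lambda-3/2}$ on $\left[\frac{1-2\lambda}{\sqrt{2\lambda-1}},\frac{1+2\lambda}{\sqrt{2\lambda-1}}\right]$; or (ii) $\alpha_1^\lambda<0$ and for all $n\ge0$ $$P_n^\lambda(x)=\left[\frac{2\lambda}{\sqrt{2\lambda-1}}\right]^np_n^{\lambda-3/2,\lambda-1/2}\!\left(\frac{\sqrt{2\lambda-1}\,x+1}{2\lambda}\right),$$ i.e. $\mu_\lambda$ has density proportional to $\left(1-\frac{\sqrt{2\lambda-1}x+1}{2\lambda}\right)^{\lambda-3/2}\left(1+\frac{\sqrt{2\lambda-1}x+1}{2\lambda}\right)^{\lambda-1/2}$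 on $\left[-\frac{1+2\lambda}{\sqrt{2\lambda-1}},\frac{2\lambda-1}{\sqrt{2\lambda-1}}\right]$.
   Context: Standard measure: $\mu_\lambda$ is a probability measure on $\mathbb{R}$ with finite moments of all orders, mean $0$ and variance $1$. Its monic orthogonal polynomials $(P_n^\lambda)_{n\ge0}$ (with $\deg P_n^\lambda=n$, $\int P_n^\lambda P_m^\lambda\,d\mu_\lambda=0$ for $n\ne m$) satisfy $xP_n^\lambda(x)=P_{n+1}^\lambda(x)+\alpha_n^\lambda P_n^\lambda(x)+\omega_n^\lambda P_{n-1}^\lambda(x)$ for $n\ge0$, with $P_{-1}^\lambda:=0$, $P_0^\lambda=1$; the reals $\alpha_n^\lambda$, $\omega_n^\lambda\ge0$ are the Jacobi-Szegő parameters. Standardness means $\alpha_0^\lambda=0$, $\omega_1^\lambda=1$. Notation: $(\lambda)_n=\lambda(\lambda+1)\cdots(\lambda+n-1)$, $(\lambda)_0=1$. Complex powers $w^\lambda$ use the principal logarithm. For $\alpha,\beta>-1$, $p_n^{\alpha,\beta}$ denotes the monic Jacobi polynomial of degree $n$, i.e. the monic orthogonal polynomials for the weight $(1-x)^\alpha(1+x)^\beta$ on $[-1,1]$. Generating function of ultraspherical type with parameter $\lambda>0$: there are a nonempty connected open set (region) $S\subset\mathbb{C}\setminus(-\infty,0]$ with $0$ in its closure, and analytic functions $u_\lambda,f_\lambda$ on $S$, with $u_\lambda$ nowhere zero, such that $\Im f_\lambda(z)\neq0$ for $z\in S$, $\lim_{z\to0,z\in S}zf_\lambda(z)=1$, $\lim_{z\to0,z\in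 S}u_\lambda(z)/z^\lambda=1$, and for all $x\in\mathrm{supp}(\mu_\lambda)$ and $z\in S$ the series below converges and $$\psi_\lambda(z,x):=\sum_{n\ge0}\frac{(\lambda)_n}{n!}P_n^\lambda(x)z^n=\frac{1}{u_\lambda(z)(f_\lambda(z)-x)^\lambda}.$$ Interchange condition on $S$: for $i\in\{0,1,2\}$ and all $z\in S$, $$\int\sum_{n\ge0}\frac{(\lambda)_n}{n!}x^iP_n^\lambda(x)z^n\,\mu_\lambda(dx)=\sum_{n\ge0}\frac{(\lambda)_n}{n!}\left(\int x^iP_n^\lambda(x)\,\mu_\lambda(dx)\right)z^n.$$ *)

theory Defs
  imports "HOL-Probability.Probability"
begin

definition standard_measure :: "real measure \<Rightarrow> bool" where
  "standard_measure \<mu> \<longleftrightarrow>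
     real_distribution \<mu> \<and>
     (\<forall>k. integrable \<mu> (\<lambda>x. x ^ k)) \<and>
     prob_space.expectation \<mu> (\<lambda>x. x) = 0 \<and>
     prob_space.variance \<mu> (\<lambda>x. x) = 1"

definition measure_support :: "real measure \<Rightarrow> real set" where
  "measure_support \<mu> = {x. \<forall>U. open U \<and> x \<in> U \<longrightarrow> emeasure \<mu> U > 0}"

definition monic_orthogonal :: "real measure \<Rightarrow> (nat \<Rightarrow> real poly) \<Rightarrow> bool" where
  "monic_orthogonal \<mu> P \<longleftrightarrow>
     (\<forall>n. degree (P n) = n \<and> lead_coeff (P n) = 1) \<and>
     (\<forall>n m. n \<noteq> m \<longrightarrow> (\<integral>x. poly (P n) x * poly (P m) x \<partial>\<mu>) = 0)"

text \<open>
  If \<open>\<mu>\<close> has infinite support, \<open>P\<close>, \<open>\<alpha>\<close> and \<open>\<omega> n\<close> (\<open>n \<ge> 1\<close>) are determined by \<open>\<mu>\<close>.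
  If the support has exactly \<open>N\<close> points, \<open>P n\<close> is not unique for \<open>n > N\<close>; the predicate then
  admits every choice obeying a three-term recurrence. The value \<open>\<omega> 0\<close> plays no role, since it
  would multiply \<open>P\<close> at index \<open>-1\<close>, which is zero.
\<close>
definition jacobi_szego ::
    "real measure \<Rightarrow> (nat \<Rightarrow> real poly) \<Rightarrow> (nat \<Rightarrow> real) \<Rightarrow> (nat \<Rightarrow> real) \<Rightarrow> bool" where
  "jacobi_szego \<mu> P \<alpha> \<omega> \<longleftrightarrow>
     monic_orthogonal \<mu> P \<and>
     (\<forall>n\<ge>1. \<omega> n \<ge> 0) \<and>
     (\<forall>n. [:0, 1:] * P n =
            P (Suc n) + smult (\<alpha> n) (P n) + (if n = 0 then 0 else smult (\<omega> n) (P (n - 1))))"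

definition jacobi_measure :: "real \<Rightarrow> real \<Rightarrow> real measure" where
  "jacobi_measure a b =
     density lborel (\<lambda>x. ennreal ((1 - x) powr a * (1 + x) powr b * indicator {-1..1} x))"

text \<open>Meaningful for \<open>a, b > -1\<close>, when the sequence exists and is unique.\<close>
definition monic_jacobi_poly :: "real \<Rightarrow> real \<Rightarrow> nat \<Rightarrow> real poly" where
  "monic_jacobi_poly a b = (THE P. monic_orthogonal (jacobi_measure a b) P)"

definition has_density_proportional_to ::
    "real measure \<Rightarrow> (real \<Rightarrow> real) \<Rightarrow> real set \<Rightarrow> bool" where
  "has_density_proportional_to \<mu> w I \<longleftrightarrow>
     (\<exists>c>0. \<mu> = density lborel (\<lambda>x. ennreal (c * w x * indicator I x)))"

definition ultraspherical_generating ::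
    "real \<Rightarrow> real measure \<Rightarrow> (nat \<Rightarrow> real poly) \<Rightarrow> complex set
       \<Rightarrow> (complex \<Rightarrow> complex) \<Rightarrow> (complex \<Rightarrow> complex) \<Rightarrow> bool" where
  "ultraspherical_generating l \<mu> P S u f \<longleftrightarrow>
     S \<noteq> {} \<and> open S \<and> connected S \<and> S \<inter> \<real>\<^sub>\<le>\<^sub>0 = {} \<and> 0 \<in> closure S \<and>
     u analytic_on S \<and> f analytic_on S \<and>
     (\<forall>z\<in>S. u z \<noteq> 0) \<and>
     (\<forall>z\<in>S. Im (f z) \<noteq> 0) \<and>
     ((\<lambda>z. z * f z) \<longlongrightarrow> 1) (at 0 within S) \<and>
     ((\<lambda>z. u z / z powr of_real l) \<longlongrightarrow> 1) (at 0 within S) \<and>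
     (\<forall>x\<in>measure_support \<mu>. \<forall>z\<in>S.
        (\<lambda>n. of_real (pochhammer l n / fact n * poly (P n) x) * z ^ n)
          sums (1 / (u z * (f z - of_real x) powr of_real l)))"

text \<open>
  Integrability is required explicitly because the Bochner integral of a non-integrable function
  is \<open>0\<close> by convention. The inner \<open>suminf\<close> only matters on the support of \<open>\<mu>\<close>, whose complement is
  a null set and where \<open>ultraspherical_generating\<close> provides convergence.
\<close>
definition interchange_condition ::
    "real \<Rightarrow> real measure \<Rightarrow> (nat \<Rightarrow> real poly) \<Rightarrow> complex set \<Rightarrow> bool" where
  "interchange_condition l \<mu> P S \<longleftrightarrow>
     (\<forall>i\<in>{0, 1, 2::nat}. \<forall>z\<in>S.
        integrable \<mu>
          (\<lambda>x. \<Sum>n. of_real (pochhammer l n / fact n * x ^ i * poly (P n) x) * z ^ n :: complex) \<and>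
        (\<lambda>n. of_real (pochhammer l n / fact n * (\<integral>x. x ^ i * poly (P n) x \<partial>\<mu>)) * z ^ n)
          sums (\<integral>x. (\<Sum>n. of_real (pochhammer l n / fact n * x ^ i * poly (P n) x) * z ^ n) \<partial>\<mu>))"

end

theory Submission
  imports Defs
begin

text \<open>
  Write \<open>\<Psi>\<^sub>x(z)\<close> for the generating function and \<open>F(z) = z f(z)\<close>, a polynomial with \<open>F(0) = 1\<close> under
  condition (A). The logarithmic derivative in \<open>z\<close> of \<open>\<Psi>\<^sub>x = 1 / (u (f - x)^\<lambda>)\<close> has an \<open>x\<close>-free part,
  so there is a formal power series \<open>v\<close> with
  \<open>z (F - x z) \<Psi>\<^sub>x' + \<lambda> (z F' - F) \<Psi>\<^sub>x = v (F - x z) \<Psi>\<^sub>x\<close> for all \<open>x\<close> in the support; no branch of the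
  power is involved any more. Integrating this equation and its product with \<open>x\<close> against \<open>\<mu>\<close>,
  coefficient by coefficient, and eliminating \<open>v\<close> leaves a Riccati equation for \<open>F\<close>. Its polynomial
  solutions have degree at most 2 and force \<open>\<lambda> > 1/2\<close> and
  \<open>F = 1 + \<epsilon> z / s + \<kappa>\<^sup>2 z\<^sup>2\<close>, where \<open>s = \<surd>(2 \<lambda> - 1)\<close>, \<open>\<kappa> = \<epsilon> \<lambda> / s\<close> and \<open>\<epsilon>\<close> is the sign of \<open>\<alpha>\<^sub>1\<close>.
  Then \<open>\<Psi>\<^sub>x = (1 + \<kappa> z) (F - x z)^(-\<lambda>)\<close>, so that \<open>P\<^sub>n\<close> is proportional to \<open>C\<^sub>n + \<epsilon> C\<^sub>n\<^sub>-\<^sub>1\<close> for the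
  Gegenbauer polynomials \<open>C\<^sub>n\<close> of parameter \<open>\<lambda>\<close>, taken at \<open>(s x - \<epsilon>) / (2 \<lambda>)\<close>. These combinations
  satisfy the Jacobi differential equation with exponents \<open>\<lambda> - 1 \<plusminus> \<epsilon>/2\<close>, which makes them orthogonal.
  Conversely, a measure with these orthogonal polynomials has the moments of a Jacobi measure, which
  determine it because its support is bounded; on a small upper half disc all the series converge
  uniformly on the support.
\<close>

section \<open>Orthogonal polynomials of measures on the line\<close>

text \<open>The function u lives only on S, which has 0 on its boundary, so z u'/u has no expansion
  at 0 to start from. The series v is obtained instead by comparing the equation at two points of
  the support and dividing by (F - x z) \<Psi>, whose constant term is 1. From there on everything
  is formal: the coefficients of \<Psi> are polynomials in x, so integrating them takes moments
  only, and orthogonality reduces the integrals of \<Psi>, x \<Psi> and x^2 \<Psi> to polynomials in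
  z of degree at most 2. Both integrated relations are linear in v, which makes the elimination a
  cross multiplication. The term subtracted from f in (A) is exactly what completes the square in
  the Riccati equation. The resulting coefficient equations degenerate at \<lambda> = 1, where they
  leave \<open>\<alpha> 1\<close> and \<open>\<omega> 2\<close> free. A second obstacle is that the
  generating function speaks about the polynomials on the support only, and a finite support does
  not determine them. The three-term recurrence of the Jacobi side, with positive coefficients,
  closes this gap. In the converse, the half disc makes the arguments of z and f - x have opposite
  signs, so that the power of their product splits.\<close>

definition has_moments :: "real measure \<Rightarrow> bool" where
  "has_moments M \<longleftrightarrow> (\<forall>k. integrable M (\<lambda>x. x ^ k))"

lemma integrable_poly:
  assumes "has_moments M"
  shows "integrable M (poly p)"
proof -
  have "integrable M (\<lambda>x. \<Sum>i\<le>degree p. coeff p i * x ^ i)"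
    using assms by (auto simp: has_moments_def)
  then show ?thesis by (simp add: poly_altdef[abs_def])
qed

lemma integrable_poly_mult:
  assumes "has_moments M"
  shows "integrable M (\<lambda>x. poly p x * poly q x)"
  using integrable_poly[OF assms, of "p * q"] by (simp add: poly_mult[abs_def])

text \<open>Subtracting a multiple of \<open>P n\<close> removes the leading term, so every
  polynomial is built up from the family. The bound \<open>n \<le> degree p\<close> in the step lets
  orthogonality to lower degrees be proved by this induction.\<close>

lemma monic_expansion_induct [consumes 1, case_names zero step]:
  fixes P :: "nat \<Rightarrow> real poly"
  assumes monic: "\<And>n. degree (P n) = n \<and> lead_coeff (P n) = 1"
    and zero: "R 0"
    and step: "\<And>c n q. n \<le> degree p \<Longrightarrow> R q \<Longrightarrow> R (smult c (P n) + q)"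
  shows "R p"
proof -
  \<comment> \<open>The disjunct \<open>q = 0\<close> provides the base case: the zero polynomial
    has degree 0, so a bound on the degree alone could not describe it at
    \<open>N = 0\<close>.\<close>
  have "degree q < N \<or> q = 0 \<Longrightarrow> N \<le> Suc (degree p) \<Longrightarrow> R q" for N q
  proof (induction N arbitrary: q)
    case 0
    then show ?case using zero by simp
  next
    case (Suc N)
    define r where "r = q - smult (coeff q N) (P N)"
    have "degree (P N) = N" "coeff (P N) N = 1"
      using monic[of N] by auto
    then have "degree r \<le> N" "coeff r N = 0"
      using Suc.prems unfolding r_def
      by (auto intro!: degree_diff_le degree_smult_le[THEN le_trans])
    then have "degree r < N \<or> r = 0"
      by (metis le_neq_implies_less leading_coeff_0_iff)
    then have "R r" using Suc by simp
    moreover have "q = smult (coeff q N) (P N) + r" by (simp add: r_def)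
    ultimately show ?case using step[of N r "coeff q N"] Suc.prems(2) by simp
  qed
  from this[of p "Suc (degree p)"] show ?thesis by simp
qed

lemma monic_orthogonalD:
  assumes "monic_orthogonal M P"
  shows "degree (P n) = n" "lead_coeff (P n) = 1" "coeff (P n) n = 1"
    "P n \<noteq> 0" "n \<noteq> m \<Longrightarrow> (\<integral>x. poly (P n) x * poly (P m) x \<partial>M) = 0"
proof -
  have *: "degree (P n) = n \<and> lead_coeff (P n) = 1"
    using assms unfolding monic_orthogonal_def by blast
  then show "degree (P n) = n" "lead_coeff (P n) = 1" "coeff (P n) n = 1" "P n \<noteq> 0"
    by (metis, metis, metis, metis leading_coeff_0_iff zero_neq_one)
qed (use assms in \<open>auto simp: monic_orthogonal_def\<close>)

lemma monic_orthogonal_0: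
  assumes "monic_orthogonal M P"
  shows "P 0 = 1"
proof -
  have "degree (P 0) = 0" "coeff (P 0) 0 = 1"
    using monic_orthogonalD(1,3)[OF assms, of 0] .
  then show ?thesis by (metis degree_0_id one_pCons of_nat_1 pCons_one degree_eq_zeroE coeff_pCons_0)
qed

lemma monic_orthogonal_lower_degree:
  assumes M: "has_moments M" and P: "monic_orthogonal M P" and "degree q < n"
  shows "(\<integral>x. poly (P n) x * poly q x \<partial>M) = 0"
proof -
  have "degree (P n) = n \<and> lead_coeff (P n) = 1" for n
    using P unfolding monic_orthogonal_def by blast
  from this show ?thesis
  proof (induction q rule: monic_expansion_induct)
    case zero
    then show ?case by simp
  next
    case (step c m q')
    have "(\<integral>x. poly (P n) x * poly (smult c (P m) + q') x \<partial>M)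
        = (\<integral>x. c * (poly (P n) x * poly (P m) x) + poly (P n) x * poly q' x \<partial>M)"
      by (simp add: algebra_simps)
    also have "\<dots> = c * (\<integral>x. poly (P n) x * poly (P m) x \<partial>M) + (\<integral>x. poly (P n) x * poly q' x \<partial>M)"
      using integrable_poly_mult[OF M] by simp
    also have "\<dots> = 0"
      using step monic_orthogonalD(5)[OF P, of n m] \<open>degree q < n\<close> by simp
    finally show ?case .
  qed
qed

text \<open>The difference of the two candidates of degree n has smaller degree, so it is orthogonal
  to both of them and hence to itself. Positivity of square integrals then makes it zero.\<close>

lemma monic_orthogonal_unique:
  assumes M: "has_moments M" and P: "monic_orthogonal M P" and Q: "monic_orthogonal M Q"
    and pos: "\<And>p. p \<noteq> 0 \<Longrightarrow> (\<integral>x. poly p x * poly p x \<partial>M) \<noteq> 0"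
  shows "P = Q"
proof
  fix n
  show "P n = Q n"
  proof (cases "n = 0")
    case True
    then show ?thesis using monic_orthogonal_0[OF P] monic_orthogonal_0[OF Q] by simp
  next
    case False
    define r where "r = P n - Q n"
    have "coeff r n = 0" "degree r \<le> n"
      using monic_orthogonalD(1,3)[OF P, of n] monic_orthogonalD(1,3)[OF Q, of n]
      by (auto simp: r_def intro: degree_diff_le)
    then have "degree r < n"
      using False by (metis degree_0 le_neq_implies_less leading_coeff_0_iff)
    then have "(\<integral>x. poly (P n) x * poly r x \<partial>M) = 0" "(\<integral>x. poly (Q n) x * poly r x \<partial>M) = 0"
      using monic_orthogonal_lower_degree[OF M] P Q by blast+
    then have "(\<integral>x. poly (P n) x * poly r x - poly (Q n) x * poly r x \<partial>M) = 0"
      using integrable_poly_mult[OF M] by simp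
    then have "(\<integral>x. poly r x * poly r x \<partial>M) = 0"
      by (simp add: r_def left_diff_distrib)
    then show ?thesis using pos[of r] by (auto simp: r_def)
  qed
qed

text \<open>In the expansion of p along the family only \<open>P 0 = 1\<close> contributes, since
  every later member is orthogonal to 1. The integral is therefore a coefficient of that expansion,
  whatever the measure.\<close>

lemma monic_orthogonal_determines_integrals:
  assumes M: "has_moments M" "prob_space M" and N: "has_moments N" "prob_space N"
    and P: "monic_orthogonal M P" "monic_orthogonal N P"
  shows "(\<integral>x. poly p x \<partial>M) = (\<integral>x. poly p x \<partial>N)"
proof -
  have "degree (P n) = n \<and> lead_coeff (P n) = 1" for n
    using P unfolding monic_orthogonal_def by blast
  from this show ?thesis
  proof (induction p rule: monic_expansion_induct)
    case zero
    then show ?case by simp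
  next
    case (step c n q)
    have "(\<integral>x. poly (P n) x \<partial>M) = (\<integral>x. poly (P n) x \<partial>N)"
    proof (cases "n = 0")
      case True
      then show ?thesis
        using monic_orthogonal_0[OF P(1)] M N by (simp add: prob_space.prob_space)
    next
      case False
      then show ?thesis
        using monic_orthogonalD(5)[OF P(1), of n 0] monic_orthogonalD(5)[OF P(2), of n 0]
          monic_orthogonal_0[OF P(1)] by simp
    qed
    then show ?case
      using step integrable_poly[OF M(1)] integrable_poly[OF N(1)] by simp
  qed
qed

text \<open>Both characteristic functions are approximated by the same Taylor polynomials. The
  remainder is controlled by a moment, so a bound on the support of N alone also controls the
  remainder for M.\<close>

lemma bounded_support_moments_determine:
  assumes M: "real_distribution M" "has_moments M" and N: "real_distribution N" "has_moments N"
    and K: "AE x in N. \<bar>x\<bar> \<le> K"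
    and eq: "\<And>k. (\<integral>x. x ^ k \<partial>M) = (\<integral>x. x ^ k \<partial>N)"
  shows "M = N"
proof (rule Levy_uniqueness[OF M(1) N(1)], rule ext)
  fix t :: real
  interpret M: real_distribution M by fact
  interpret N: real_distribution N by fact
  \<comment> \<open>Only even orders are used: the remainder involves the absolute moment, which for
    even exponents is an ordinary moment and thus shared by M and N.\<close>
  define S where "S n = (\<Sum>k\<le>2 * n. ((\<i> * t)^k / fact k) * N.expectation (\<lambda>x. x^k))" for n
  define B where "B n = 2 * ((\<bar>t\<bar> * max K 0) ^ (2 * n) / fact (2 * n))" for n :: nat
  have even: "\<bar>x\<bar> ^ (2 * n) = x ^ (2 * n)" for x :: real and n
    by (simp add: power_even_abs)
  have ex: "(\<integral>x. x ^ (2 * n) \<partial>N) \<le> max K 0 ^ (2 * n)" for n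
  proof -
    have "(\<integral>x. x ^ (2 * n) \<partial>N) \<le> (\<integral>x. max K 0 ^ (2 * n) \<partial>N)"
    proof (rule integral_mono_AE)
      show "integrable N (\<lambda>x. x ^ (2 * n))" using N(2) by (simp add: has_moments_def)
      show "AE x in N. x ^ (2 * n) \<le> max K 0 ^ (2 * n)"
        using K
      proof eventually_elim
        case (elim x)
        then have "\<bar>x\<bar> ^ (2 * n) \<le> max K 0 ^ (2 * n)" by (intro power_mono) auto
        then show ?case by (simp only: even)
      qed
    qed simp
    also have "\<dots> = max K 0 ^ (2 * n)" using N.prob_space by simp
    finally show ?thesis .
  qed
  have le: "(2 * \<bar>t\<bar> ^ (2 * n) / fact (2 * n)) * (\<integral>x. x ^ (2 * n) \<partial>N) \<le> B n" for n
    using mult_left_mono[OF ex[of n], of "2 * \<bar>t\<bar> ^ (2 * n) / fact (2 * n)"]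
    by (simp add: B_def power_mult_distrib)
  have m: "cmod (char M t - S n) \<le> B n" for n
    using M.char_approx1[of "2 * n" t] M(2) le[of n]
    by (simp add: S_def eq even has_moments_def)
  have n: "cmod (char N t - S n) \<le> B n" for n
    using N.char_approx1[of "2 * n" t] N(2) le[of n]
    by (simp add: S_def even has_moments_def)
  have "(\<lambda>n. (\<bar>t\<bar> * max K 0) ^ n / fact n) \<longlonglongrightarrow> 0"
    using summable_LIMSEQ_zero[OF summable_exp[of "\<bar>t\<bar> * max K 0"]]
    by (simp add: field_simps)
  then have "(\<lambda>n. (\<bar>t\<bar> * max K 0) ^ (2 * n) / fact (2 * n)) \<longlonglongrightarrow> 0"
    by (rule LIMSEQ_subseq_LIMSEQ[unfolded o_def]) (simp add: strict_mono_def)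
  then have B: "B \<longlonglongrightarrow> 0"
    unfolding B_def by (rule tendsto_mult_right_zero)
  have "(\<lambda>n. char M t - S n) \<longlonglongrightarrow> 0" "(\<lambda>n. char N t - S n) \<longlonglongrightarrow> 0"
    by (rule Lim_null_comparison[OF _ B], simp add: m, rule Lim_null_comparison[OF _ B], simp add: n)
  from tendsto_diff[OF this] have "(\<lambda>n::nat. char M t - char N t) \<longlonglongrightarrow> 0" by simp
  then show "char M t = char N t" by (simp add: LIMSEQ_const_iff)
qed

text \<open>The complement of the support is a union of open null sets; by Lindelof's theorem
  countably many of them suffice.\<close>

lemma AE_measure_support:
  assumes "sets M = sets borel"
  shows "AE x in M. x \<in> measure_support M"
proof -
  define \<F> where "\<F> = {U. open U \<and> emeasure M U = 0}"
  obtain \<F>' where F': "\<F>' \<subseteq> \<F>" "countable \<F>'" "\<Union>\<F>' = \<Union>\<F>"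
    using Lindelof[of \<F>] unfolding \<F>_def by (metis (no_types, lifting) mem_Collect_eq)
  have "(\<Union>U\<in>\<F>'. U) \<in> null_sets M"
  proof (rule null_sets_UN')
    fix U assume "U \<in> \<F>'"
    then have "open U" "emeasure M U = 0" using F' by (auto simp: \<F>_def)
    then show "U \<in> null_sets M" using assms by auto
  qed fact
  then have "\<Union>\<F> \<in> null_sets M" using F' by simp
  then show ?thesis
  proof (rule AE_I', safe)
    fix x assume "x \<notin> measure_support M"
    then obtain U where "open U" "x \<in> U" "\<not> emeasure M U > 0"
      by (auto simp: measure_support_def)
    then have "U \<in> \<F>" by (simp add: \<F>_def zero_less_iff_neq_zero)
    with \<open>x \<in> U\<close> show "x \<in> \<Union>\<F>" by blast
  qed
qed

section \<open>Three-term recurrences and what they determine\<close>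

lemma jacobi_szegoD:
  assumes "jacobi_szego M P \<alpha> \<omega>"
  shows "monic_orthogonal M P"
    and "x * poly (P n) x = poly (P (Suc n)) x + \<alpha> n * poly (P n) x
           + (if n = 0 then 0 else \<omega> n * poly (P (n - 1)) x)"
    and "n \<ge> 1 \<Longrightarrow> \<omega> n \<ge> 0"
proof -
  have "poly ([:0, 1:] * P n) x = poly (P (Suc n) + smult (\<alpha> n) (P n)
      + (if n = 0 then 0 else smult (\<omega> n) (P (n - 1)))) x"
    using assms unfolding jacobi_szego_def by metis
  then show "x * poly (P n) x = poly (P (Suc n)) x + \<alpha> n * poly (P n) x
           + (if n = 0 then 0 else \<omega> n * poly (P (n - 1)) x)"
    by (cases "n = 0") simp_all
qed (use assms in \<open>auto simp: jacobi_szego_def\<close>)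

text \<open>
  For a measure of finite support, agreement almost everywhere does not by itself determine the
  polynomials, but positivity of \<open>\<omega>'\<close> forces all the norms to be positive.
\<close>
lemma recurrence_determined_AE:
  assumes M: "prob_space M" "has_moments M" and P: "jacobi_szego M P \<alpha> \<omega>"
    and Q0: "\<And>x. poly (Q 0) x = 1"
    and Q: "\<And>n x. x * poly (Q n) x = poly (Q (Suc n)) x + \<alpha>' n * poly (Q n) x
           + (if n = 0 then 0 else \<omega>' n * poly (Q (n - 1)) x)"
    and \<omega>': "\<And>n. n \<ge> 1 \<Longrightarrow> \<omega>' n > 0"
    and AE: "\<And>n. AE x in M. poly (P n) x = poly (Q n) x"
  shows "P = Q"
proof -
  note orth = monic_orthogonalD(5)[OF jacobi_szegoD(1)[OF P]]
  note P0 = monic_orthogonal_0[OF jacobi_szegoD(1)[OF P]]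
  note rec = jacobi_szegoD(2)[OF P]
  define N where "N n = (\<integral>x. poly (P n) x * poly (P n) x \<partial>M)" for n
  note int = integrable_poly_mult[OF M(2)]
  have diag: "(\<integral>x. poly (P m) x * poly (P n) x \<partial>M) = (if m = n then N n else 0)" for m n
    using orth[of m n] by (auto simp: N_def)
  \<comment> \<open>The coefficients are left arbitrary and the recurrence is required only almost
    everywhere, so that both the recurrence of P and the one inherited from Q can be
    inserted.\<close>
  have shift: "(\<integral>x. (x * poly (P n) x) * poly (P m) x \<partial>M)
      = (if Suc n = m then N m else 0) + a * (if n = m then N m else 0)
        + (if n = 0 then 0 else w * (if n - 1 = m then N m else 0))"
    if r: "AE x in M. x * poly (P n) x = poly (P (Suc n)) x + a * poly (P n) x
           + (if n = 0 then 0 else w * poly (P (n - 1)) x)" for n m and a w :: real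
  proof -
    have "(\<integral>x. (x * poly (P n) x) * poly (P m) x \<partial>M)
        = (\<integral>x. poly (P (Suc n)) x * poly (P m) x + a * (poly (P n) x * poly (P m) x)
           + (if n = 0 then 0 else w) * (poly (P (n - 1)) x * poly (P m) x) \<partial>M)"
    proof (rule integral_cong_AE)
      have "integrable M (\<lambda>x. (x * poly (P n) x) * poly (P m) x)"
        using int[of "[:0,1:] * P n" "P m"] by simp
      then show "(\<lambda>x. (x * poly (P n) x) * poly (P m) x) \<in> borel_measurable M" by simp
      show "AE x in M. (x * poly (P n) x) * poly (P m) x = poly (P (Suc n)) x * poly (P m) x
           + a * (poly (P n) x * poly (P m) x)
           + (if n = 0 then 0 else w) * (poly (P (n - 1)) x * poly (P m) x)"
        using r by eventually_elim (auto simp: algebra_simps)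
    qed (intro borel_measurable_integrable Bochner_Integration.integrable_add integrable_mult_right int)
    then show ?thesis
      using int by (simp add: diag)
  qed
  have r1: "AE x in M. x * poly (P n) x = poly (P (Suc n)) x + \<alpha> n * poly (P n) x
           + (if n = 0 then 0 else \<omega> n * poly (P (n - 1)) x)" for n
    using rec by simp
  have r2: "AE x in M. x * poly (P n) x = poly (P (Suc n)) x + \<alpha>' n * poly (P n) x
           + (if n = 0 then 0 else \<omega>' n * poly (P (n - 1)) x)" for n
    using AE[of n] AE[of "Suc n"] AE[of "n - 1"] by eventually_elim (simp add: Q)
  \<comment> \<open>Multiplication by x is symmetric: the recurrence of P at n yields the left side,
    the one inherited from Q at n + 1 yields the right side.\<close>
  have step: "N (Suc n) = \<omega>' (Suc n) * N n" for n
  proof -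
    have "(\<integral>x. (x * poly (P n) x) * poly (P (Suc n)) x \<partial>M)
        = (\<integral>x. (x * poly (P (Suc n)) x) * poly (P n) x \<partial>M)"
      by (simp add: ac_simps)
    moreover have "\<dots> = \<omega>' (Suc n) * N n"
      using shift[OF r2[of "Suc n"], of n] by simp
    ultimately show ?thesis
      using shift[OF r1[of n], of "Suc n"] by (cases n) simp_all
  qed
  have "N 0 = 1"
    using M by (simp add: N_def P0 prob_space.prob_space)
  then have pos: "N n > 0" for n
    by (induction n) (simp_all add: step \<omega>')
  have "\<alpha> n = \<alpha>' n" for n
    using shift[OF r1[of n], of n] shift[OF r2[of n], of n] pos[of n] by (cases n) auto
  moreover have "\<omega> (Suc n) = \<omega>' (Suc n)" for n
    using shift[OF r1[of "Suc n"], of n] shift[OF r2[of "Suc n"], of n] pos[of n] by auto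
  ultimately have rec': "x * poly (P n) x = poly (P (Suc n)) x + \<alpha>' n * poly (P n) x
           + (if n = 0 then 0 else \<omega>' n * poly (P (n - 1)) x)" for n x
    using rec[of x n] by (cases n) auto
  have "\<forall>x. poly (P n) x = poly (Q n) x" for n
  proof (induction n rule: less_induct)
    case (less n)
    show ?case
    proof (cases n)
      case 0
      then show ?thesis using P0 Q0 by simp
    next
      case (Suc m)
      then show ?thesis
        using rec'[of _ m] Q[of _ m] less[of m] less[of "m - 1"] by (cases "m = 0") auto
    qed
  qed
  then show ?thesis by (metis ext poly_eq_poly_eq_iff)
qed

section \<open>Gegenbauer polynomials\<close>

fun gegenbauer :: "real \<Rightarrow> nat \<Rightarrow> real poly" where
  "gegenbauer l 0 = 1"
| "gegenbauer l (Suc 0) = [:0, 2 * l:]"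
| "gegenbauer l (Suc (Suc n)) = smult (1 / (real n + 2))
     (smult (2 * (real n + 1 + l)) ([:0, 1:] * gegenbauer l (Suc n))
      - smult (real n + 2 * l) (gegenbauer l n))"

lemma gegenbauer_rec:
  "(real n + 2) * poly (gegenbauer l (Suc (Suc n))) x =
     2 * (real n + 1 + l) * x * poly (gegenbauer l (Suc n)) x
     - (real n + 2 * l) * poly (gegenbauer l n) x"
  by (simp add: divide_simps)

lemma pderiv_gegenbauer_rec:
  "(real n + 2) * poly (pderiv (gegenbauer l (Suc (Suc n)))) x =
     2 * (real n + 1 + l) * (poly (gegenbauer l (Suc n)) x + x * poly (pderiv (gegenbauer l (Suc n))) x)
     - (real n + 2 * l) * poly (pderiv (gegenbauer l n)) x"
  by (simp add: pderiv_smult pderiv_diff pderiv_mult pderiv_pCons divide_simps)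
    (simp add: algebra_simps)

declare gegenbauer.simps(3) [simp del]

text \<open>The two identities have to be proved together: the second at n + 1 comes from the first
  at n, and the first at n + 1 from the new second one and both old ones.\<close>

lemma gegenbauer_contiguous:
  "(real n + 1) * poly (gegenbauer l (Suc n)) x =
     x * poly (pderiv (gegenbauer l (Suc n))) x - poly (pderiv (gegenbauer l n)) x"
  "poly (pderiv (gegenbauer l (Suc n))) x =
     x * poly (pderiv (gegenbauer l n)) x + (real n + 2 * l) * poly (gegenbauer l n) x"
proof (induction n)
  case 0
  case 1
  show ?case by (simp add: pderiv_pCons)
  case 2
  show ?case by (simp add: pderiv_pCons)
next
  case (Suc n)
  define c0 c1 c2 d0 d1 d2 where defs:
    "c0 = poly (gegenbauer l n) x" "c1 = poly (gegenbauer l (Suc n)) x"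
    "c2 = poly (gegenbauer l (Suc (Suc n))) x" "d0 = poly (pderiv (gegenbauer l n)) x"
    "d1 = poly (pderiv (gegenbauer l (Suc n))) x"
    "d2 = poly (pderiv (gegenbauer l (Suc (Suc n)))) x"
  have I: "(real n + 1) * c1 = x * d1 - d0" and II: "d1 = x * d0 + (real n + 2 * l) * c0"
    using Suc unfolding defs by blast+
  have r: "(real n + 2) * c2 = 2 * (real n + 1 + l) * x * c1 - (real n + 2 * l) * c0"
    unfolding defs by (rule gegenbauer_rec)
  have r': "(real n + 2) * d2 = 2 * (real n + 1 + l) * (c1 + x * d1) - (real n + 2 * l) * d0"
    unfolding defs by (rule pderiv_gegenbauer_rec)
  have d0: "d0 = x * d1 - (real n + 1) * c1" using I by simp
  have "(real n + 2) * d2 = (real n + 2) * (x * d1 + (real n + 1 + 2 * l) * c1)"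
    unfolding r' d0 by algebra
  then have d2: "d2 = x * d1 + (real n + 1 + 2 * l) * c1"
    by (simp only: mult_cancel_left) linarith
  have "(real n + 2) * c2 = x * d2 - d1"
    using II I unfolding r d2 by algebra
  then show "(real (Suc n) + 1) * poly (gegenbauer l (Suc (Suc n))) x =
     x * poly (pderiv (gegenbauer l (Suc (Suc n)))) x - poly (pderiv (gegenbauer l (Suc n))) x"
    unfolding defs by (simp add: add.commute)
  from d2 show "poly (pderiv (gegenbauer l (Suc (Suc n)))) x =
     x * poly (pderiv (gegenbauer l (Suc n))) x + (real (Suc n) + 2 * l) * poly (gegenbauer l (Suc n)) x"
    unfolding defs by (simp add: add.commute add.left_commute)
qed

text \<open>The contiguous relations combine to (1 - x^2) q' = (m + 2 l) p - (m + 1) x q for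
  consecutive polynomials p and q. Differentiating once and eliminating p' leaves an equation in q
  alone.\<close>

lemma gegenbauer_ode:
  "(1 - x\<^sup>2) * poly (pderiv (pderiv (gegenbauer l n))) x
     - (2 * l + 1) * x * poly (pderiv (gegenbauer l n)) x
     + real n * (real n + 2 * l) * poly (gegenbauer l n) x = 0"
proof (cases n)
  case 0
  then show ?thesis by simp
next
  case (Suc m)
  define p where "p = gegenbauer l m"
  define q where "q = gegenbauer l (Suc m)"
  have I: "(real m + 1) * poly q x = x * poly (pderiv q) x - poly (pderiv p) x" for x
    unfolding p_def q_def by (rule gegenbauer_contiguous)
  have II: "poly (pderiv q) x = x * poly (pderiv p) x + (real m + 2 * l) * poly p x" for x
    unfolding p_def q_def by (rule gegenbauer_contiguous)
  have "poly ([:1, 0, -1:] * pderiv q) x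
      = poly (smult (real m + 2 * l) p - smult (real m + 1) ([:0, 1:] * q)) x" for x
  proof -
    have "(1 - x * x) * poly (pderiv q) x = (real m + 2 * l) * poly p x - (real m + 1) * x * poly q x"
      using I[of x] II[of x] by algebra
    then show ?thesis by (simp add: algebra_simps)
  qed
  then have "[:1, 0, -1:] * pderiv q
      = smult (real m + 2 * l) p - smult (real m + 1) ([:0, 1:] * q)"
    by (metis ext poly_eq_poly_eq_iff)
  then have "poly (pderiv ([:1, 0, -1:] * pderiv q)) x
      = poly (pderiv (smult (real m + 2 * l) p - smult (real m + 1) ([:0, 1:] * q))) x"
    by simp
  then have "(1 - x\<^sup>2) * poly (pderiv (pderiv q)) x - 2 * x * poly (pderiv q) x
      = (real m + 2 * l) * poly (pderiv p) x - (real m + 1) * (poly q x + x * poly (pderiv q) x)"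
    unfolding pderiv_mult pderiv_diff pderiv_smult poly_add poly_mult poly_diff poly_smult
    by (simp add: pderiv_pCons power2_eq_square) (simp add: algebra_simps)
  moreover have "poly (pderiv p) x = x * poly (pderiv q) x - (real m + 1) * poly q x"
    using I[of x] by simp
  ultimately have "(1 - x\<^sup>2) * poly (pderiv (pderiv q)) x - (2 * l + 1) * x * poly (pderiv q) x
     + (real m + 1) * (real m + 1 + 2 * l) * poly q x = 0"
    by algebra
  then show ?thesis by (simp add: Suc q_def algebra_simps)
qed

lemma degree_gegenbauer_le: "degree (gegenbauer l n) \<le> n"
proof (induction l n rule: gegenbauer.induct)
  case (3 l n)
  have "degree ([:0, 1:] * gegenbauer l (Suc n)) \<le> Suc (Suc n)"
    using degree_mult_le[of "[:0, 1:]" "gegenbauer l (Suc n)"] 3 by simp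
  then show ?case
    using 3 unfolding gegenbauer.simps
    by (intro degree_diff_le degree_smult_le[THEN le_trans]) auto
qed auto

lemma coeff_gegenbauer:
  "coeff (gegenbauer l n) n = 2 ^ n * pochhammer l n / fact n"
proof (induction l n rule: gegenbauer.induct)
  case (3 l n)
  have "coeff (gegenbauer l n) (Suc (Suc n)) = 0"
    using degree_gegenbauer_le[of l n] by (intro coeff_eq_0) simp
  then have "coeff (gegenbauer l (Suc (Suc n))) (Suc (Suc n))
      = (1 / (real n + 2)) * (2 * (real n + 1 + l)) * coeff (gegenbauer l (Suc n)) (Suc n)"
    by (simp add: gegenbauer.simps)
  also have "\<dots> = 2 ^ Suc (Suc n) * pochhammer l (Suc (Suc n)) / fact (Suc (Suc n))"
    unfolding 3 by (simp add: pochhammer_Suc field_simps)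
  finally show ?case .
qed auto

text \<open>These are the coefficients of (1 + e z) (1 - 2 x z + z^2)^(-l) in powers of z. The first
  clause amounts to reading the Gegenbauer polynomial of index -1 as 0.\<close>

fun gegenbauer_sum :: "real \<Rightarrow> real \<Rightarrow> nat \<Rightarrow> real poly" where
  "gegenbauer_sum l e 0 = 1"
| "gegenbauer_sum l e (Suc n) = gegenbauer l (Suc n) + smult e (gegenbauer l n)"

text \<open>Multiplying C_n + e C_(n-1) by x term by term gives four consecutive Gegenbauer
  polynomials. They regroup into three sums because e squares to 1 and because the two coefficients
  in the expansion of x C_n add up to 1.\<close>

lemma gegenbauer_sum_rec:
  assumes l: "l > 1/2" and e: "e * e = 1"
  shows "x * poly (gegenbauer_sum l e n) x =
      (real n + 1) / (2 * (real n + l)) * poly (gegenbauer_sum l e (Suc n)) x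
      + e / 2 * (real n / (real n + l - 1) - (real n + 1) / (real n + l)) * poly (gegenbauer_sum l e n) x
      + (if n = 0 then 0
         else (real n + 2 * l - 2) / (2 * (real n + l - 1)) * poly (gegenbauer_sum l e (n - 1)) x)"
proof -
  have c: "x * poly (gegenbauer l (Suc n)) x = (real n + 2) / (2 * (real n + 1 + l)) * poly (gegenbauer l (Suc (Suc n))) x
      + (real n + 2 * l) / (2 * (real n + 1 + l)) * poly (gegenbauer l n) x" for n
  proof -
    have "real n + 1 + l \<noteq> 0" using l by linarith
    have "x * poly (gegenbauer l (Suc n)) x = (2 * (real n + 1 + l) * x * poly (gegenbauer l (Suc n)) x)
        / (2 * (real n + 1 + l))"
      using \<open>real n + 1 + l \<noteq> 0\<close> by simp
    also have "\<dots> = ((real n + 2) * poly (gegenbauer l (Suc (Suc n))) x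
        + (real n + 2 * l) * poly (gegenbauer l n) x) / (2 * (real n + 1 + l))"
      using gegenbauer_rec[of n l x] by (intro arg_cong2[where f = "(/)"]) simp_all
    finally show ?thesis
      by (simp only: add_divide_distrib distrib_right times_divide_eq_left)
  qed
  show ?thesis
  proof (cases n)
    case 0
    then show ?thesis using l by (simp add: field_simps)
  next
    case 3: (Suc m)
    define k where "k = real m"
    \<comment> \<open>The value 0 stands for the missing polynomial of index -1, so that
      \<open>m = 0\<close> needs no separate calculation later.\<close>
    define c0 where "c0 = (if m = 0 then 0 else poly (gegenbauer l (m - 1)) x)"
    define c1 c2 c3 where defs: "c1 = poly (gegenbauer l m) x"
      "c2 = poly (gegenbauer l (Suc m)) x" "c3 = poly (gegenbauer l (Suc (Suc m))) x"
    have 1: "x * c1 = (k + 1) / (2 * (k + l)) * c2 + (k - 1 + 2 * l) / (2 * (k + l)) * c0"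
    proof (cases m)
      case 0
      then show ?thesis using l by (simp add: defs c0_def k_def)
    next
      case (Suc i)
      then show ?thesis using c[of i] by (simp add: defs c0_def k_def algebra_simps)
    qed
    have 2: "x * c2 = (k + 2) / (2 * (k + 1 + l)) * c3 + (k + 2 * l) / (2 * (k + 1 + l)) * c1"
      using c[of m] by (simp add: defs k_def)
    have nz: "k + l \<noteq> 0" "k + 1 + l \<noteq> 0" using l by (auto simp: k_def)
    define i j where "i = 1 / (2 * (k + l))" and "j = 1 / (2 * (k + 1 + l))"
    have i: "i * (2 * (k + l)) = 1" and j: "j * (2 * (k + 1 + l)) = 1"
      using nz by (simp_all add: i_def j_def)
    have 1: "x * c1 = (k + 1) * i * c2 + (k - 1 + 2 * l) * i * c0"
      using 1 by (simp add: i_def)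
    have 2: "x * c2 = (k + 2) * j * c3 + (k + 2 * l) * j * c1"
      using 2 by (simp add: j_def)
    have main: "x * (c2 + e * c1) = (k + 2) * j * (c3 + e * c2)
        + e * ((k + 1) * i - (k + 2) * j) * (c2 + e * c1) + (k - 1 + 2 * l) * i * (c1 + e * c0)"
    proof -
      have "e * (e * c1) = c1" using e by (simp flip: mult.assoc)
      moreover have "(k + 2 * l) * j = 1 - (k + 2) * j" using j by algebra
      moreover have "(k - 1 + 2 * l) * i = 1 - (k + 1) * i" using i by algebra
      ultimately have h: "(k + 2 * l) * j * c1
          = ((k + 1) * i - (k + 2) * j) * (e * (e * c1)) + (k - 1 + 2 * l) * i * c1"
        by (simp only:) (simp add: left_diff_distrib)
      have "x * (c2 + e * c1) = x * c2 + e * (x * c1)" by algebra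
      then show ?thesis unfolding 1 2 h by algebra
    qed
    have s: "poly (gegenbauer_sum l e (Suc n)) x = c3 + e * c2"
      "poly (gegenbauer_sum l e n) x = c2 + e * c1"
      "poly (gegenbauer_sum l e (n - 1)) x = c1 + e * c0"
      unfolding 3 defs c0_def by (simp, simp, cases m, simp_all)
    have n: "real n = k + 1" by (simp add: 3 k_def)
    have co: "(real n + 1) / (2 * (real n + l)) = (k + 2) * j"
      "e / 2 * (real n / (real n + l - 1) - (real n + 1) / (real n + l)) = e * ((k + 1) * i - (k + 2) * j)"
      "(real n + 2 * l - 2) / (2 * (real n + l - 1)) = (k - 1 + 2 * l) * i"
    proof -
      have "(k + 1) / (k + l) = (k + 1) * i * 2" "(k + 2) / (k + 1 + l) = (k + 2) * j * 2"
      proof -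
        have half: "u / v = u * (1 / (2 * v)) * 2" for u v :: real by simp
        show "(k + 1) / (k + l) = (k + 1) * i * 2" "(k + 2) / (k + 1 + l) = (k + 2) * j * 2"
          unfolding i_def j_def by (rule half)+
      qed
      then have "e / 2 * ((k + 1) / (k + l) - (k + 2) / (k + 1 + l)) = e * ((k + 1) * i - (k + 2) * j)"
        by (simp only:) (simp add: algebra_simps)
      moreover have "k + 1 + l - 1 = k + l" "k + 1 + 1 = k + 2" by simp_all
      ultimately show "e / 2 * (real n / (real n + l - 1) - (real n + 1) / (real n + l))
          = e * ((k + 1) * i - (k + 2) * j)"
        unfolding n by (simp only:)
    qed (use nz in \<open>simp_all add: n i_def j_def field_simps\<close>)
    have "n \<noteq> 0" by (simp add: 3)
    then show ?thesis unfolding co s using main by (simp only: if_False)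
  qed
qed

text \<open>For \<open>e = 1\<close> and \<open>e = -1\<close> this is the monic Jacobi polynomial
  with exponents l - 1 + e/2 and l - 1 - e/2; the factor is the reciprocal of the leading
  coefficient of the Gegenbauer polynomial.\<close>

definition jacobi_monic :: "real \<Rightarrow> real \<Rightarrow> nat \<Rightarrow> real poly" where
  "jacobi_monic l e n = smult (fact n / (2 ^ n * pochhammer l n)) (gegenbauer_sum l e n)"

lemma jacobi_monic_degree:
  assumes "l > 0"
  shows "degree (jacobi_monic l e n) = n" "lead_coeff (jacobi_monic l e n) = 1"
proof -
  have "degree (gegenbauer_sum l e n) \<le> n"
    using degree_gegenbauer_le[of l "n - 1"] degree_gegenbauer_le[of l n]
    by (cases n) (auto intro!: degree_add_le degree_smult_le[THEN le_trans])
  then have le: "degree (jacobi_monic l e n) \<le> n"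
    unfolding jacobi_monic_def using degree_smult_le le_trans by blast
  have "coeff (gegenbauer_sum l e n) n = 2 ^ n * pochhammer l n / fact n"
  proof (cases n)
    case (Suc m)
    have "coeff (gegenbauer l m) (Suc m) = 0"
      using degree_gegenbauer_le[of l m] by (intro coeff_eq_0) simp
    then show ?thesis using Suc by (simp add: coeff_gegenbauer)
  qed simp
  then have 1: "coeff (jacobi_monic l e n) n = 1"
    using pochhammer_pos[OF assms, of n] by (simp add: jacobi_monic_def)
  with le show "degree (jacobi_monic l e n) = n"
    by (metis le_antisym le_degree zero_neq_one)
  with 1 show "lead_coeff (jacobi_monic l e n) = 1" by simp
qed

lemma jacobi_monic_rec:
  assumes l: "l > 1/2" and e: "e * e = 1"
  shows "x * poly (jacobi_monic l e n) x = poly (jacobi_monic l e (Suc n)) x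
      + e / 2 * (real n / (real n + l - 1) - (real n + 1) / (real n + l)) * poly (jacobi_monic l e n) x
      + (if n = 0 then 0 else real n * (real n + 2 * l - 2) / (4 * (real n + l - 1)\<^sup>2)
           * poly (jacobi_monic l e (n - 1)) x)"
proof -
  define r where "r n = fact n / (2 ^ n * pochhammer l n)" for n
  have r: "r (Suc n) = r n * ((real n + 1) / (2 * (real n + l)))" for n
    by (simp add: r_def pochhammer_Suc ac_simps)
  have J: "poly (jacobi_monic l e n) x = r n * poly (gegenbauer_sum l e n) x" for n
    by (simp add: jacobi_monic_def r_def)
  define a where "a = (real n + 1) / (2 * (real n + l))"
  define b where "b = e / 2 * (real n / (real n + l - 1) - (real n + 1) / (real n + l))"
  define q where "q = (real n + 2 * l - 2) / (2 * (real n + l - 1))"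
  define w where "w = real n * (real n + 2 * l - 2) / (4 * (real n + l - 1)\<^sup>2)"
  have w: "r n * q = w * r (n - 1)" if "n \<noteq> 0"
  proof -
    obtain m where "n = Suc m" using \<open>n \<noteq> 0\<close> by (cases n) auto
    define y where "y = real m + l"
    have "real n + l - 1 = y" using \<open>n = Suc m\<close> by (simp add: y_def)
    moreover have "r n = r m * (real n / (2 * y))" using r[of m] \<open>n = Suc m\<close> by (simp add: y_def)
    ultimately show ?thesis unfolding q_def w_def using \<open>n = Suc m\<close> by (simp add: power2_eq_square)
  qed
  have "x * poly (jacobi_monic l e n) x = r n * (x * poly (gegenbauer_sum l e n) x)"
    by (simp add: J)
  also have "\<dots> = r n * (a * poly (gegenbauer_sum l e (Suc n)) x + b * poly (gegenbauer_sum l e n) x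
      + (if n = 0 then 0 else q * poly (gegenbauer_sum l e (n - 1)) x))"
    unfolding a_def b_def q_def gegenbauer_sum_rec[OF assms, symmetric] ..
  also have "\<dots> = (r n * a) * poly (gegenbauer_sum l e (Suc n)) x
      + b * (r n * poly (gegenbauer_sum l e n) x)
      + (if n = 0 then 0 else w * (r (n - 1) * poly (gegenbauer_sum l e (n - 1)) x))"
  proof (cases "n = 0")
    case False
    have "r n * (q * poly (gegenbauer_sum l e (n - 1)) x)
        = w * (r (n - 1) * poly (gegenbauer_sum l e (n - 1)) x)"
      using w[OF False] by (simp flip: mult.assoc)
    with False show ?thesis by (simp only: if_False distrib_left ac_simps)
  qed (simp add: algebra_simps)
  finally show ?thesis
    unfolding J by (simp only: r a_def b_def w_def)
qed

text \<open>This is the Jacobi equation with a = l - 1 + e/2 and b = l - 1 - e/2, since b - a = -e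
  and a + b + 2 = 2 l. The Gegenbauer equations of the two summands have the coefficient 2 l + 1 and
  different eigenvalues; the contiguous relations convert the excess derivatives into the missing
  multiples, using e^2 = 1.\<close>

lemma jacobi_monic_ode:
  assumes e: "e * e = 1"
  shows "(1 - x\<^sup>2) * poly (pderiv (pderiv (jacobi_monic l e n))) x
     - (e + 2 * l * x) * poly (pderiv (jacobi_monic l e n)) x
     = - (real n * (real n + 2 * l - 1)) * poly (jacobi_monic l e n) x"
proof -
  have "(1 - x\<^sup>2) * poly (pderiv (pderiv (gegenbauer_sum l e n))) x
     - (e + 2 * l * x) * poly (pderiv (gegenbauer_sum l e n)) x
     = - (real n * (real n + 2 * l - 1)) * poly (gegenbauer_sum l e n) x"
  proof (cases n)
    case (Suc m)
    define p q where "p = gegenbauer l m" and "q = gegenbauer l (Suc m)"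
    have I: "(real m + 1) * poly q x = x * poly (pderiv q) x - poly (pderiv p) x"
      and II: "poly (pderiv q) x = x * poly (pderiv p) x + (real m + 2 * l) * poly p x"
      unfolding p_def q_def by (rule gegenbauer_contiguous)+
    have "(1 - x\<^sup>2) * poly (pderiv (pderiv p)) x - (2 * l + 1) * x * poly (pderiv p) x
       + real m * (real m + 2 * l) * poly p x = 0"
      unfolding p_def by (rule gegenbauer_ode)
    moreover have "(1 - x\<^sup>2) * poly (pderiv (pderiv q)) x - (2 * l + 1) * x * poly (pderiv q) x
       + (real m + 1) * (real m + 1 + 2 * l) * poly q x = 0"
      using gegenbauer_ode[of x l "Suc m"] by (simp add: q_def algebra_simps)
    ultimately have p2: "(1 - x\<^sup>2) * poly (pderiv (pderiv p)) x
        = (2 * l + 1) * x * poly (pderiv p) x - real m * (real m + 2 * l) * poly p x"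
      and q2: "(1 - x\<^sup>2) * poly (pderiv (pderiv q)) x
        = (2 * l + 1) * x * poly (pderiv q) x - (real m + 1) * (real m + 1 + 2 * l) * poly q x"
      by linarith+
    have "e * (e * poly (pderiv p) x) = poly (pderiv p) x"
      using e by (simp flip: mult.assoc)
    moreover have "e * poly (pderiv q) x = e * (x * poly (pderiv p) x + (real m + 2 * l) * poly p x)"
      using II by simp
    moreover have "(1 - x\<^sup>2) * (poly (pderiv (pderiv q)) x + e * poly (pderiv (pderiv p)) x)
       - (e + 2 * l * x) * (poly (pderiv q) x + e * poly (pderiv p) x)
       = ((2 * l + 1) * x * poly (pderiv q) x - (real m + 1) * (real m + 1 + 2 * l) * poly q x)
       + e * ((2 * l + 1) * x * poly (pderiv p) x - real m * (real m + 2 * l) * poly p x)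
       - (e * poly (pderiv q) x + e * (e * poly (pderiv p) x)
          + 2 * l * x * (poly (pderiv q) x + e * poly (pderiv p) x))"
      unfolding p2[symmetric] q2[symmetric] by algebra
    ultimately have "(1 - x\<^sup>2) * (poly (pderiv (pderiv q)) x + e * poly (pderiv (pderiv p)) x)
       - (e + 2 * l * x) * (poly (pderiv q) x + e * poly (pderiv p) x)
       = ((2 * l + 1) * x * poly (pderiv q) x - (real m + 1) * (real m + 1 + 2 * l) * poly q x)
       + e * ((2 * l + 1) * x * poly (pderiv p) x - real m * (real m + 2 * l) * poly p x)
       - (e * (x * poly (pderiv p) x + (real m + 2 * l) * poly p x) + poly (pderiv p) x
          + 2 * l * x * (poly (pderiv q) x + e * poly (pderiv p) x))"
      by (simp only:)
    also have "\<dots> = - ((real m + 1) * (real m + 1 + 2 * l - 1)) * (poly q x + e * poly p x)"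
      using I by algebra
    finally have "(1 - x\<^sup>2) * (poly (pderiv (pderiv q)) x + e * poly (pderiv (pderiv p)) x)
       - (e + 2 * l * x) * (poly (pderiv q) x + e * poly (pderiv p) x)
       = - ((real m + 1) * (real m + 1 + 2 * l - 1)) * (poly q x + e * poly p x)" .
    then show ?thesis
      unfolding Suc by (simp add: p_def q_def pderiv_add pderiv_smult ac_simps)
  qed simp
  then have *: "r * ((1 - x\<^sup>2) * poly (pderiv (pderiv (gegenbauer_sum l e n))) x
     - (e + 2 * l * x) * poly (pderiv (gegenbauer_sum l e n)) x)
     = r * (- (real n * (real n + 2 * l - 1)) * poly (gegenbauer_sum l e n) x)" for r
    by simp
  then show ?thesis
    unfolding jacobi_monic_def pderiv_smult poly_smult
    using *[of "fact n / (2 ^ n * pochhammer l n)"] by (simp only: right_diff_distrib mult.left_commute)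
qed

section \<open>Jacobi measures\<close>

definition jacobi_weight :: "real \<Rightarrow> real \<Rightarrow> real \<Rightarrow> real" where
  "jacobi_weight a b x = (1 - x) powr a * (1 + x) powr b * indicator {-1..1} x"

lemma jacobi_weight_measurable [measurable]: "jacobi_weight a b \<in> borel_measurable borel"
  unfolding jacobi_weight_def[abs_def] by measurable

lemma jacobi_weight_nonneg: "jacobi_weight a b x \<ge> 0"
  by (simp add: jacobi_weight_def)

lemma jacobi_measure_eq: "jacobi_measure a b = density lborel (\<lambda>x. ennreal (jacobi_weight a b x))"
  by (simp add: jacobi_measure_def jacobi_weight_def)

text \<open>The substitution t = (1 + x)/2 turns the weight into a multiple of the Beta integrand.
  Nonnegativity passes from the gauge integral to absolute integrability, and Borel measurability
  from the completed measure to \<open>lborel\<close>.\<close>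

lemma integrable_jacobi_weight:
  assumes "a > -1" "b > -1"
  shows "integrable lborel (jacobi_weight a b)"
proof -
  define g :: "real \<Rightarrow> real" where "g t = t powr b * (1 - t) powr a" for t
  have "(g has_integral Beta (b + 1) (a + 1)) {0..1}"
    using has_integral_Beta_real[of "b + 1" "a + 1"] assms by (simp add: g_def[abs_def])
  then have "g absolutely_integrable_on {0..1}"
    by (intro nonnegative_absolutely_integrable_1) (auto simp: g_def integrable_on_def)
  then have "integrable (completion lborel) (\<lambda>t. indicator {0..1} t *\<^sub>R g t)"
    by (simp add: set_integrable_def)
  moreover have "(\<lambda>t. indicator {0..1} t *\<^sub>R g t) \<in> borel_measurable lborel"
    unfolding g_def by measurable
  ultimately have "integrable lborel (\<lambda>t. indicator {0..1} t *\<^sub>R g t)"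
    by (simp add: integrable_completion)
  then have "integrable lborel (\<lambda>x. indicator {0..1} (1/2 + (1/2) * x) *\<^sub>R g (1/2 + (1/2) * x))"
    by (rule lborel_integrable_real_affine) simp
  then have "integrable lborel (\<lambda>x. 2 powr a * 2 powr b *
      (indicator {0..1} (1/2 + (1/2) * x) *\<^sub>R g (1/2 + (1/2) * x)))"
    by (rule integrable_mult_right)
  moreover have "2 powr a * 2 powr b * (indicator {0..1} (1/2 + (1/2) * x) *\<^sub>R g (1/2 + (1/2) * x))
      = jacobi_weight a b x" for x
  proof (cases "x \<in> {-1..1}")
    case True
    then have "g (1/2 + (1/2) * x) = ((1 + x) / 2) powr b * ((1 - x) / 2) powr a"
      by (simp add: g_def add_divide_distrib diff_divide_distrib)
    also have "\<dots> = (1 + x) powr b / 2 powr b * ((1 - x) powr a / 2 powr a)"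
      using True by (simp add: powr_divide)
    finally show ?thesis using True by (simp add: jacobi_weight_def field_simps)
  qed (auto simp: jacobi_weight_def indicator_def)
  ultimately show ?thesis by (simp only:)
qed

lemma integrable_jacobi_weight_mult:
  assumes "a > -1" "b > -1" and "continuous_on UNIV h"
  shows "integrable lborel (\<lambda>x. jacobi_weight a b x * h x)"
proof -
  have "continuous_on {-1..1} h" using assms(3) continuous_on_subset by blast
  then have "bounded (h ` {-1..1})" by (intro compact_imp_bounded compact_continuous_image) auto
  then obtain B where B: "\<And>x. x \<in> {-1..1} \<Longrightarrow> norm (h x) \<le> B"
    unfolding bounded_iff by (metis imageI)
  have [measurable]: "h \<in> borel_measurable borel"
    using assms(3) by (rule borel_measurable_continuous_onI)
  show ?thesis
  proof (rule Bochner_Integration.integrable_bound)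
    show "integrable lborel (\<lambda>x. B * jacobi_weight a b x)"
      using integrable_jacobi_weight[OF assms(1,2)] by simp
    show "AE x in lborel. norm (jacobi_weight a b x * h x) \<le> norm (B * jacobi_weight a b x)"
    proof (rule AE_I2)
      fix x :: real
      show "norm (jacobi_weight a b x * h x) \<le> norm (B * jacobi_weight a b x)"
      proof (cases "x \<in> {-1..1}")
        case True
        have "\<bar>jacobi_weight a b x\<bar> * \<bar>h x\<bar> \<le> \<bar>jacobi_weight a b x\<bar> * \<bar>B\<bar>"
          using B[OF True] by (intro mult_left_mono) auto
        then show ?thesis by (simp add: abs_mult mult.commute)
      qed (simp add: jacobi_weight_def)
    qed
  qed measurable
qed

lemma integral_jacobi_measure:
  assumes "f \<in> borel_measurable borel"
  shows "(\<integral>x. f x \<partial>jacobi_measure a b) = (\<integral>x. jacobi_weight a b x * f x \<partial>lborel)"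
  using assms unfolding jacobi_measure_eq
  by (subst integral_density) (auto simp: jacobi_weight_nonneg)

lemma has_moments_jacobi_measure:
  assumes "a > -1" "b > -1"
  shows "has_moments (jacobi_measure a b)"
proof -
  have "integrable lborel (\<lambda>x. jacobi_weight a b x * x ^ k)" for k
    using assms by (intro integrable_jacobi_weight_mult continuous_intros)
  then show ?thesis
    unfolding has_moments_def jacobi_measure_eq
    by (auto simp: integrable_density jacobi_weight_nonneg)
qed

text \<open>
  The integrand is the derivative of \<open>(1 - x)^(a+1) * (1 + x)^(b+1) * p x\<close>, which vanishes at both
  ends of the interval.
\<close>
lemma jacobi_pearson:
  assumes ab: "a > -1" "b > -1"
  shows "(\<integral>x. jacobi_weight a b x * ((1 - x\<^sup>2) * poly (pderiv p) x
           + (b - a - (a + b + 2) * x) * poly p x) \<partial>lborel) = 0"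
proof -
  define \<Phi> where "\<Phi> x = (1 - x) powr (a + 1) * (1 + x) powr (b + 1) * poly p x" for x
  define \<phi> where "\<phi> x = jacobi_weight a b x * ((1 - x\<^sup>2) * poly (pderiv p) x
           + (b - a - (a + b + 2) * x) * poly p x)" for x
  \<comment> \<open>Derivatives are taken in the interior only: for negative exponents \<Phi> may
    fail to be differentiable at an endpoint, where continuity is enough.\<close>
  have "(\<phi> has_integral (\<Phi> 1 - \<Phi> (-1))) {-1..1}"
  proof (rule fundamental_theorem_of_calculus_interior)
    show "continuous_on {-1..1} \<Phi>"
      unfolding \<Phi>_def using ab by (intro continuous_intros continuous_on_powr') auto
    fix x :: real assume x: "x \<in> {-1<..<1}"
    define A B where "A = (1 - x) powr a" and "B = (1 + x) powr b"
    have pw: "(1 - x) powr (a + 1) = A * (1 - x)" "(1 + x) powr (b + 1) = B * (1 + x)"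
      using x by (simp_all add: A_def B_def powr_add)
    have "(\<Phi> has_real_derivative (- (a + 1) * A * (B * (1 + x)) * poly p x
        + A * (1 - x) * ((b + 1) * B) * poly p x
        + A * (1 - x) * (B * (1 + x)) * poly (pderiv p) x)) (at x)"
      unfolding \<Phi>_def
      apply (rule derivative_eq_intros refl | use x in \<open>simp; fail\<close>)+
      unfolding pw using x by (simp add: A_def B_def powr_diff powr_add field_simps)
    moreover have "\<phi> x = - (a + 1) * A * (B * (1 + x)) * poly p x
        + A * (1 - x) * ((b + 1) * B) * poly p x
        + A * (1 - x) * (B * (1 + x)) * poly (pderiv p) x"
      using x by (simp add: \<phi>_def jacobi_weight_def A_def[symmetric] B_def[symmetric]) algebra
    ultimately show "(\<Phi> has_vector_derivative \<phi> x) (at x)"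
      by (simp add: has_real_derivative_iff_has_vector_derivative)
  qed simp
  moreover have "\<Phi> 1 = 0" "\<Phi> (-1) = 0" using ab by (simp_all add: \<Phi>_def)
  ultimately have "(\<phi> has_integral 0) {-1..1}" by simp
  then have 0: "(\<phi> has_integral 0) UNIV"
    by (rule has_integral_on_superset) (auto simp: \<phi>_def jacobi_weight_def)
  have "integrable lborel \<phi>"
    unfolding \<phi>_def using ab by (intro integrable_jacobi_weight_mult continuous_intros)
  then have "(\<phi> has_integral (\<integral>x. \<phi> x \<partial>lborel)) UNIV"
    by (rule has_integral_integral_lborel)
  with 0 show ?thesis using has_integral_unique by (auto simp: \<phi>_def)
qed

lemma integrable_jacobi_weight_poly:
  assumes "a > -1" "b > -1"
  shows "integrable lborel (\<lambda>x. jacobi_weight a b x * poly p x)"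
  using assms by (intro integrable_jacobi_weight_mult continuous_intros)

text \<open>A Sturm-Liouville argument. Integrating the derivative of the weighted product p' q
  shows that the eigenvalue of p times the integral of p q equals the integral of (1 - x^2) p' q',
  which is symmetric in p and q. Distinct eigenvalues then force the integral of p q to
  vanish.\<close>

lemma monic_orthogonal_jacobi_monic:
  assumes l: "l > 1/2" and e: "e = 1 \<or> e = -1"
  shows "monic_orthogonal (jacobi_measure (l - 1 + e/2) (l - 1 - e/2)) (jacobi_monic l e)"
proof -
  have ee: "e * e = 1" using e by auto
  define a b where "a = l - 1 + e/2" and "b = l - 1 - e/2"
  have ab: "a > -1" "b > -1" using l e by (auto simp: a_def b_def)
  define L where "L p = (\<integral>x. jacobi_weight a b x * poly p x \<partial>lborel)" for p
  have L_add: "L (p + q) = L p + L q" and L_smult: "L (smult c p) = c * L p" for p q c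
    using integrable_jacobi_weight_poly[OF ab]
    by (simp_all add: L_def distrib_left mult.left_commute)
  have "(\<integral>x. poly (jacobi_monic l e n) x * poly (jacobi_monic l e m) x \<partial>jacobi_measure a b) = 0"
    if "n \<noteq> m" for n m
  proof -
    have sym: "real n * (real n + 2 * l - 1) * L (jacobi_monic l e n * jacobi_monic l e m)
        = L ([:1, 0, -1:] * pderiv (jacobi_monic l e n) * pderiv (jacobi_monic l e m))" for n m
    proof -
      define p q where "p = jacobi_monic l e n" and "q = jacobi_monic l e m"
      have "0 = (\<integral>x. jacobi_weight a b x * ((1 - x\<^sup>2) * poly (pderiv (pderiv p * q)) x
           + (b - a - (a + b + 2) * x) * poly (pderiv p * q) x) \<partial>lborel)"
        by (rule jacobi_pearson[OF ab, symmetric])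
      also have "\<dots> = L ([:1, 0, -1:] * pderiv p * pderiv q + smult (- (real n * (real n + 2 * l - 1))) (p * q))"
        unfolding L_def
      proof (rule Bochner_Integration.integral_cong[OF refl])
        fix x
        have "(1 - x\<^sup>2) * poly (pderiv (pderiv p)) x - (e + 2 * l * x) * poly (pderiv p) x
            = - (real n * (real n + 2 * l - 1)) * poly p x"
          unfolding p_def by (rule jacobi_monic_ode[OF ee])
        moreover have "b - a - (a + b + 2) * x = - (e + 2 * l * x)"
          by (simp add: a_def b_def field_simps)
        ultimately have "(1 - x\<^sup>2) * poly (pderiv (pderiv p * q)) x
             + (b - a - (a + b + 2) * x) * poly (pderiv p * q) x
           = (1 - x\<^sup>2) * poly (pderiv p) x * poly (pderiv q) x
             + - (real n * (real n + 2 * l - 1)) * (poly p x * poly q x)"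
          unfolding pderiv_mult poly_mult poly_add by algebra
        then show "jacobi_weight a b x * ((1 - x\<^sup>2) * poly (pderiv (pderiv p * q)) x
             + (b - a - (a + b + 2) * x) * poly (pderiv p * q) x)
           = jacobi_weight a b x * poly ([:1, 0, -1:] * pderiv p * pderiv q
              + smult (- (real n * (real n + 2 * l - 1))) (p * q)) x"
          by (simp add: power2_eq_square left_diff_distrib mult.assoc)
      qed
      finally show ?thesis unfolding L_add L_smult p_def q_def by simp
    qed
    have "real n * (real n + 2 * l - 1) * L (jacobi_monic l e n * jacobi_monic l e m)
        = real m * (real m + 2 * l - 1) * L (jacobi_monic l e n * jacobi_monic l e m)"
      using sym[of n m] sym[of m n] by (simp only: mult.assoc mult.commute mult.left_commute)
    \<comment> \<open>The difference of two eigenvalues factors as (n - m) (n + m + 2 l - 1), and l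
      > 1/2 keeps the second factor positive.\<close>
    moreover have "real n * (real n + 2 * l - 1) \<noteq> real m * (real m + 2 * l - 1)"
    proof
      assume "real n * (real n + 2 * l - 1) = real m * (real m + 2 * l - 1)"
      then have "(real n - real m) * (real n + real m + 2 * l - 1) = 0" by algebra
      then show False using that l by auto
    qed
    ultimately have "L (jacobi_monic l e n * jacobi_monic l e m) = 0" by simp
    then show ?thesis
      by (subst integral_jacobi_measure)
        (auto simp: L_def intro!: borel_measurable_continuous_onI continuous_intros)
  qed
  then show ?thesis
    unfolding monic_orthogonal_def a_def b_def using jacobi_monic_degree[of l e] l by auto
qed

text \<open>If the integral were 0, almost every point of the interval would be one of the finitely
  many roots of p.\<close>

lemma poly_square_integral_nonzero:
  assumes M: "M = density lborel (\<lambda>x. ennreal (w x))" and mom: "has_moments M"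
    and w [measurable]: "w \<in> borel_measurable borel" and w0: "\<And>x. w x \<ge> 0"
    and pos: "\<And>x. x \<in> {a<..<b} \<Longrightarrow> w x > 0" and "a < b" and p: "p \<noteq> 0"
  shows "(\<integral>x. poly p x * poly p x \<partial>M) \<noteq> 0"
proof
  assume "(\<integral>x. poly p x * poly p x \<partial>M) = 0"
  then have "AE x in M. poly p x * poly p x = 0"
    using integral_nonneg_eq_0_iff_AE[OF integrable_poly_mult[OF mom, of p p]] by simp
  then have "AE x in lborel. w x > 0 \<longrightarrow> poly p x = 0"
    unfolding M by (subst (asm) AE_density) (auto simp: w0)
  moreover have "AE x in lborel. x \<notin> {x. poly p x = 0}"
    using poly_roots_finite[OF p] by (intro AE_not_in finite_imp_null_set_lborel)
  ultimately have "AE x in lborel. x \<notin> {a<..<b}"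
    by eventually_elim (use pos in force)
  then have "emeasure lborel {a<..<b} = 0"
    by (subst (asm) AE_iff_measurable[OF _ refl]) (auto simp: greaterThanLessThan_def greaterThan_def lessThan_def Int_def)
  then show False using \<open>a < b\<close> by simp
qed

text \<open>Writing the exponents as l - 1 + e/2 and l - 1 - e/2 covers both pairs of (B) at once:
  the sign of e swaps them. Existence and uniqueness together resolve the definite
  description.\<close>

lemma monic_jacobi_poly_eq:
  assumes l: "l > 1/2" and e: "e = 1 \<or> e = -1"
  shows "monic_jacobi_poly (l - 1 + e/2) (l - 1 - e/2) = jacobi_monic l e"
  unfolding monic_jacobi_poly_def
proof (rule the_equality)
  define a b where "a = l - 1 + e/2" and "b = l - 1 - e/2"
  have ab: "a > -1" "b > -1" using l e by (auto simp: a_def b_def)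
  show o: "monic_orthogonal (jacobi_measure (l - 1 + e/2) (l - 1 - e/2)) (jacobi_monic l e)"
    by (rule monic_orthogonal_jacobi_monic[OF assms])
  fix P assume P: "monic_orthogonal (jacobi_measure (l - 1 + e/2) (l - 1 - e/2)) P"
  show "P = jacobi_monic l e"
  proof (rule monic_orthogonal_unique[OF _ P o])
    show mom: "has_moments (jacobi_measure (l - 1 + e/2) (l - 1 - e/2))"
      using has_moments_jacobi_measure[OF ab] by (simp add: a_def b_def)
    show "(\<integral>x. poly p x * poly p x \<partial>jacobi_measure (l - 1 + e/2) (l - 1 - e/2)) \<noteq> 0"
      if "p \<noteq> 0" for p
      by (rule poly_square_integral_nonzero[OF jacobi_measure_eq mom, where a = "-1" and b = 1])
        (use that in \<open>auto simp: jacobi_weight_nonneg jacobi_weight_def\<close>)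
  qed
qed

section \<open>Generating functions as formal power series\<close>

text \<open>An identity theorem for a set that merely accumulates at 0. A nonzero difference is z^n
  G(z) with G(0) nonzero, so it has no zeros in a punctured neighbourhood of 0, yet S meets every
  such neighbourhood.\<close>

lemma fps_eqI_eval_near_0:
  fixes A B :: "complex fps"
  assumes r: "r > 0" "r \<le> fps_conv_radius A" "r \<le> fps_conv_radius B"
    and S: "0 \<in> closure S" "0 \<notin> S"
    and eq: "\<And>z. z \<in> S \<Longrightarrow> ereal (norm z) < r \<Longrightarrow> eval_fps A z = eval_fps B z"
  shows "A = B"
proof (rule ccontr)
  assume "A \<noteq> B"
  define D where "D = A - B"
  define n where "n = subdegree D"
  define G where "G = fps_shift n D"
  have "D \<noteq> 0" using \<open>A \<noteq> B\<close> by (simp add: D_def)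
  have rD: "r \<le> fps_conv_radius D"
    unfolding D_def using r fps_conv_radius_diff[of A B] by (meson min.boundedI order_trans)
  then have rG: "r \<le> fps_conv_radius G" by (simp add: G_def)
  have "isCont (eval_fps G) 0"
    using continuous_eval_fps[of 0 G UNIV] rG r by (simp add: zero_ereal_def[symmetric])
  moreover have "eval_fps G 0 \<noteq> 0"
    using \<open>D \<noteq> 0\<close> by (simp add: eval_fps_at_0 G_def n_def)
  ultimately have "eventually (\<lambda>z. eval_fps G z \<noteq> 0) (nhds 0)"
    unfolding eventually_nhds_conv_at isCont_def by (blast intro: tendsto_imp_eventually_ne)
  moreover have "eventually (\<lambda>z. z \<in> eball 0 r) (nhds (0 :: complex))"
    using r by (intro eventually_nhds_in_open) (auto simp: zero_ereal_def[symmetric])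
  ultimately have "eventually (\<lambda>z. eval_fps G z \<noteq> 0 \<and> ereal (norm z) < r) (nhds 0)"
    by eventually_elim simp
  then obtain U where U: "open U" "0 \<in> U" "\<And>z. z \<in> U \<Longrightarrow> eval_fps G z \<noteq> 0 \<and> ereal (norm z) < r"
    unfolding eventually_nhds by blast
  then obtain z where z: "z \<in> S" "z \<in> U"
    using S(1) U(1,2) unfolding closure_iff_nhds_not_empty by blast
  then have "ereal (norm z) < r" "eval_fps G z \<noteq> 0" "z \<noteq> 0" using U S(2) by auto
  moreover have "eval_fps D z = 0"
    unfolding D_def using eq[OF z(1)] \<open>ereal (norm z) < r\<close> r
    by (subst eval_fps_diff) auto
  moreover have "ereal (norm z) < fps_conv_radius D"
    using \<open>ereal (norm z) < r\<close> rD by (rule less_le_trans)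
  ultimately show False
    using eval_fps_shift[of n D z] by (auto simp: G_def n_def)
qed

text \<open>With w = f - x one has z w = F - x z and z^2 f' = z F' - F, so the logarithmic
  derivative multiplied by z^2 w contains x only polynomially. The remaining factor -z u'/u is the
  same for all x. A nonzero imaginary part of f keeps w off the branch cut.\<close>

lemma generating_function_log_deriv:
  fixes f u :: "complex \<Rightarrow> complex" and l x :: real
  assumes S: "open S" "z \<in> S" "z \<noteq> 0"
    and u: "u analytic_on S" "u z \<noteq> 0" and f: "f analytic_on S" and Im: "Im (f z) \<noteq> 0"
    and F: "\<And>z. z \<in> S \<Longrightarrow> f z = poly F z / z"
    and r: "ereal (norm z) < r" "r \<le> fps_conv_radius \<Psi>"
    and \<Psi>: "\<And>z. z \<in> S \<Longrightarrow> ereal (norm z) < r \<Longrightarrow> eval_fps \<Psi> z = 1 / (u z * (f z - of_real x) powr of_real l)"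
  shows "z * (poly F z - of_real x * z) * eval_fps (fps_deriv \<Psi>) z
      + of_real l * (z * poly (pderiv F) z - poly F z) * eval_fps \<Psi> z
      = - z * (deriv u z / u z) * ((poly F z - of_real x * z) * eval_fps \<Psi> z)"
proof -
  define T where "T = S \<inter> eball 0 r"
  have T: "open T" "z \<in> T" using S r by (auto simp: T_def)
  have du: "(u has_field_derivative deriv u z) (at z)"
    using u(1) S by (metis analytic_on_imp_differentiable_at DERIV_deriv_iff_field_differentiable)
  define f' where "f' = (z * poly (pderiv F) z - poly F z) / z\<^sup>2"
  have "((\<lambda>z. poly F z / z) has_field_derivative f') (at z)"
    unfolding f'_def using S(3)
    by (auto intro!: derivative_eq_intros simp: power2_eq_square mult.commute)
  then have df: "(f has_field_derivative f') (at z)"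
    by (rule has_field_derivative_transform_within_open[OF _ S(1,2)]) (simp add: F)
  define w where "w = f z - of_real x"
  have "w \<notin> \<real>\<^sub>\<le>\<^sub>0" "w \<noteq> 0" using Im by (auto simp: w_def complex_nonpos_Reals_iff complex_eq_iff)
  then have pw: "w powr of_real l \<noteq> 0" by simp
  have "((\<lambda>z. 1 / (u z * (f z - of_real x) powr of_real l)) has_field_derivative
      - (1 / (u z * w powr of_real l)) * (deriv u z / u z + of_real l * f' / w)) (at z)"
    using \<open>w \<notin> \<real>\<^sub>\<le>\<^sub>0\<close> \<open>w \<noteq> 0\<close> u(2) pw
    by (auto intro!: derivative_eq_intros df du simp: w_def[symmetric] powr_diff field_simps power2_eq_square)
  then have "(eval_fps \<Psi> has_field_derivative
      - (1 / (u z * w powr of_real l)) * (deriv u z / u z + of_real l * f' / w)) (at z)"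
    by (rule has_field_derivative_transform_within_open[OF _ T]) (simp add: T_def \<Psi>)
  moreover have "(eval_fps \<Psi> has_field_derivative eval_fps (fps_deriv \<Psi>) z) (at z)"
    using r by (intro has_field_derivative_eval_fps) (rule less_le_trans)
  ultimately have 1: "eval_fps (fps_deriv \<Psi>) z
      = - (1 / (u z * w powr of_real l)) * (deriv u z / u z + of_real l * f' / w)"
    using DERIV_unique by blast
  have 2: "eval_fps \<Psi> z = 1 / (u z * w powr of_real l)"
    using \<Psi>[OF S(2) r(1)] by (simp add: w_def)
  have 3: "poly F z - of_real x * z = z * w"
    using F[OF S(2)] S(3) by (simp add: w_def field_simps)
  have 4: "z * poly (pderiv F) z - poly F z = z\<^sup>2 * f'"
    using S(3) by (simp add: f'_def)
  show ?thesis
    unfolding 1 2 3 4 using \<open>w \<noteq> 0\<close> by (simp add: power2_eq_square algebra_simps)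
qed

text \<open>Integration is coefficientwise because the coefficients of the generating function are
  polynomials in x; finite moments suffice and z stays formal. Multiplication by a series free of x
  and differentiation in z then commute with it.\<close>

definition fps_integral :: "real measure \<Rightarrow> (real \<Rightarrow> complex fps) \<Rightarrow> complex fps" where
  "fps_integral M \<Phi> = Abs_fps (\<lambda>n. \<integral>x. fps_nth (\<Phi> x) n \<partial>M)"

definition fps_integrable :: "real measure \<Rightarrow> (real \<Rightarrow> complex fps) \<Rightarrow> bool" where
  "fps_integrable M \<Phi> \<longleftrightarrow> (\<forall>n. integrable M (\<lambda>x. fps_nth (\<Phi> x) n))"

lemma fps_integral_add:
  assumes "fps_integrable M \<Phi>" "fps_integrable M \<Theta>"
  shows "fps_integrable M (\<lambda>x. \<Phi> x + \<Theta> x)"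
    "fps_integral M (\<lambda>x. \<Phi> x + \<Theta> x) = fps_integral M \<Phi> + fps_integral M \<Theta>"
  using assms by (auto simp: fps_integral_def fps_integrable_def fps_eq_iff)

lemma fps_integral_mult_left:
  assumes "fps_integrable M \<Phi>"
  shows "fps_integrable M (\<lambda>x. C * \<Phi> x)"
    "fps_integral M (\<lambda>x. C * \<Phi> x) = C * fps_integral M \<Phi>"
  using assms by (auto simp: fps_integral_def fps_integrable_def fps_eq_iff fps_mult_nth)

lemma fps_integral_deriv:
  assumes "fps_integrable M \<Phi>"
  shows "fps_integrable M (\<lambda>x. fps_deriv (\<Phi> x))"
    "fps_integral M (\<lambda>x. fps_deriv (\<Phi> x)) = fps_deriv (fps_integral M \<Phi>)"
  using assms by (auto simp: fps_integral_def fps_integrable_def fps_eq_iff)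

lemma fps_integral_cong_AE:
  assumes "fps_integrable M \<Phi>" "fps_integrable M \<Theta>" "AE x in M. \<Phi> x = \<Theta> x"
  shows "fps_integral M \<Phi> = fps_integral M \<Theta>"
proof -
  have "(\<integral>x. fps_nth (\<Phi> x) n \<partial>M) = (\<integral>x. fps_nth (\<Theta> x) n \<partial>M)" for n
  proof (rule integral_cong_AE)
    show "AE x in M. fps_nth (\<Phi> x) n = fps_nth (\<Theta> x) n" using assms(3) by eventually_elim simp
  qed (use assms(1,2) in \<open>auto simp: fps_integrable_def intro: borel_measurable_integrable\<close>)
  then show ?thesis by (simp add: fps_integral_def)
qed

text \<open>The functions 1, x and x^2 are combinations of \<open>P 0\<close>, \<open>P 1\<close>
  and \<open>P 2\<close>, so orthogonality leaves only the listed indices. Mean 0 gives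
  \<open>\<alpha> 0 = 0\<close> and variance 1 gives \<open>\<omega> 1 = 1\<close>.\<close>

lemma standard_measure_low_integrals:
  assumes M: "standard_measure M" and P: "jacobi_szego M P \<alpha> \<omega>"
  shows "(\<integral>x. poly (P n) x \<partial>M) = (if n = 0 then 1 else 0)"
    "(\<integral>x. x * poly (P n) x \<partial>M) = (if n = 1 then 1 else 0)"
    "(\<integral>x. x * x * poly (P n) x \<partial>M)
       = (if n = 0 then 1 else if n = 1 then \<alpha> 1 else if n = 2 then \<omega> 2 else 0)"
proof -
  interpret real_distribution M using M by (simp add: standard_measure_def)
  have mom: "has_moments M" using M by (simp add: standard_measure_def has_moments_def)
  note o = jacobi_szegoD(1)[OF P]
  note orth = monic_orthogonalD(5)[OF o] and rec = jacobi_szegoD(2)[OF P]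
  note P0 = monic_orthogonal_0[OF o]
  note int = integrable_poly_mult[OF mom]
  show 0: "(\<integral>x. poly (P n) x \<partial>M) = (if n = 0 then 1 else 0)" for n
    using orth[of n 0] prob_space by (cases "n = 0") (auto simp: P0)
  have mean: "(\<integral>x. x \<partial>M) = 0" and var: "(\<integral>x. x * x \<partial>M) = 1"
    using M by (auto simp: standard_measure_def power2_eq_square)
  have "integrable M (\<lambda>x. x)"
    using mom[unfolded has_moments_def, rule_format, of 1] by simp
  moreover have "poly (P 1) x = x - \<alpha> 0" for x using rec[of x 0] by (simp add: P0)
  ultimately have "\<alpha> 0 = 0" using 0[of 1] mean prob_space by simp
  with \<open>\<And>x. poly (P 1) x = x - \<alpha> 0\<close> have P1: "poly (P 1) x = x" for x by simp
  show 1: "(\<integral>x. x * poly (P n) x \<partial>M) = (if n = 1 then 1 else 0)" for n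
    using orth[of 1 n] var unfolding P1 by (cases "n = 1") (auto simp: P1[unfolded One_nat_def])
  have sq: "x * x = poly (P 2) x + \<alpha> 1 * x + \<omega> 1" for x
    using rec[of x 1] by (simp add: P1[unfolded One_nat_def] P0 numeral_2_eq_2)
  have "(\<integral>x. x * x \<partial>M) = (\<integral>x. poly (P 2) x + \<alpha> 1 * x + \<omega> 1 \<partial>M)"
    using sq by simp
  then have \<omega>1: "\<omega> 1 = 1"
    using 0[of 2] mean var integrable_poly[OF mom] \<open>integrable M (\<lambda>x. x)\<close> prob_space by simp
  have i1: "integrable M (\<lambda>x. x * poly (P n) x)" for n
    using int[of "[:0,1:]" "P n"] by simp
  \<comment> \<open>The integral of x^2 \<open>P 2\<close> is computed twice: by expanding x^2, and
    by expanding x \<open>P 2\<close> with the recurrence.\<close>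
  have "(\<integral>x. poly (P 2) x * poly (P 2) x \<partial>M) = \<omega> 2"
  proof -
    have "(\<integral>x. x * (x * poly (P 2) x) \<partial>M) = (\<integral>x. poly (P 2) x * poly (P 2) x + \<alpha> 1 * (x * poly (P 2) x)
        + \<omega> 1 * poly (P 2) x \<partial>M)"
    proof (intro Bochner_Integration.integral_cong refl)
      fix x
      show "x * (x * poly (P 2) x) = poly (P 2) x * poly (P 2) x + \<alpha> 1 * (x * poly (P 2) x)
          + \<omega> 1 * poly (P 2) x"
        using sq[of x] by algebra
    qed
    moreover have "(\<integral>x. x * (x * poly (P 2) x) \<partial>M) = (\<integral>x. x * poly (P 3) x + \<alpha> 2 * (x * poly (P 2) x)
        + \<omega> 2 * (x * x) \<partial>M)"
    proof (intro Bochner_Integration.integral_cong refl)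
      fix x
      have "x * poly (P 2) x = poly (P 3) x + \<alpha> 2 * poly (P 2) x + \<omega> 2 * x"
        using rec[of x 2] by (simp add: P1[unfolded One_nat_def] numeral_3_eq_3 numeral_2_eq_2)
      then show "x * (x * poly (P 2) x) = x * poly (P 3) x + \<alpha> 2 * (x * poly (P 2) x) + \<omega> 2 * (x * x)"
        by algebra
    qed
    moreover have "integrable M (\<lambda>x. x * x)"
      using mom[unfolded has_moments_def, rule_format, of 2] by (simp add: power2_eq_square)
    ultimately show ?thesis
      using 0[of 2] 1[of 2] 1[of 3] var int i1 integrable_poly[OF mom] by simp
  qed
  then show "(\<integral>x. x * x * poly (P n) x \<partial>M)
       = (if n = 0 then 1 else if n = 1 then \<alpha> 1 else if n = 2 then \<omega> 2 else 0)"
  proof -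
    have "(\<integral>x. x * x * poly (P n) x \<partial>M) = (\<integral>x. poly (P 2) x * poly (P n) x + \<alpha> 1 * (x * poly (P n) x)
        + \<omega> 1 * poly (P n) x \<partial>M)"
    proof (intro Bochner_Integration.integral_cong refl)
      fix x
      show "x * x * poly (P n) x = poly (P 2) x * poly (P n) x + \<alpha> 1 * (x * poly (P n) x)
          + \<omega> 1 * poly (P n) x"
        using sq[of x] by algebra
    qed
    also have "\<dots> = (\<integral>x. poly (P 2) x * poly (P n) x \<partial>M) + \<alpha> 1 * (if n = 1 then 1 else 0)
        + (if n = 0 then 1 else 0)"
      using 0[of n] 1[of n] i1 int integrable_poly[OF mom] by (simp add: \<omega>1[unfolded One_nat_def])
    finally show ?thesis
      using orth[of 2 n] \<open>(\<integral>x. poly (P 2) x * poly (P 2) x \<partial>M) = \<omega> 2\<close> by auto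
  qed
qed

section \<open>The Riccati equation\<close>

text \<open>The case b = 0 is impossible by the first two equations. Otherwise eliminating e2 from
  the third leaves b (1 - l) times an expression linear in b, hence b (2 l - 1) (l + 1) = 2 l^3,
  whose positivity gives l > 1/2. For l = 1 all three equations would hold with e2 = 0 and arbitrary
  a and b.\<close>

lemma riccati_polynomial_solution_real:
  fixes a b l e2 :: real
  assumes l: "l > 0" "l \<noteq> 1" and b: "b \<ge> 0"
    and eq2: "3 * e2 = 1 + a\<^sup>2 / 4 - l\<^sup>2 * a\<^sup>2 / 4 - b + l * b - l\<^sup>2"
    and eq3: "2 * l * e2 = b * (1 - l)"
    and eq4: "e2\<^sup>2 + l * (b - l) * e2 + (l - 1) * b * (b - l) = 0"
  shows "l > 1/2" "e2 + b = l\<^sup>2 / (2 * l - 1)" "a\<^sup>2 * (l + 1)\<^sup>2 * (2 * l - 1) = 4"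
proof -
  have "b \<noteq> 0"
  proof
    assume "b = 0"
    then have "e2 = 0" using eq3 l by simp
    then have "(1 - l) * ((1 + l) * (1 + a\<^sup>2 / 4)) = 0"
      using eq2 \<open>b = 0\<close> by algebra
    moreover have "1 + a\<^sup>2 / 4 > 0" by (simp add: add_pos_nonneg)
    ultimately show False using l by auto
  qed
  then have "b > 0" using b by simp
  have "(b * (1 - l)) * (b * (1 - l) - 2 * l\<^sup>2 * (b - l)) = 0"
    using eq3 eq4 by algebra
  then have "b * (1 - l) - 2 * l\<^sup>2 * (b - l) = 0"
    using \<open>b > 0\<close> l by simp
  then have bl: "b * (2 * l - 1) * (l + 1) = 2 * l ^ 3" by algebra
  moreover have "2 * l ^ 3 > 0" using l by simp
  ultimately have "b * (2 * l - 1) * (l + 1) > 0" by simp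
  then have pos: "2 * l - 1 > 0" using \<open>b > 0\<close> l by (simp add: zero_less_mult_iff)
  then show "l > 1/2" by simp
  have "2 * l * ((e2 + b) * (2 * l - 1)) = 2 * l * l\<^sup>2"
    using eq3 bl by algebra
  then have "(e2 + b) * (2 * l - 1) = l\<^sup>2"
    by (rule iffD1[OF mult_left_cancel, rotated]) (use l in simp)
  then show "e2 + b = l\<^sup>2 / (2 * l - 1)"
    using pos by (simp add: eq_divide_eq)
  have "2 * l * (1 - l) * (a\<^sup>2 * (l + 1)\<^sup>2 * (2 * l - 1) - 4) = 0"
    using eq2 eq3 bl by algebra
  then show "a\<^sup>2 * (l + 1)\<^sup>2 * (2 * l - 1) = 4"
    using l by simp
qed

text \<open>Splitting off (a/2) z + b z^2 from F completes the square: the terms F^2 - (a z + 2 b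
  z^2) F become E^2 minus a known polynomial. The equation for E then bounds its degree, and
  comparing coefficients reduces everything to real equations.\<close>

lemma riccati_polynomial_solution:
  fixes F E :: "complex poly" and a b l :: real
  assumes l: "l > 0" "l \<noteq> 1" and a: "a \<noteq> 0" and b: "b \<ge> 0"
    and F: "F = E + [:0, of_real (a / 2), of_real b:]" and E0: "poly E 0 = 1"
    and eq: "([:0, 1:] * pderiv F - F) * ([:0, 0, of_real (l\<^sup>2):] - [:1, of_real (l * a), of_real (l * b):])
      = F * F - [:0, of_real a, of_real (2 * b):] * F + [:0, 0, -1, 0, of_real (l * b):]"
  shows "l > 1/2" "a\<^sup>2 * (l + 1)\<^sup>2 * (2 * l - 1) = 4"
    "F = [:1, of_real (a * (l + 1) / 2), of_real (l\<^sup>2 / (2 * l - 1)):]"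
proof -
  define H where "H = [:0, 0, 1 + of_real (a\<^sup>2 / 4), of_real (a * b), of_real (b\<^sup>2 - l * b) :: complex:]"
  define N where "N = [:1, of_real (l * a), of_real (l * (b - l)) :: complex:]"
  have E: "([:0, 1:] * pderiv E - E + [:0, 0, of_real b:]) * N = H - E * E"
  proof (intro poly_eq_poly_eq_iff[THEN iffD1] ext)
    fix z
    have d: "pderiv F = pderiv E + [:of_real (a / 2), 2 * of_real b:]"
      by (simp add: F pderiv_add pderiv_pCons)
    define A L B where "A = complex_of_real a" and "L = complex_of_real l" and "B = complex_of_real b"
    have "poly (([:0, 1:] * pderiv F - F) * ([:0, 0, of_real (l\<^sup>2):] - [:1, of_real (l * a), of_real (l * b):])) z
        = poly (F * F - [:0, of_real a, of_real (2 * b):] * F + [:0, 0, -1, 0, of_real (l * b):]) z"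
      unfolding eq ..
    then have *: "(z * (poly (pderiv E) z + (A / 2 + 2 * B * z)) - (poly E z + (A / 2 * z + B * z * z)))
        * (L * L * z * z - (1 + L * A * z + L * B * z * z))
        = (poly E z + (A / 2 * z + B * z * z)) * (poly E z + (A / 2 * z + B * z * z))
          - (A * z + 2 * B * z * z) * (poly E z + (A / 2 * z + B * z * z)) + (- (z * z) + L * B * z * z * z * z)"
      unfolding d unfolding F A_def L_def B_def by (simp add: power2_eq_square algebra_simps)
    have "(z * poly (pderiv E) z - poly E z + B * z * z) * (1 + L * A * z + L * (B - L) * z * z)
        = z * z * (1 + A * A / 4) + A * B * z * z * z + (B * B - L * B) * z * z * z * z - poly E z * poly E z"
    proof -
      define h D e where "h = A / 2" and "D = poly (pderiv E) z" and "e = poly E z"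
      have A: "A = 2 * h" by (simp add: h_def)
      have "(z * D - e + B * z * z) * (1 + L * A * z + L * (B - L) * z * z)
          = - ((z * (D + (h + 2 * B * z)) - (e + (h * z + B * z * z)))
             * (L * L * z * z - (1 + L * A * z + L * B * z * z)))"
        by (simp add: algebra_simps)
      also have "\<dots> = - ((e + (h * z + B * z * z)) * (e + (h * z + B * z * z))
          - (A * z + 2 * B * z * z) * (e + (h * z + B * z * z)) + (- (z * z) + L * B * z * z * z * z))"
        using * by (simp only: h_def D_def e_def)
      also have "\<dots> = z * z * (1 + h * h) + 2 * h * B * z * z * z + (B * B - L * B) * z * z * z * z - e * e"
        unfolding A by (simp add: algebra_simps)
      also have "h * h = A * A / 4" by (simp add: h_def)
      also have "2 * h = A" by (simp add: h_def)
      finally show ?thesis unfolding D_def e_def .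
    qed
    then show "poly (([:0, 1:] * pderiv E - E + [:0, 0, of_real b:]) * N) z = poly (H - E * E) z"
      unfolding N_def H_def A_def L_def B_def by (simp add: power2_eq_square algebra_simps)
  qed
  \<comment> \<open>The square E^2 has degree twice that of E, whereas z E' - E raises no degree and
    N adds at most 2. This balance leaves no room above degree 2.\<close>
  have "degree E \<le> 2"
  proof (rule ccontr)
    assume "\<not> degree E \<le> 2"
    have "degree ([:0, 1:] * pderiv E) \<le> degree E"
      using degree_mult_le[of "[:0, 1:]" "pderiv E"] degree_pderiv[of E] \<open>\<not> degree E \<le> 2\<close> by simp
    then have "degree ([:0, 1:] * pderiv E - E + [:0, 0, of_real b:]) \<le> degree E"
      using \<open>\<not> degree E \<le> 2\<close> by (intro degree_add_le degree_diff_le) auto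
    moreover have "degree N \<le> 2" by (simp add: N_def)
    ultimately have "degree (([:0, 1:] * pderiv E - E + [:0, 0, of_real b:]) * N) \<le> degree E + 2"
      by (intro degree_mult_le[THEN le_trans] add_mono)
    moreover have "degree H \<le> 4" by (simp add: H_def)
    moreover have "E * E = H - ([:0, 1:] * pderiv E - E + [:0, 0, of_real b:]) * N"
      unfolding E by simp
    ultimately have "degree (E * E) \<le> max 4 (degree E + 2)"
      using degree_diff_le_max[of H] by (metis (no_types, lifting) le_max_iff_disj le_trans max.mono)
    moreover have "degree (E * E) = degree E + degree E"
      using \<open>\<not> degree E \<le> 2\<close> by (intro degree_mult_eq) auto
    ultimately show False using \<open>\<not> degree E \<le> 2\<close> by (auto simp: max_def split: if_splits)
  qed
  define e1 e2 where "e1 = coeff E 1" and "e2 = coeff E 2"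
  have E': "E = [:1, e1, e2:]"
  proof (rule poly_eqI)
    fix n :: nat
    consider "n = 0" | "n = 1" | "n = 2" | "n > 2" by linarith
    then show "coeff E n = coeff [:1, e1, e2:] n"
    proof cases
      case 4
      then have "n = Suc (Suc (Suc (n - 3)))" by linarith
      then obtain m where "n = Suc (Suc (Suc m))" ..
      with 4 show ?thesis using \<open>degree E \<le> 2\<close> by (simp add: coeff_eq_0)
    qed (use E0 in \<open>auto simp: e1_def e2_def poly_0_coeff_0 numeral_2_eq_2\<close>)
  qed
  have *: "[:- 1, 0, e2 + of_real b:] * N = H - [:1, e1, e2:] * [:1, e1, e2:]"
    using E unfolding E' by (simp add: pderiv_pCons)
  have "coeff ([:- 1, 0, e2 + of_real b:] * N) n = coeff (H - [:1, e1, e2:] * [:1, e1, e2:]) n" for n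
    unfolding * ..
  from this[of 1] this[of 2] this[of 3] this[of 4]
  have c1: "2 * e1 = of_real (l * a)"
    and c2: "(e2 + of_real b) - of_real (l * (b - l)) = 1 + of_real (a\<^sup>2 / 4) - 2 * e2 - e1\<^sup>2"
    and c3: "(e2 + of_real b) * of_real (l * a) = of_real (a * b) - 2 * e1 * e2"
    and c4: "(e2 + of_real b) * of_real (l * (b - l)) = of_real (b\<^sup>2 - l * b) - e2\<^sup>2"
    unfolding N_def H_def
    by (simp_all add: numeral_2_eq_2 numeral_3_eq_3 eval_nat_numeral algebra_simps)
  have e1: "e1 = of_real (l * a / 2)"
    using c1 by (metis nonzero_mult_div_cancel_left of_real_divide of_real_numeral zero_neq_numeral)
  \<comment> \<open>After inserting e1 the coefficient of z^3 has the common factor a; cancelling it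
    is where a nonzero \<open>\<alpha> 1\<close> yields an extra equation for e2.\<close>
  have "of_real a * (2 * of_real l * e2) = of_real a * (of_real (b * (1 - l)) :: complex)"
    using c3 unfolding e1 by (simp add: algebra_simps)
  then have "2 * of_real l * e2 = (of_real (b * (1 - l)) :: complex)"
    using a by (simp only: mult_cancel_left of_real_eq_0_iff) simp
  then have e2: "e2 = of_real (b * (1 - l) / (2 * l))"
    using l by (simp add: field_simps)
  define r where "r = b * (1 - l) / (2 * l)"
  have e2: "e2 = of_real r" unfolding r_def by (rule e2)
  have "(of_real ((r + b) - l * (b - l)) :: complex) = of_real (1 + a\<^sup>2 / 4 - 2 * r - (l * a / 2)\<^sup>2)"
    using c2 unfolding e1 e2 by simp
  then have r2: "(r + b) - l * (b - l) = 1 + a\<^sup>2 / 4 - 2 * r - (l * a / 2)\<^sup>2"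
    unfolding of_real_eq_iff .
  have "(of_real ((r + b) * (l * (b - l))) :: complex) = of_real ((b\<^sup>2 - l * b) - r\<^sup>2)"
    using c4 unfolding e2 by simp
  then have r4: "(r + b) * (l * (b - l)) = (b\<^sup>2 - l * b) - r\<^sup>2"
    unfolding of_real_eq_iff .
  have r3: "2 * l * r = b * (1 - l)" using l by (simp add: r_def)
  have "3 * r = 1 + a\<^sup>2 / 4 - l\<^sup>2 * a\<^sup>2 / 4 - b + l * b - l\<^sup>2"
    using r2 by (simp add: power2_eq_square algebra_simps)
  moreover have "r\<^sup>2 + l * (b - l) * r + (l - 1) * b * (b - l) = 0"
    using r4 by algebra
  ultimately have sol: "l > 1/2" "r + b = l\<^sup>2 / (2 * l - 1)" "a\<^sup>2 * (l + 1)\<^sup>2 * (2 * l - 1) = 4"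
    using riccati_polynomial_solution_real[OF l b _ r3] by blast+
  then show "l > 1/2" "a\<^sup>2 * (l + 1)\<^sup>2 * (2 * l - 1) = 4" by blast+
  have "F = [:1, of_real (l * a / 2) + of_real (a / 2), of_real r + of_real b:]"
    by (simp add: F E' e1 e2)
  also have "of_real r + of_real b = (of_real (r + b) :: complex)" by simp
  also have "of_real (l * a / 2) + of_real (a / 2) = (of_real (a * (l + 1) / 2) :: complex)"
    by (simp add: field_simps)
  finally show "F = [:1, of_real (a * (l + 1) / 2), of_real (l\<^sup>2 / (2 * l - 1)):]"
    unfolding sol(2) .
qed

text \<open>Coefficients of the differential equation give the Gegenbauer recurrence rescaled by
  powers of k. The leading coefficient series starts with 1, so the constant term of G determines
  all the others.\<close>

lemma gegenbauer_generating_function_unique: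
  fixes G :: "complex fps" and l k t :: real
  assumes G0: "fps_nth G 0 = 1"
    and ode: "(1 - fps_const (of_real (2 * t * k)) * fps_X + fps_const (of_real (k\<^sup>2)) * fps_X\<^sup>2) * fps_deriv G
      = fps_const (of_real l) * (fps_const (of_real (2 * t * k)) - fps_const (of_real (2 * k\<^sup>2)) * fps_X) * G"
  shows "fps_nth G n = of_real (k ^ n * poly (gegenbauer l n) t)"
proof -
  define p q where "p = complex_of_real (2 * t * k)" and "q = complex_of_real (k\<^sup>2)"
  have ode': "fps_deriv G - fps_const p * (fps_X * fps_deriv G) + fps_const q * (fps_X * (fps_X * fps_deriv G))
      = fps_const (of_real l) * (fps_const p * G - fps_const (2 * q) * (fps_X * G))"
    using ode by (simp add: p_def q_def power2_eq_square algebra_simps)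
  have nth: "fps_nth (fps_deriv G - fps_const p * (fps_X * fps_deriv G)
        + fps_const q * (fps_X * (fps_X * fps_deriv G))) n
      = fps_nth (fps_const (of_real l) * (fps_const p * G - fps_const (2 * q) * (fps_X * G))) n" for n
    by (simp only: ode')
  have rec: "(of_nat m + 2) * fps_nth G (Suc (Suc m))
      = p * (of_nat m + 1 + of_real l) * fps_nth G (Suc m) - q * (of_nat m + 2 * of_real l) * fps_nth G m" for m
    using nth[of "Suc m"] by (cases m) (simp_all add: algebra_simps)
  have "fps_nth G 1 = p * of_real l"
    using nth[of 0] G0 by simp
  then show ?thesis
  proof (induction n rule: induct_nat_012)
    case 0
    show ?case by (simp add: G0)
  next
    case 1
    then show ?case by (simp add: p_def)
  next
    case (ge2 n)
    have "(of_nat n + 2) * fps_nth G (Suc (Suc n)) = of_real (2 * t * k * (real n + 1 + l)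
        * (k ^ Suc n * poly (gegenbauer l (Suc n)) t) - k\<^sup>2 * (real n + 2 * l) * (k ^ n * poly (gegenbauer l n) t))"
      unfolding rec ge2.IH(1)[OF ge2.prems] ge2.IH(2)[OF ge2.prems] p_def q_def by simp
    also have "2 * t * k * (real n + 1 + l) * (k ^ Suc n * poly (gegenbauer l (Suc n)) t)
        - k\<^sup>2 * (real n + 2 * l) * (k ^ n * poly (gegenbauer l n) t)
        = k ^ Suc (Suc n) * (2 * (real n + 1 + l) * t * poly (gegenbauer l (Suc n)) t
          - (real n + 2 * l) * poly (gegenbauer l n) t)"
      by (simp add: power2_eq_square algebra_simps)
    also have "\<dots> = (real n + 2) * (k ^ Suc (Suc n) * poly (gegenbauer l (Suc (Suc n))) t)"
      unfolding gegenbauer_rec[symmetric] by simp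
    finally have "(of_nat n + 2) * fps_nth G (Suc (Suc n))
        = (of_nat n + 2) * complex_of_real (k ^ Suc (Suc n) * poly (gegenbauer l (Suc (Suc n))) t)"
      by simp
    moreover have "(of_nat n + 2 :: complex) \<noteq> 0"
      by (metis of_nat_Suc of_nat_add of_nat_numeral of_nat_neq_0 add_2_eq_Suc')
    ultimately show ?case by (simp only: mult_cancel_left) simp
  qed
qed

text \<open>The elimination behind the substitution \<Psi> = U G, as a pure ring identity: R stands
  for F - x z, H for F', and K G + U G' is the derivative of U G. Multiplying by U makes v appear
  only in the product v U, which is known.\<close>

lemma cancel_linear_factor:
  fixes U K X L D R G G' H v Y :: "'a :: comm_ring_1"
  assumes U: "U = 1 + K * X" and LK: "L * (K - D) = K" and v: "v * U = - L * (1 + D * X)"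
    and eq: "X * R * (K * G + U * G') + L * (X * H - (R + Y * X)) * (U * G) = v * (R * (U * G))"
  shows "X * U * U * (R * G' + L * (H - Y) * G) = 0"
proof -
  have "X * U * U * (R * G' + L * (H - Y) * G)
    = U * (X * R * (K * G + U * G') + L * (X * H - (R + Y * X)) * (U * G) - v * (R * (U * G)))
      + (v * U - - L * (1 + D * X)) * (R * U * G) + R * U * G * L * (U - (1 + K * X))
      + R * U * G * X * (L * (K - D) - K)"
    by (simp add: algebra_simps)
  also have "\<dots> = 0"
    unfolding eq v LK by (simp add: U)
  finally show ?thesis .
qed

text \<open>
  With \<open>\<kappa> = \<epsilon> \<lambda> / \<surd>(2 \<lambda> - 1)\<close> and \<open>\<delta> = \<epsilon> (\<lambda> - 1) / \<surd>(2 \<lambda> - 1)\<close>, where \<open>\<epsilon> = \<plusminus>1\<close>, all the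
  quantities in play become polynomials in \<open>\<kappa>\<close> and \<open>\<delta>\<close>, and \<open>\<kappa>\<^sup>2 - \<delta>\<^sup>2 = 1\<close>.
\<close>
lemma generating_function_coeffs:
  fixes \<Psi> F v :: "complex fps" and \<kappa> \<delta> l x :: real
  assumes \<kappa>\<delta>: "\<kappa>\<^sup>2 - \<delta>\<^sup>2 = 1" and l: "l = \<kappa> * (\<kappa> + \<delta>)"
    and F: "F = fps_of_poly [:1, of_real (\<kappa> - \<delta>), of_real (\<kappa>\<^sup>2):]"
    and v: "v * (F - fps_const (of_real l) * fps_X\<^sup>2)
      = fps_const (of_real l) * (fps_X * fps_deriv F - F - fps_X\<^sup>2)"
    and \<Psi>0: "fps_nth \<Psi> 0 = 1"
    and \<Psi>: "fps_X * (F - fps_const (of_real x) * fps_X) * fps_deriv \<Psi>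
        + fps_const (of_real l) * (fps_X * fps_deriv F - F) * \<Psi>
      = v * ((F - fps_const (of_real x) * fps_X) * \<Psi>)"
    and e: "e = 1 \<or> e = -1" and k: "k = e * \<kappa>" "k > 0" and t: "2 * t * k = x - (\<kappa> - \<delta>)"
  shows "fps_nth \<Psi> n = of_real (k ^ n * poly (gegenbauer_sum l e n) t)"
proof -
  define K D L Y where "K = fps_const (complex_of_real \<kappa>)" and "D = fps_const (complex_of_real \<delta>)"
    and "L = fps_const (complex_of_real l)" and "Y = fps_const (complex_of_real x)"
  have KK: "K * K = 1 + D * D"
  proof -
    have "\<kappa> * \<kappa> = 1 + \<delta> * \<delta>" using \<kappa>\<delta> by (simp add: power2_eq_square)
    then have "fps_const (complex_of_real (\<kappa> * \<kappa>)) = fps_const (complex_of_real (1 + \<delta> * \<delta>))"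
      by simp
    then show ?thesis by (simp add: K_def D_def flip: fps_const_add fps_const_mult)
  qed
  have L: "L = K * (K + D)" by (simp add: L_def K_def D_def l)
  have F': "F = 1 + (K - D) * fps_X + K * K * fps_X * fps_X"
    by (simp add: F fps_of_poly_pCons K_def D_def power2_eq_square algebra_simps)
  have dF: "fps_deriv F = (K - D) + 2 * K * K * fps_X"
    unfolding F' by (simp add: K_def D_def algebra_simps)
  define U where "U = 1 + K * fps_X"
  have U0: "fps_nth U 0 = 1" by (simp add: U_def)
  have "1 - D * fps_X \<noteq> 0"
  proof
    assume "1 - D * fps_X = 0"
    then have "fps_nth (1 - D * fps_X) 0 = 0" by simp
    then show False by simp
  qed
  moreover have "(1 - D * fps_X) * (v * U + L * (1 + D * fps_X)) = 0"
  proof -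
    \<comment> \<open>Both sides of the relation for v contain 1 - \<delta> z: on the left F -
      \<lambda> z^2 = (1 + \<kappa> z) (1 - \<delta> z), on the right \<kappa>^2 - 1 = \<delta>^2
      leaves -\<lambda> (1 - \<delta> z) (1 + \<delta> z).\<close>
    have "F - L * fps_X\<^sup>2 = U * (1 - D * fps_X)"
      unfolding F' L U_def by (simp add: power2_eq_square algebra_simps)
    moreover have "fps_X * fps_deriv F - F - fps_X\<^sup>2 = - 1 + (K * K) * fps_X\<^sup>2 - fps_X\<^sup>2"
      unfolding dF unfolding F' by (simp add: power2_eq_square algebra_simps)
    ultimately have "v * (U * (1 - D * fps_X)) = L * (- 1 + (1 + D * D) * fps_X\<^sup>2 - fps_X\<^sup>2)"
      using v unfolding L_def[symmetric] KK by simp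
    then show ?thesis by (simp add: power2_eq_square algebra_simps)
  qed
  ultimately have vU: "v * U = - L * (1 + D * fps_X)"
    by (simp add: eq_neg_iff_add_eq_0)
  \<comment> \<open>The relation v U = -\<lambda> (1 + \<delta> z) makes 1 + \<kappa> z the
    prefactor that has to be divided out; the quotient satisfies the pure Gegenbauer
    equation.\<close>
  define G where "G = \<Psi> * inverse U"
  have \<Psi>G: "\<Psi> = U * G"
    using inverse_mult_eq_1'[of U] U0 by (simp add: G_def mult.left_commute)
  have dU: "fps_deriv U = K" by (simp add: U_def K_def)
  have d\<Psi>: "fps_deriv \<Psi> = K * G + U * fps_deriv G"
    unfolding \<Psi>G by (simp add: dU algebra_simps)
  have LK: "L * (K - D) = K"
  proof -
    have "L * (K - D) = K * (K * K - D * D)" unfolding L by (simp add: algebra_simps)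
    then show ?thesis unfolding KK by simp
  qed
  have "fps_X * U * U * ((F - Y * fps_X) * fps_deriv G + L * (fps_deriv F - Y) * G) = 0"
  proof (rule cancel_linear_factor[OF U_def LK vU])
    show "fps_X * (F - Y * fps_X) * (K * G + U * fps_deriv G)
        + L * (fps_X * fps_deriv F - (F - Y * fps_X + Y * fps_X)) * (U * G) = v * ((F - Y * fps_X) * (U * G))"
      using \<Psi> unfolding d\<Psi> L_def[symmetric] Y_def[symmetric] unfolding \<Psi>G by (simp only: diff_add_cancel)
  qed
  moreover have "U \<noteq> 0" using U0 by auto
  ultimately have "(F - Y * fps_X) * fps_deriv G + L * (fps_deriv F - Y) * G = 0"
    by simp
  then have ode: "(F - Y * fps_X) * fps_deriv G = - (L * (fps_deriv F - Y) * G)"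
    by (simp only: eq_neg_iff_add_eq_0)
  have kk: "k\<^sup>2 = \<kappa>\<^sup>2" using e k by auto
  have G: "fps_nth G n = of_real (k ^ n * poly (gegenbauer l n) t)" for n
  proof (rule gegenbauer_generating_function_unique)
    show "fps_nth G 0 = 1" by (simp add: G_def \<Psi>0 U0)
    have c: "fps_const (complex_of_real (2 * t * k)) = Y - (K - D)"
      "fps_const (complex_of_real (k\<^sup>2)) = K * K" "fps_const (complex_of_real (2 * k\<^sup>2)) = 2 * K * K"
      unfolding t kk by (simp_all add: Y_def K_def D_def power2_eq_square numeral_fps_const)
    show "(1 - fps_const (of_real (2 * t * k)) * fps_X + fps_const (of_real (k\<^sup>2)) * fps_X\<^sup>2) * fps_deriv G
      = fps_const (of_real l) * (fps_const (of_real (2 * t * k)) - fps_const (of_real (2 * k\<^sup>2)) * fps_X) * G"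
    proof -
      have "1 - (Y - (K - D)) * fps_X + K * K * fps_X\<^sup>2 = F - Y * fps_X"
        unfolding F' by (simp add: power2_eq_square algebra_simps)
      moreover have "L * (Y - (K - D) - 2 * K * K * fps_X) * G = - (L * (fps_deriv F - Y) * G)"
        unfolding dF by (simp add: algebra_simps)
      ultimately show ?thesis unfolding c L_def[symmetric] using ode by simp
    qed
  qed
  show ?thesis
  proof (cases n)
    case (Suc m)
    have "fps_nth \<Psi> n = fps_nth G (Suc m) + of_real \<kappa> * fps_nth G m"
      by (simp add: \<Psi>G U_def K_def Suc distrib_right mult.assoc)
    moreover have "\<kappa> = e * k" using e k by auto
    ultimately show ?thesis by (simp add: G Suc algebra_simps)
  qed (simp add: \<Psi>0)
qed

section \<open>From the generating function to the Jacobi polynomials\<close>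

lemma fps_conv_radius_closed:
  fixes A B :: "complex fps"
  assumes "r \<le> fps_conv_radius A" "r \<le> fps_conv_radius B"
  shows "r \<le> fps_conv_radius (A + B)" "r \<le> fps_conv_radius (A - B)" "r \<le> fps_conv_radius (A * B)"
  using assms fps_conv_radius_add[of A B] fps_conv_radius_diff[of A B] fps_conv_radius_mult[of A B]
  by (meson min.boundedI order_trans)+

text \<open>On S the quotient of the two sides is -z u'/u for every x. Cross multiplying the
  equations for two points x and y removes u and gives an identity between convergent power series,
  valid on all of them by the identity theorem. Since A_y has constant term 1, the quotient B_y /
  A_y is a power series and serves as v.\<close>

lemma generating_function_fps_relation:
  fixes f u :: "complex \<Rightarrow> complex" and \<Psi> :: "real \<Rightarrow> complex fps" and F :: "complex poly"
  assumes S: "open S" "0 \<in> closure S" "0 \<notin> S"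
    and u: "u analytic_on S" "\<And>z. z \<in> S \<Longrightarrow> u z \<noteq> 0"
    and f: "f analytic_on S" "\<And>z. z \<in> S \<Longrightarrow> Im (f z) \<noteq> 0"
    and F: "\<And>z. z \<in> S \<Longrightarrow> f z = poly F z / z" "poly F 0 = 1"
    and r: "r > 0" "\<And>x. x \<in> X \<Longrightarrow> r \<le> fps_conv_radius (\<Psi> x)"
    and \<Psi>: "\<And>x z. x \<in> X \<Longrightarrow> z \<in> S \<Longrightarrow> ereal (norm z) < r \<Longrightarrow>
        eval_fps (\<Psi> x) z = 1 / (u z * (f z - of_real x) powr of_real l)"
    and \<Psi>0: "\<And>x. x \<in> X \<Longrightarrow> fps_nth (\<Psi> x) 0 = 1" and X: "X \<noteq> {}"
  obtains v where "\<And>x. x \<in> X \<Longrightarrow>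
      fps_X * (fps_of_poly F - fps_const (of_real x) * fps_X) * fps_deriv (\<Psi> x)
      + fps_const (of_real l) * (fps_X * fps_deriv (fps_of_poly F) - fps_of_poly F) * \<Psi> x
      = v * ((fps_of_poly F - fps_const (of_real x) * fps_X) * \<Psi> x)"
proof -
  define A where "A x = (fps_of_poly F - fps_const (of_real x) * fps_X) * \<Psi> x" for x
  define B where "B x = fps_X * (fps_of_poly F - fps_const (of_real x) * fps_X) * fps_deriv (\<Psi> x)
      + fps_const (of_real l) * (fps_X * fps_deriv (fps_of_poly F) - fps_of_poly F) * \<Psi> x" for x
  have dF: "fps_deriv (fps_of_poly F) = fps_of_poly (pderiv F)" by (simp add: fps_of_poly_pderiv)
  have radA: "r \<le> fps_conv_radius (A x)" and radB: "r \<le> fps_conv_radius (B x)" if "x \<in> X" for x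
  proof -
    have "r \<le> fps_conv_radius (fps_deriv (\<Psi> x))"
      using r(2)[OF that] fps_conv_radius_deriv by (rule order_trans)
    then show "r \<le> fps_conv_radius (A x)" "r \<le> fps_conv_radius (B x)"
      unfolding A_def B_def dF by (intro fps_conv_radius_closed r(2)[OF that]; simp)+
  qed
  have evA: "eval_fps (A x) z = (poly F z - of_real x * z) * eval_fps (\<Psi> x) z"
    and evB: "eval_fps (B x) z = z * (poly F z - of_real x * z) * eval_fps (fps_deriv (\<Psi> x)) z
      + of_real l * (z * poly (pderiv F) z - poly F z) * eval_fps (\<Psi> x) z"
    if "x \<in> X" "ereal (norm z) < r" for x z
  proof -
    have 1: "ereal (norm z) < fps_conv_radius (\<Psi> x)" using r(2)[OF that(1)] that(2) by (rule less_le_trans[rotated])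
    then have 2: "ereal (norm z) < fps_conv_radius (fps_deriv (\<Psi> x))"
      using fps_conv_radius_deriv by (rule less_le_trans)
    have P: "ereal (norm z) < fps_conv_radius (fps_of_poly F - fps_const (of_real x) * fps_X)"
      "ereal (norm z) < fps_conv_radius (fps_X * fps_of_poly (pderiv F) - fps_of_poly F)"
      "ereal (norm z) < fps_conv_radius (fps_X * (fps_of_poly F - fps_const (of_real x) * fps_X))"
      "ereal (norm z) < fps_conv_radius (fps_const (of_real l) * (fps_X * fps_of_poly (pderiv F) - fps_of_poly F))"
      "ereal (norm z) < fps_conv_radius (fps_const (complex_of_real x) * fps_X)"
      "ereal (norm z) < fps_conv_radius (fps_X * fps_of_poly (pderiv F))"
      by (rule less_le_trans[of _ \<infinity>], simp, intro fps_conv_radius_closed; simp)+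
    then have "ereal (norm z) < fps_conv_radius
        (fps_X * (fps_of_poly F - fps_const (of_real x) * fps_X) * fps_deriv (\<Psi> x))"
      "ereal (norm z) < fps_conv_radius (fps_const (of_real l) * (fps_X * fps_of_poly (pderiv F) - fps_of_poly F) * \<Psi> x)"
      using 1 2 by (auto intro!: less_le_trans[OF _ fps_conv_radius_mult])
    with 1 2 P show "eval_fps (A x) z = (poly F z - of_real x * z) * eval_fps (\<Psi> x) z"
      "eval_fps (B x) z = z * (poly F z - of_real x * z) * eval_fps (fps_deriv (\<Psi> x)) z
      + of_real l * (z * poly (pderiv F) z - poly F z) * eval_fps (\<Psi> x) z"
      unfolding A_def B_def dF by (simp_all add: eval_fps_mult eval_fps_add eval_fps_diff)
  qed
  have cross: "B x * A y = B y * A x" if "x \<in> X" "y \<in> X" for x y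
  proof (rule fps_eqI_eval_near_0[OF r(1) _ _ S(2,3)])
    show "r \<le> fps_conv_radius (B x * A y)" "r \<le> fps_conv_radius (B y * A x)"
      using radA radB that by (auto intro: fps_conv_radius_closed)
    fix z assume z: "z \<in> S" "ereal (norm z) < r"
    have "eval_fps (B x) z = - z * (deriv u z / u z) * eval_fps (A x) z" if "x \<in> X" for x
      unfolding evA[OF that z(2)] evB[OF that z(2)]
    proof (rule generating_function_log_deriv[OF S(1) z(1) _ u(1) u(2)[OF z(1)] f(1) f(2)[OF z(1)] F(1) z(2) r(2)[OF that]])
      show "z \<noteq> 0" using z S by auto
    qed (use \<Psi>[OF that] in auto)
    then show "eval_fps (B x * A y) z = eval_fps (B y * A x) z"
      using that radA radB z(2) by (simp add: eval_fps_mult less_le_trans)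
  qed
  obtain y where y: "y \<in> X" using X by blast
  have "fps_nth (A y) 0 = 1"
    using \<Psi>0[OF y] F(2) by (simp add: A_def poly_0_coeff_0)
  then have inv: "A y * inverse (A y) = 1" by (intro inverse_mult_eq_1') simp
  show ?thesis
  proof (rule that)
    fix x assume x: "x \<in> X"
    have "B x = B x * (A y * inverse (A y))" by (simp add: inv)
    also have "\<dots> = (B y * inverse (A y)) * A x"
      using cross[OF x y] by (simp add: ac_simps)
    finally show "fps_X * (fps_of_poly F - fps_const (of_real x) * fps_X) * fps_deriv (\<Psi> x)
      + fps_const (of_real l) * (fps_X * fps_deriv (fps_of_poly F) - fps_of_poly F) * \<Psi> x
      = (B y * inverse (A y)) * ((fps_of_poly F - fps_const (of_real x) * fps_X) * \<Psi> x)"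
      unfolding A_def B_def .
  qed
qed

definition generating_fps :: "real \<Rightarrow> (nat \<Rightarrow> real poly) \<Rightarrow> real \<Rightarrow> complex fps" where
  "generating_fps l P x = Abs_fps (\<lambda>n. of_real (pochhammer l n / fact n * poly (P n) x))"

lemma generating_fps_integrals:
  assumes M: "standard_measure M" and P: "jacobi_szego M P \<alpha> \<omega>"
  shows "fps_integrable M (generating_fps l P)"
    "fps_integrable M (\<lambda>x. fps_const (of_real x) * generating_fps l P x)"
    "fps_integrable M (\<lambda>x. fps_const (of_real x) * (fps_const (of_real x) * generating_fps l P x))"
    "fps_integral M (generating_fps l P) = 1"
    "fps_integral M (\<lambda>x. fps_const (of_real x) * generating_fps l P x) = fps_const (of_real l) * fps_X"
    "fps_integral M (\<lambda>x. fps_const (of_real x) * (fps_const (of_real x) * generating_fps l P x))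
      = 1 + fps_const (of_real (l * \<alpha> 1)) * fps_X + fps_const (of_real (l * ((l + 1) * \<omega> 2 / 2))) * fps_X\<^sup>2"
proof -
  note I = standard_measure_low_integrals[OF M P]
  have mom: "has_moments M" using M by (simp add: standard_measure_def has_moments_def)
  have i: "integrable M (\<lambda>x. pochhammer l n / fact n * poly (P n) x)"
    "integrable M (\<lambda>x. x * (pochhammer l n / fact n * poly (P n) x))"
    "integrable M (\<lambda>x. x * (x * (pochhammer l n / fact n * poly (P n) x)))" for n
  proof -
    have "(\<lambda>x. pochhammer l n / fact n * poly (P n) x) = poly (smult (pochhammer l n / fact n) (P n))"
      "(\<lambda>x. x * (pochhammer l n / fact n * poly (P n) x))
        = poly ([:0, 1:] * smult (pochhammer l n / fact n) (P n))"
      "(\<lambda>x. x * (x * (pochhammer l n / fact n * poly (P n) x)))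
        = poly ([:0, 1:] * ([:0, 1:] * smult (pochhammer l n / fact n) (P n)))"
      by (simp_all add: fun_eq_iff)
    then show "integrable M (\<lambda>x. pochhammer l n / fact n * poly (P n) x)"
      "integrable M (\<lambda>x. x * (pochhammer l n / fact n * poly (P n) x))"
      "integrable M (\<lambda>x. x * (x * (pochhammer l n / fact n * poly (P n) x)))"
      using integrable_poly[OF mom] by (simp_all only:)
  qed
  have nth: "fps_nth (generating_fps l P x) n = of_real (pochhammer l n / fact n * poly (P n) x)"
    "fps_nth (fps_const (of_real x) * generating_fps l P x) n = of_real (x * (pochhammer l n / fact n * poly (P n) x))"
    "fps_nth (fps_const (of_real x) * (fps_const (of_real x) * generating_fps l P x)) n
      = of_real (x * (x * (pochhammer l n / fact n * poly (P n) x)))" for x n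
    by (simp_all add: generating_fps_def)
  show "fps_integrable M (generating_fps l P)"
    "fps_integrable M (\<lambda>x. fps_const (of_real x) * generating_fps l P x)"
    "fps_integrable M (\<lambda>x. fps_const (of_real x) * (fps_const (of_real x) * generating_fps l P x))"
    unfolding fps_integrable_def nth by (rule allI integrable_of_real i)+
  show "fps_integral M (generating_fps l P) = 1"
    unfolding fps_integral_def nth integral_complex_of_real
    by (simp add: fps_eq_iff I)
  have "(\<integral>x. x * (pochhammer l n / fact n * poly (P n) x) \<partial>M) = (if n = 1 then l else 0)" for n
  proof -
    have "(\<integral>x. x * (pochhammer l n / fact n * poly (P n) x) \<partial>M)
        = (\<integral>x. pochhammer l n / fact n * (x * poly (P n) x) \<partial>M)"
      by (simp only: ac_simps)
    then show ?thesis by (simp add: I)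
  qed
  then show "fps_integral M (\<lambda>x. fps_const (of_real x) * generating_fps l P x) = fps_const (of_real l) * fps_X"
    unfolding fps_integral_def nth integral_complex_of_real
    by (simp add: fps_eq_iff)
  have "(\<integral>x. x * (x * (pochhammer l n / fact n * poly (P n) x)) \<partial>M)
      = (if n = 0 then 1 else if n = 1 then l * \<alpha> 1 else if n = 2 then l * (l + 1) / 2 * \<omega> 2 else 0)" for n
  proof -
    have "(\<integral>x. x * (x * (pochhammer l n / fact n * poly (P n) x)) \<partial>M)
        = (\<integral>x. pochhammer l n / fact n * (x * x * poly (P n) x) \<partial>M)"
      by (simp only: ac_simps)
    then show ?thesis by (simp add: I pochhammer_Suc numeral_2_eq_2)
  qed
  then show "fps_integral M (\<lambda>x. fps_const (of_real x) * (fps_const (of_real x) * generating_fps l P x))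
      = 1 + fps_const (of_real (l * \<alpha> 1)) * fps_X + fps_const (of_real (l * ((l + 1) * \<omega> 2 / 2))) * fps_X\<^sup>2"
    unfolding fps_integral_def nth integral_complex_of_real
    by (simp add: fps_eq_iff fps_X_power_iff)
qed

text \<open>The equation and its product with x are arranged so that x occurs only inside \<Psi>, x
  \<Psi> and x^2 \<Psi>. All other factors are free of x and can be taken out of the coefficientwise
  integral.\<close>

lemma integrated_relations:
  fixes F v :: "complex fps"
  assumes M: "standard_measure M" and P: "jacobi_szego M P \<alpha> \<omega>"
    and rel: "AE x in M.
      fps_X * (F - fps_const (of_real x) * fps_X) * fps_deriv (generating_fps l P x)
      + fps_const (of_real l) * (fps_X * fps_deriv F - F) * generating_fps l P x
      = v * ((F - fps_const (of_real x) * fps_X) * generating_fps l P x)"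
  defines "L \<equiv> fps_const (complex_of_real l)" and "T \<equiv> fps_X * fps_deriv F - F"
    and "a \<equiv> fps_const (complex_of_real (\<alpha> 1))" and "b \<equiv> fps_const (complex_of_real ((l + 1) * \<omega> 2 / 2))"
  shows "v * (F - L * fps_X\<^sup>2) = L * (T - fps_X\<^sup>2)"
    "v * (L * F - (1 + L * a * fps_X + L * b * fps_X\<^sup>2)) = L * (F - a * fps_X - 2 * b * fps_X\<^sup>2 + L * T)"
proof -
  define \<Psi> where "\<Psi> = generating_fps l P"
  define \<Psi>1 where "\<Psi>1 x = fps_const (of_real x) * \<Psi> x" for x
  define \<Psi>2 where "\<Psi>2 x = fps_const (of_real x) * \<Psi>1 x" for x
  note J = generating_fps_integrals[OF M P, of l, folded \<Psi>_def, folded \<Psi>1_def, folded \<Psi>2_def]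
  have d1: "fps_deriv (\<Psi>1 x) = fps_const (of_real x) * fps_deriv (\<Psi> x)"
    and d2: "fps_deriv (\<Psi>2 x) = fps_const (of_real x) * (fps_const (of_real x) * fps_deriv (\<Psi> x))" for x
    by (simp_all add: \<Psi>1_def \<Psi>2_def)
  note ints = fps_integral_add fps_integral_mult_left fps_integral_deriv J
  have r1: "AE x in M. (fps_X * F) * fps_deriv (\<Psi> x) + (L * T) * \<Psi> x + (v * fps_X) * \<Psi>1 x
      = (v * F) * \<Psi> x + fps_X\<^sup>2 * fps_deriv (\<Psi>1 x)"
    using rel unfolding d1 \<Psi>_def[symmetric]
    by eventually_elim (simp add: L_def T_def \<Psi>1_def power2_eq_square algebra_simps)
  have r2: "AE x in M. (fps_X * F) * fps_deriv (\<Psi>1 x) + (L * T) * \<Psi>1 x + (v * fps_X) * \<Psi>2 x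
      = (v * F) * \<Psi>1 x + fps_X\<^sup>2 * fps_deriv (\<Psi>2 x)"
    using r1
  proof eventually_elim
    case (elim x)
    from arg_cong[OF this, of "\<lambda>A. fps_const (of_real x) * A"]
    show ?case unfolding d1 d2 by (simp add: \<Psi>1_def \<Psi>2_def algebra_simps)
  qed
  have "fps_integral M (\<lambda>x. (fps_X * F) * fps_deriv (\<Psi> x) + (L * T) * \<Psi> x + (v * fps_X) * \<Psi>1 x)
      = fps_integral M (\<lambda>x. (v * F) * \<Psi> x + fps_X\<^sup>2 * fps_deriv (\<Psi>1 x))"
    by (intro fps_integral_cong_AE r1 ints)
  \<comment> \<open>The entries 0, 1, \<open>L * fps_X\<close> and L are the integrals of \<Psi>',
    \<Psi>, \<Psi>1 and \<Psi>1'.\<close>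
  then have "fps_X * F * 0 + L * T * 1 + v * fps_X * (L * fps_X) = v * F * 1 + fps_X\<^sup>2 * L"
    by (simp add: ints L_def)
  then show "v * (F - L * fps_X\<^sup>2) = L * (T - fps_X\<^sup>2)"
    by (simp add: power2_eq_square algebra_simps)
  have "fps_integral M (\<lambda>x. (fps_X * F) * fps_deriv (\<Psi>1 x) + (L * T) * \<Psi>1 x + (v * fps_X) * \<Psi>2 x)
      = fps_integral M (\<lambda>x. (v * F) * \<Psi>1 x + fps_X\<^sup>2 * fps_deriv (\<Psi>2 x))"
    by (intro fps_integral_cong_AE r2 ints)
  moreover have La: "fps_const (complex_of_real (l * \<alpha> 1)) = L * a"
    and Lb: "fps_const (complex_of_real (l * ((l + 1) * \<omega> 2 / 2))) = L * b"
    by (simp_all add: L_def a_def b_def)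
  moreover have "fps_deriv (1 + L * a * fps_X + L * b * fps_X\<^sup>2) = L * a + 2 * L * b * fps_X"
    by (simp add: L_def a_def b_def fps_deriv_power)
  ultimately have "fps_X * F * L + L * T * (L * fps_X) + v * fps_X * (1 + L * a * fps_X + L * b * fps_X\<^sup>2)
      = v * F * (L * fps_X) + fps_X\<^sup>2 * (L * a + 2 * L * b * fps_X)"
    by (simp only: ints) (simp add: L_def)
  then have "fps_X * (v * (L * F - (1 + L * a * fps_X + L * b * fps_X\<^sup>2)))
      = fps_X * (L * (F - a * fps_X - 2 * b * fps_X\<^sup>2 + L * T))"
    by (simp add: power2_eq_square algebra_simps)
  then show "v * (L * F - (1 + L * a * fps_X + L * b * fps_X\<^sup>2)) = L * (F - a * fps_X - 2 * b * fps_X\<^sup>2 + L * T)"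
    by simp
qed


section \<open>The rescaled polynomials of statement (B)\<close>

definition scaled_jacobi :: "real \<Rightarrow> real \<Rightarrow> nat \<Rightarrow> real poly" where
  "scaled_jacobi l e n = smult ((2 * l / sqrt (2 * l - 1)) ^ n)
     (pcompose (jacobi_monic l e n) [:- e / (2 * l), sqrt (2 * l - 1) / (2 * l):])"

lemma poly_scaled_jacobi:
  "poly (scaled_jacobi l e n) x = (2 * l / sqrt (2 * l - 1)) ^ n *
     poly (jacobi_monic l e n) ((sqrt (2 * l - 1) * x - e) / (2 * l))"
  by (simp add: scaled_jacobi_def poly_pcompose diff_divide_distrib mult.commute)

text \<open>The weights of the generating function are, up to 2^n, the factors that the monic
  normalisation divided out. The two cancel, and 2^n is absorbed by the scaling.\<close>

lemma poly_scaled_jacobi_gegenbauer_sum: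
  assumes "l > 1/2"
  shows "pochhammer l n / fact n * poly (scaled_jacobi l e n) x
    = (l / sqrt (2 * l - 1)) ^ n * poly (gegenbauer_sum l e n) ((sqrt (2 * l - 1) * x - e) / (2 * l))"
proof -
  have "pochhammer l n > 0" using assms by (intro pochhammer_pos) simp
  moreover have "(2 * l / sqrt (2 * l - 1)) ^ n = 2 ^ n * (l / sqrt (2 * l - 1)) ^ n"
    by (simp add: power_mult_distrib power_divide)
  ultimately show ?thesis
    unfolding poly_scaled_jacobi jacobi_monic_def by simp
qed

lemma scaled_jacobi_rec:
  assumes l: "l > 1/2" and e: "e * e = 1"
  defines "s \<equiv> sqrt (2 * l - 1)"
  shows "x * poly (scaled_jacobi l e n) x = poly (scaled_jacobi l e (Suc n)) x
    + (2 * l / s * (e / 2 * (real n / (real n + l - 1) - (real n + 1) / (real n + l))) + e / s)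
        * poly (scaled_jacobi l e n) x
    + (if n = 0 then 0 else ((2 * l / s)\<^sup>2 * (real n * (real n + 2 * l - 2) / (4 * (real n + l - 1)\<^sup>2)))
        * poly (scaled_jacobi l e (n - 1)) x)"
proof -
  have s: "s > 0" using l by (simp add: s_def)
  define t where "t = (s * x - e) / (2 * l)"
  define c where "c = 2 * l / s"
  have "c * t + e / s = x" using s l by (simp add: c_def t_def field_simps)
  then have x: "x * y = c * (t * y) + e / s * y" for y by (metis distrib_right mult.assoc)
  have Q: "poly (scaled_jacobi l e n) x = c ^ n * poly (jacobi_monic l e n) t" for n
    by (simp add: poly_scaled_jacobi c_def t_def s_def)
  define a where "a = e / 2 * (real n / (real n + l - 1) - (real n + 1) / (real n + l))"
  define w where "w = real n * (real n + 2 * l - 2) / (4 * (real n + l - 1)\<^sup>2)"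
  have rec: "t * poly (jacobi_monic l e n) t = poly (jacobi_monic l e (Suc n)) t
      + a * poly (jacobi_monic l e n) t + (if n = 0 then 0 else w * poly (jacobi_monic l e (n - 1)) t)"
    unfolding a_def w_def by (rule jacobi_monic_rec[OF l e])
  have "x * poly (scaled_jacobi l e n) x
      = c * c ^ n * (t * poly (jacobi_monic l e n) t) + e / s * (c ^ n * poly (jacobi_monic l e n) t)"
    unfolding Q x by simp
  also have "\<dots> = c ^ Suc n * poly (jacobi_monic l e (Suc n)) t
      + (c * a + e / s) * (c ^ n * poly (jacobi_monic l e n) t)
      + (if n = 0 then 0 else (c\<^sup>2 * w) * (c ^ (n - 1) * poly (jacobi_monic l e (n - 1)) t))"
    unfolding rec by (cases n) (simp_all add: power2_eq_square distrib_left distrib_right)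
  finally show ?thesis unfolding Q c_def a_def w_def .
qed

lemma measure_support_nonempty:
  assumes "real_distribution M"
  shows "measure_support M \<noteq> {}"
proof
  interpret real_distribution M by fact
  assume "measure_support M = {}"
  then have "AE x in M. False" using AE_measure_support[of M] by simp
  then show False by simp
qed

text \<open>The Riccati equation determines only the square of a; its sign selects between the two
  alternatives of (B).\<close>

lemma sgn_leading_parameter:
  fixes a l :: real
  assumes "a\<^sup>2 * (l + 1)\<^sup>2 * (2 * l - 1) = 4" "l > 1/2"
  shows "a * (l + 1) / 2 = sgn a / sqrt (2 * l - 1)"
proof -
  have "(\<bar>a\<bar> * (l + 1) * sqrt (2 * l - 1))\<^sup>2 = 2\<^sup>2"
    using assms by (simp add: power_mult_distrib)
  moreover have "\<bar>a\<bar> * (l + 1) * sqrt (2 * l - 1) \<ge> 0" using assms by simp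
  ultimately have "\<bar>a\<bar> * (l + 1) * sqrt (2 * l - 1) = 2"
    by (subst (asm) power2_eq_iff_nonneg) simp_all
  moreover have "a = sgn a * \<bar>a\<bar>" by (simp add: sgn_mult_abs)
  ultimately have "a * (l + 1) * sqrt (2 * l - 1) = sgn a * 2"
    by (metis mult.assoc)
  then show ?thesis using assms by (simp add: field_simps)
qed

lemma ultraspherical_generating_imp_scaled_jacobi:
  assumes l: "l > 0" "l \<noteq> 1" and M: "standard_measure \<mu>" and P: "jacobi_szego \<mu> P \<alpha> \<omega>"
    and \<alpha>1: "\<alpha> 1 \<noteq> 0" and gen: "ultraspherical_generating l \<mu> P S u f"
    and E: "\<And>z. z \<in> S \<Longrightarrow> f z - (of_real ((l + 1) * \<omega> 2) * z + of_real (\<alpha> 1)) / 2 = poly E z / z"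
  shows "l > 1/2 \<and> P = scaled_jacobi l (sgn (\<alpha> 1))"
proof -
  define a b where "a = \<alpha> 1" and "b = (l + 1) * \<omega> 2 / 2"
  have S: "open S" "0 \<in> closure S" "S \<noteq> {}" and S0: "0 \<notin> S"
    using gen by (auto simp: ultraspherical_generating_def)
  have real_dist: "real_distribution \<mu>" using M by (simp add: standard_measure_def)
  then interpret real_distribution \<mu> .
  define F where "F = E + [:0, of_real (a / 2), of_real b:]"
  have F: "f z = poly F z / z" if "z \<in> S" for z
  proof -
    have "z \<noteq> 0" using that S0 by auto
    have "f z = poly E z / z + (of_real ((l + 1) * \<omega> 2) * z + of_real (\<alpha> 1)) / 2"
      using E[OF that] by (simp add: diff_eq_eq)
    also have "\<dots> = poly F z / z"
      using \<open>z \<noteq> 0\<close> by (simp add: F_def a_def b_def field_simps)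
    finally show ?thesis .
  qed
  have nontriv: "at 0 within S \<noteq> bot"
    using S(2) S0 by (simp add: trivial_limit_within islimpt_in_closure)
  have "((\<lambda>z. z * f z) \<longlongrightarrow> 1) (at 0 within S)"
    using gen by (simp add: ultraspherical_generating_def)
  moreover have "eventually (\<lambda>z. z * f z = poly F z) (at 0 within S)"
    using S0 unfolding eventually_at_filter by (intro always_eventually) (auto simp: F)
  ultimately have "(poly F \<longlongrightarrow> 1) (at 0 within S)"
    by (rule Lim_transform_eventually)
  moreover have "(poly F \<longlongrightarrow> poly F 0) (at 0 within S)"
    by (rule tendsto_within_subset[of _ _ 0 UNIV]) (use poly_isCont[of 0 F] in \<open>auto simp: isCont_def\<close>)
  ultimately have F0: "poly F 0 = 1" using nontriv tendsto_unique by blast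
  define X where "X = measure_support \<mu>"
  have sums: "(\<lambda>n. fps_nth (generating_fps l P x) n * z ^ n) sums (1 / (u z * (f z - of_real x) powr of_real l))"
    if "x \<in> X" "z \<in> S" for x z
    using gen that by (simp add: ultraspherical_generating_def generating_fps_def X_def)
  \<comment> \<open>Convergence at a single point of S bounds all radii of convergence from below at
    once, uniformly in x.\<close>
  obtain z1 where z1: "z1 \<in> S" using S by blast
  have P0: "P 0 = 1" using monic_orthogonal_0[OF jacobi_szegoD(1)[OF P]] .
  have \<Psi>0: "fps_nth (generating_fps l P x) 0 = 1" for x by (simp add: generating_fps_def P0)
  obtain v where v: "\<And>x. x \<in> X \<Longrightarrow>
      fps_X * (fps_of_poly F - fps_const (of_real x) * fps_X) * fps_deriv (generating_fps l P x)
      + fps_const (of_real l) * (fps_X * fps_deriv (fps_of_poly F) - fps_of_poly F) * generating_fps l P x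
      = v * ((fps_of_poly F - fps_const (of_real x) * fps_X) * generating_fps l P x)"
  proof (rule generating_function_fps_relation[of S u f F "ereal (norm z1)" X "generating_fps l P" l, OF S(1,2) S0])
    show "0 < ereal (norm z1)" using z1 S0 by auto
    show "ereal (norm z1) \<le> fps_conv_radius (generating_fps l P x)" if "x \<in> X" for x
      unfolding fps_conv_radius_def using sums[OF that z1] by (intro conv_radius_geI) (auto simp: sums_iff)
    show "eval_fps (generating_fps l P x) z = 1 / (u z * (f z - of_real x) powr of_real l)"
      if "x \<in> X" "z \<in> S" for x z
      using sums[OF that] by (simp add: eval_fps_def sums_iff)
    show "X \<noteq> {}" unfolding X_def by (rule measure_support_nonempty[OF real_dist])
  qed (use gen F F0 \<Psi>0 that in \<open>auto simp: ultraspherical_generating_def\<close>)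
  define T where "T = fps_X * fps_deriv (fps_of_poly F) - fps_of_poly F"
  have "AE x in \<mu>. x \<in> X" unfolding X_def by (rule AE_measure_support) simp
  then have AE: "AE x in \<mu>. fps_X * (fps_of_poly F - fps_const (of_real x) * fps_X) * fps_deriv (generating_fps l P x)
      + fps_const (of_real l) * (fps_X * fps_deriv (fps_of_poly F) - fps_of_poly F) * generating_fps l P x
      = v * ((fps_of_poly F - fps_const (of_real x) * fps_X) * generating_fps l P x)"
    by eventually_elim (rule v)
  define L A B where "L = fps_const (complex_of_real l)" and "A = fps_const (complex_of_real a)"
    and "B = fps_const (complex_of_real b)"
  note rel = integrated_relations[OF M P AE, folded T_def a_def b_def, folded L_def A_def B_def]
  define Fp where "Fp = fps_of_poly F"
  \<comment> \<open>Each relation is multiplied by the cofactor of v in the other one, so that v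
    disappears.\<close>
  have "L * ((T - fps_X\<^sup>2) * (L * Fp - (1 + L * A * fps_X + L * B * fps_X\<^sup>2)))
      = L * ((Fp - L * fps_X\<^sup>2) * (Fp - A * fps_X - 2 * B * fps_X\<^sup>2 + L * T))"
  proof -
    have "(v * (Fp - L * fps_X\<^sup>2)) * (L * Fp - (1 + L * A * fps_X + L * B * fps_X\<^sup>2))
      = (Fp - L * fps_X\<^sup>2) * (v * (L * Fp - (1 + L * A * fps_X + L * B * fps_X\<^sup>2)))"
      by (simp only: ac_simps)
    then show ?thesis unfolding rel[folded Fp_def] by (simp only: ac_simps)
  qed
  moreover have "L \<noteq> 0" using l by (simp add: L_def)
  ultimately have "(T - fps_X\<^sup>2) * (L * Fp - (1 + L * A * fps_X + L * B * fps_X\<^sup>2))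
      = (Fp - L * fps_X\<^sup>2) * (Fp - A * fps_X - 2 * B * fps_X\<^sup>2 + L * T)"
    by simp
  then have "T * (L * L * fps_X\<^sup>2 - (1 + L * A * fps_X + L * B * fps_X\<^sup>2))
      = Fp * Fp - (A * fps_X + 2 * B * fps_X\<^sup>2) * Fp + (- fps_X\<^sup>2 + L * B * fps_X\<^sup>2 * fps_X\<^sup>2)"
    by (simp add: algebra_simps)
  moreover have "T = fps_of_poly ([:0, 1:] * pderiv F - F)"
    by (simp add: T_def fps_of_poly_diff fps_of_poly_mult fps_of_poly_pderiv fps_of_poly_pCons)
  moreover have "L * L * fps_X\<^sup>2 - (1 + L * A * fps_X + L * B * fps_X\<^sup>2)
      = fps_of_poly ([:0, 0, of_real (l\<^sup>2):] - [:1, of_real (l * a), of_real (l * b):])"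
    by (simp add: L_def A_def B_def fps_of_poly_diff fps_of_poly_pCons power2_eq_square algebra_simps)
  moreover have "Fp * Fp - (A * fps_X + 2 * B * fps_X\<^sup>2) * Fp + (- fps_X\<^sup>2 + L * B * fps_X\<^sup>2 * fps_X\<^sup>2)
      = fps_of_poly (F * F - [:0, of_real a, of_real (2 * b):] * F + [:0, 0, -1, 0, of_real (l * b):])"
    by (simp add: Fp_def L_def A_def B_def fps_of_poly_add fps_of_poly_diff fps_of_poly_mult
        fps_of_poly_pCons power2_eq_square numeral_fps_const algebra_simps)
  ultimately have poly_eq: "([:0, 1:] * pderiv F - F) * ([:0, 0, of_real (l\<^sup>2):] - [:1, of_real (l * a), of_real (l * b):])
      = F * F - [:0, of_real a, of_real (2 * b):] * F + [:0, 0, -1, 0, of_real (l * b):]"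
    by (metis fps_of_poly_mult fps_of_poly_eq_iff)
  have "b \<ge> 0" using l jacobi_szegoD(3)[OF P, of 2] by (simp add: b_def)
  moreover have "poly E 0 = 1" using F0 by (simp add: F_def)
  ultimately have sol: "l > 1/2" "a\<^sup>2 * (l + 1)\<^sup>2 * (2 * l - 1) = 4"
      "F = [:1, of_real (a * (l + 1) / 2), of_real (l\<^sup>2 / (2 * l - 1)):]"
    using riccati_polynomial_solution[OF l _ _ F_def _ poly_eq] \<alpha>1 unfolding a_def by blast+
  define e s where "e = sgn a" and "s = sqrt (2 * l - 1)"
  have e: "e = 1 \<or> e = -1" using \<alpha>1 by (auto simp: e_def a_def sgn_if)
  then have ee: "e * e = 1" by auto
  have s: "s > 0" "s * s = 2 * l - 1" using sol(1) by (simp_all add: s_def)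
  have "a * (l + 1) / 2 = e / s"
    using sgn_leading_parameter[OF sol(2,1)] by (simp add: e_def s_def)
  \<comment> \<open>Chosen such that \<kappa> - \<delta> and \<kappa>^2 are the nonconstant
    coefficients of F, with the sign of \<open>\<alpha> 1\<close> carried along.\<close>
  define \<kappa> \<delta> where "\<kappa> = e * l / s" and "\<delta> = e * (l - 1) / s"
  have kd: "\<kappa> - \<delta> = e / s" by (simp add: \<kappa>_def \<delta>_def diff_divide_distrib[symmetric] algebra_simps)
  have kk: "\<kappa>\<^sup>2 = l\<^sup>2 / (2 * l - 1)"
    using ee s by (simp add: \<kappa>_def power2_eq_square)
  have k2: "\<kappa>\<^sup>2 - \<delta>\<^sup>2 = 1"
  proof -
    have "\<delta>\<^sup>2 = (l - 1)\<^sup>2 / (2 * l - 1)"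
      using ee s by (simp add: \<delta>_def power2_eq_square)
    then have "\<kappa>\<^sup>2 - \<delta>\<^sup>2 = (l\<^sup>2 - (l - 1)\<^sup>2) / (2 * l - 1)"
      by (simp only: kk diff_divide_distrib)
    also have "l\<^sup>2 - (l - 1)\<^sup>2 = 2 * l - 1" by (simp add: power2_eq_square algebra_simps)
    finally show ?thesis using sol(1) by simp
  qed
  have lk: "l = \<kappa> * (\<kappa> + \<delta>)"
  proof -
    have "\<kappa> + \<delta> = e * (2 * l - 1) / s"
      by (simp add: \<kappa>_def \<delta>_def add_divide_distrib[symmetric] algebra_simps)
    also have "\<dots> = e * s" using s by (metis nonzero_mult_div_cancel_right less_irrefl mult.assoc)
    finally have "\<kappa> * (\<kappa> + \<delta>) = (e * e) * l" using s by (simp add: \<kappa>_def)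
    then show ?thesis by (simp add: ee)
  qed
  have F': "fps_of_poly F = fps_of_poly [:1, of_real (\<kappa> - \<delta>), of_real (\<kappa>\<^sup>2):]"
    unfolding sol(3) kd kk \<open>a * (l + 1) / 2 = e / s\<close> ..
  have coeffs: "poly (P n) x = poly (scaled_jacobi l e n) x" if "x \<in> X" for n x
  proof -
    have "fps_nth (generating_fps l P x) n
        = of_real ((l / s) ^ n * poly (gegenbauer_sum l e n) ((s * x - e) / (2 * l)))"
    proof (rule generating_function_coeffs[OF k2 lk F' _ \<Psi>0 v[OF that] e])
      show "v * (fps_of_poly F - fps_const (of_real l) * fps_X\<^sup>2)
          = fps_const (of_real l) * (fps_X * fps_deriv (fps_of_poly F) - fps_of_poly F - fps_X\<^sup>2)"
        using rel(1) by (simp only: L_def T_def)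
      show "l / s = e * \<kappa>" using ee by (simp add: \<kappa>_def)
      show "0 < l / s" using l s by simp
      show "2 * ((s * x - e) / (2 * l)) * (l / s) = x - (\<kappa> - \<delta>)"
        unfolding kd using l s by (simp add: field_simps)
    qed
    then have "pochhammer l n / fact n * poly (P n) x
        = (l / s) ^ n * poly (gegenbauer_sum l e n) ((s * x - e) / (2 * l))"
      unfolding generating_fps_def fps_nth_Abs_fps of_real_eq_iff .
    also have "\<dots> = pochhammer l n / fact n * poly (scaled_jacobi l e n) x"
      using poly_scaled_jacobi_gegenbauer_sum[OF sol(1)] by (simp add: s_def)
    finally show ?thesis using pochhammer_pos[OF l(1), of n] by simp
  qed
  \<comment> \<open>The generating function gives equality on the support only, that is almost
    everywhere; the recurrence of the scaled Jacobi polynomials extends it to an equality of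
    polynomials.\<close>
  have "P = scaled_jacobi l e"
  proof (rule recurrence_determined_AE[OF prob_space_axioms _ P _ scaled_jacobi_rec[OF sol(1) ee]])
    show "has_moments \<mu>" using M by (simp add: standard_measure_def has_moments_def)
    show "poly (scaled_jacobi l e 0) x = 1" for x
      by (simp add: poly_scaled_jacobi jacobi_monic_def)
    show "0 < (2 * l / sqrt (2 * l - 1))\<^sup>2 * (real n * (real n + 2 * l - 2) / (4 * (real n + l - 1)\<^sup>2))"
      if "n \<ge> 1" for n
    proof -
      \<comment> \<open>The critical index is n = 1, where the two quantities are 2 l - 1 and
        l.\<close>
      have "real n + 2 * l - 2 > 0" "real n + l - 1 > 0" using that sol(1) by auto
      then show ?thesis using that sol(1) by simp
    qed
    show "AE x in \<mu>. poly (P n) x = poly (scaled_jacobi l e n) x" for n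
      using \<open>AE x in \<mu>. x \<in> X\<close> by eventually_elim (rule coeffs)
  qed
  then show ?thesis using sol(1) by (simp add: e_def a_def)
qed

section \<open>From the Jacobi polynomials to the density\<close>

text \<open>The weights of (i) and (ii) in one formula; the indicator inside
  \<open>jacobi_weight\<close> is pulled back as well and cuts out the interval.\<close>

definition scaled_weight :: "real \<Rightarrow> real \<Rightarrow> real \<Rightarrow> real" where
  "scaled_weight l e x =
     jacobi_weight (l - 1 + e/2) (l - 1 - e/2) ((sqrt (2 * l - 1) * x - e) / (2 * l))"

lemma scaled_weight_measurable [measurable]: "scaled_weight l e \<in> borel_measurable borel"
  unfolding scaled_weight_def[abs_def] by measurable

lemma scaled_weight_nonneg: "scaled_weight l e x \<ge> 0"
  by (simp add: scaled_weight_def jacobi_weight_nonneg)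

lemma jacobi_weight_pos: "x \<in> {-1<..<1} \<Longrightarrow> jacobi_weight a b x > 0"
  by (simp add: jacobi_weight_def)

lemma scaled_argument_iff_interval:
  assumes l: "l > 1/2"
  defines "s \<equiv> sqrt (2 * l - 1)"
  shows "(s * x - e) / (2 * l) \<in> {-1..1} \<longleftrightarrow> x \<in> {(e - 2 * l) / s..(e + 2 * l) / s}"
    "(s * x - e) / (2 * l) \<in> {-1<..<1} \<longleftrightarrow> x \<in> {(e - 2 * l) / s<..<(e + 2 * l) / s}"
proof -
  have s: "s > 0" using l by (simp add: s_def)
  show "(s * x - e) / (2 * l) \<in> {-1..1} \<longleftrightarrow> x \<in> {(e - 2 * l) / s..(e + 2 * l) / s}"
    "(s * x - e) / (2 * l) \<in> {-1<..<1} \<longleftrightarrow> x \<in> {(e - 2 * l) / s<..<(e + 2 * l) / s}"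
    using l s by (auto simp: field_simps)
qed

lemma integrable_scaled_weight_mult:
  assumes l: "l > 1/2" and e: "e = 1 \<or> e = -1" and h: "continuous_on UNIV h"
  shows "integrable lborel (\<lambda>x. scaled_weight l e x * h x)"
proof -
  define s where "s = sqrt (2 * l - 1)"
  have s: "s > 0" using l by (simp add: s_def)
  have "continuous_on UNIV (\<lambda>t. h (a + c * t))" for a c
    by (rule continuous_on_compose2[OF h, of UNIV "\<lambda>t. a + c * t"]) (intro continuous_intros, simp)
  then have "integrable lborel (\<lambda>t. jacobi_weight (l - 1 + e/2) (l - 1 - e/2) t * h (e / s + 2 * l / s * t))"
    by (rule integrable_jacobi_weight_mult[rotated 2]) (use l e in auto)
  then have "integrable lborel (\<lambda>x. jacobi_weight (l - 1 + e/2) (l - 1 - e/2) (- e / (2 * l) + s / (2 * l) * x)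
      * h (e / s + 2 * l / s * (- e / (2 * l) + s / (2 * l) * x)))"
    using s l by (intro lborel_integrable_real_affine) auto
  moreover have "- e / (2 * l) + s / (2 * l) * x = (s * x - e) / (2 * l)" for x
    using l by (simp add: field_simps)
  moreover have "e / s + 2 * l / s * ((s * x - e) / (2 * l)) = x" for x
    using l s by (simp add: field_simps)
  ultimately show ?thesis by (simp only: scaled_weight_def s_def)
qed

lemma has_moments_scaled_density:
  assumes l: "l > 1/2" and e: "e = 1 \<or> e = -1" and "c > 0"
  shows "has_moments (density lborel (\<lambda>x. ennreal (c * scaled_weight l e x)))"
  unfolding has_moments_def
proof
  fix k
  have "integrable lborel (\<lambda>x. c * (scaled_weight l e x * x ^ k))"
    using l e by (intro integrable_mult_right integrable_scaled_weight_mult continuous_intros)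
  then show "integrable (density lborel (\<lambda>x. ennreal (c * scaled_weight l e x))) (\<lambda>x. x ^ k)"
    using \<open>c > 0\<close> by (subst integrable_density) (auto simp: scaled_weight_nonneg mult.assoc)
qed

lemma monic_orthogonal_scaled_jacobi:
  assumes l: "l > 1/2" and e: "e = 1 \<or> e = -1" and c: "c > 0"
  shows "monic_orthogonal (density lborel (\<lambda>x. ennreal (c * scaled_weight l e x))) (scaled_jacobi l e)"
proof -
  define s where "s = sqrt (2 * l - 1)"
  have s: "s > 0" using l by (simp add: s_def)
  define t where "t x = (s * x - e) / (2 * l)" for x
  define k where "k = 2 * l / s"
  have "k > 0" using l s by (simp add: k_def)
  define w where "w = jacobi_weight (l - 1 + e/2) (l - 1 - e/2)"
  define J where "J = jacobi_monic l e"
  have Q: "poly (scaled_jacobi l e n) x = k ^ n * poly (J n) (t x)" for n x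
    by (simp add: poly_scaled_jacobi k_def t_def s_def J_def)
  have "(\<integral>x. poly (scaled_jacobi l e n) x * poly (scaled_jacobi l e m) x
      \<partial>density lborel (\<lambda>x. ennreal (c * scaled_weight l e x))) = 0" if "n \<noteq> m" for n m
  proof -
    have J0: "(\<integral>x. w x * (poly (J n) x * poly (J m) x) \<partial>lborel) = 0"
    proof -
      have "(\<integral>x. poly (J n) x * poly (J m) x \<partial>jacobi_measure (l - 1 + e/2) (l - 1 - e/2)) = 0"
        using monic_orthogonalD(5)[OF monic_orthogonal_jacobi_monic[OF l e] that] by (simp add: J_def)
      then show ?thesis unfolding w_def
        by (subst (asm) integral_jacobi_measure)
          (auto intro!: borel_measurable_continuous_onI continuous_intros)
    qed
    have [measurable]: "(\<lambda>x. poly p x) \<in> borel_measurable borel" for p :: "real poly"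
      by (intro borel_measurable_continuous_onI continuous_intros)
    have "(\<integral>x. poly (scaled_jacobi l e n) x * poly (scaled_jacobi l e m) x
        \<partial>density lborel (\<lambda>x. ennreal (c * scaled_weight l e x)))
      = (\<integral>x. c * scaled_weight l e x * (poly (scaled_jacobi l e n) x * poly (scaled_jacobi l e m) x) \<partial>lborel)"
      using c by (subst integral_density) (auto simp: scaled_weight_nonneg)
    also have "\<dots> = (\<integral>x. c * k ^ n * k ^ m * (w (t x) * (poly (J n) (t x) * poly (J m) (t x))) \<partial>lborel)"
      unfolding Q by (simp add: scaled_weight_def w_def t_def s_def ac_simps)
    also have "\<dots> = c * k ^ n * k ^ m * (\<integral>x. w (t x) * (poly (J n) (t x) * poly (J m) (t x)) \<partial>lborel)"
      by simp
    \<comment> \<open>The affine map x = e/s + k t inverts t, and its Jacobian only contributes a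
      factor to an integral that vanishes.\<close>
    also have "(\<integral>x. w (t x) * (poly (J n) (t x) * poly (J m) (t x)) \<partial>lborel)
        = \<bar>k\<bar> *\<^sub>R (\<integral>x. w (t (e / s + k * x)) * (poly (J n) (t (e / s + k * x)) * poly (J m) (t (e / s + k * x))) \<partial>lborel)"
      using \<open>k > 0\<close> by (intro lborel_integral_real_affine) simp
    also have "t (e / s + k * x) = x" for x
      using s l by (simp add: t_def k_def field_simps)
    then have "(\<lambda>x. w (t (e / s + k * x)) * (poly (J n) (t (e / s + k * x)) * poly (J m) (t (e / s + k * x))))
        = (\<lambda>x. w x * (poly (J n) x * poly (J m) x))" by simp
    finally show ?thesis by (simp add: J0)
  qed
  moreover have "degree (scaled_jacobi l e n) = n \<and> lead_coeff (scaled_jacobi l e n) = 1" for n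
  proof -
    have *: "degree (jacobi_monic l e n) = n" "lead_coeff (jacobi_monic l e n) = 1"
      using jacobi_monic_degree l by auto
    have d: "degree [:- e / (2 * l), s / (2 * l):] = 1" using s l by simp
    have "degree (scaled_jacobi l e n) = n"
      unfolding scaled_jacobi_def using s l * d by (simp add: s_def[symmetric] degree_pcompose del: minus_divide_left)
    moreover have "lead_coeff (scaled_jacobi l e n) = (2 * l / s) ^ n * (s / (2 * l)) ^ n"
      unfolding scaled_jacobi_def lead_coeff_smult s_def[symmetric]
      using * d s l by (subst lead_coeff_comp) simp_all
    then have "lead_coeff (scaled_jacobi l e n) = 1"
      using s l by (simp flip: power_mult_distrib)
    ultimately show ?thesis by blast
  qed
  ultimately show ?thesis unfolding monic_orthogonal_def by blast
qed

lemma scaled_density_square_integral_nonzero: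
  assumes l: "l > 1/2" and e: "e = 1 \<or> e = -1" and c: "c > 0" and "p \<noteq> 0"
  shows "(\<integral>x. poly p x * poly p x \<partial>density lborel (\<lambda>x. ennreal (c * scaled_weight l e x))) \<noteq> 0"
proof (rule poly_square_integral_nonzero[OF refl has_moments_scaled_density[OF l e c]])
  show "0 < c * scaled_weight l e x"
    if "x \<in> {(e - 2 * l) / sqrt (2 * l - 1)<..<(e + 2 * l) / sqrt (2 * l - 1)}" for x
    using that c jacobi_weight_pos unfolding scaled_argument_iff_interval(2)[OF l, symmetric] scaled_weight_def
    by (intro mult_pos_pos)
  show "(e - 2 * l) / sqrt (2 * l - 1) < (e + 2 * l) / sqrt (2 * l - 1)"
    using l by (intro divide_strict_right_mono) auto
qed (use assms in \<open>auto simp: scaled_weight_nonneg\<close>)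

lemma AE_scaled_density:
  assumes l: "l > 1/2"
  shows "AE x in density lborel (\<lambda>x. ennreal (c * scaled_weight l e x)).
    (sqrt (2 * l - 1) * x - e) / (2 * l) \<in> {-1..1}"
  by (subst AE_density) (auto simp: scaled_weight_def jacobi_weight_def indicator_def)

lemma scaled_argument_bound:
  assumes l: "l > 1/2" and e: "e = 1 \<or> e = -1"
    and x: "(sqrt (2 * l - 1) * x - e) / (2 * l) \<in> {-1..1}"
  shows "\<bar>x\<bar> \<le> (1 + 2 * l) / sqrt (2 * l - 1)"
proof -
  have s: "sqrt (2 * l - 1) > 0" using l by simp
  have "\<bar>sqrt (2 * l - 1) * x\<bar> \<le> 1 + 2 * l"
    using x l e by (auto simp: field_simps)
  then show ?thesis using s by (simp add: field_simps abs_mult)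
qed

lemma ex_scaled_probability_density:
  assumes l: "l > 1/2" and e: "e = 1 \<or> e = -1"
  obtains c where "c > 0" "prob_space (density lborel (\<lambda>x. ennreal (c * scaled_weight l e x)))"
proof -
  have int: "integrable lborel (scaled_weight l e)"
    using integrable_scaled_weight_mult[OF l e, of "\<lambda>_. 1"] by simp
  define I where "I = (\<integral>x. scaled_weight l e x \<partial>lborel)"
  have "I \<ge> 0" unfolding I_def by (intro integral_nonneg_AE AE_I2 scaled_weight_nonneg)
  moreover have "I \<noteq> 0"
  proof -
    have "(\<integral>x. poly 1 x * poly 1 x \<partial>density lborel (\<lambda>x. ennreal (1 * scaled_weight l e x)))
        = (\<integral>x. 1 * scaled_weight l e x * (poly 1 x * poly 1 x) \<partial>lborel)"
      by (subst integral_density) (auto simp: scaled_weight_nonneg)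
    moreover have "(\<integral>x. poly 1 x * poly 1 x \<partial>density lborel (\<lambda>x. ennreal (1 * scaled_weight l e x))) \<noteq> 0"
      by (rule scaled_density_square_integral_nonzero[OF l e]) simp_all
    ultimately show ?thesis by (simp add: I_def)
  qed
  ultimately have I: "I > 0" by simp
  have "emeasure (density lborel (\<lambda>x. ennreal (1 / I * scaled_weight l e x))) UNIV
      = (\<integral>\<^sup>+x. ennreal (1 / I * scaled_weight l e x) \<partial>lborel)"
    by (subst emeasure_density) auto
  also have "\<dots> = ennreal (\<integral>x. 1 / I * scaled_weight l e x \<partial>lborel)"
    using int I by (intro nn_integral_eq_integral) (auto simp: scaled_weight_nonneg)
  also have "(\<integral>x. 1 / I * scaled_weight l e x \<partial>lborel) = 1"
    using I by (simp add: I_def)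
  finally show ?thesis
    using I by (intro that[of "1 / I"] prob_spaceI) (auto simp: space_density)
qed

text \<open>A density determines its monic orthogonal polynomials. Conversely, the normalised
  density is a probability measure with the same orthogonal polynomials as \<mu>, hence with the
  same moments, and its bounded support makes the moments decisive.\<close>

lemma scaled_jacobi_iff_density:
  assumes l: "l > 1/2" and e: "e = 1 \<or> e = -1"
    and M: "standard_measure \<mu>" and P: "monic_orthogonal \<mu> P"
  shows "P = scaled_jacobi l e \<longleftrightarrow>
    (\<exists>c>0. \<mu> = density lborel (\<lambda>x. ennreal (c * scaled_weight l e x)))"
proof
  assume "\<exists>c>0. \<mu> = density lborel (\<lambda>x. ennreal (c * scaled_weight l e x))"
  then obtain c where c: "c > 0" and \<mu>: "\<mu> = density lborel (\<lambda>x. ennreal (c * scaled_weight l e x))"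
    by blast
  show "P = scaled_jacobi l e"
    by (rule monic_orthogonal_unique[OF has_moments_scaled_density[OF l e c] P[unfolded \<mu>]
          monic_orthogonal_scaled_jacobi[OF l e c] scaled_density_square_integral_nonzero[OF l e c]])
next
  assume PQ: "P = scaled_jacobi l e"
  obtain c where c: "c > 0" "prob_space (density lborel (\<lambda>x. ennreal (c * scaled_weight l e x)))"
    using ex_scaled_probability_density[OF l e] .
  define \<nu> where "\<nu> = density lborel (\<lambda>x. ennreal (c * scaled_weight l e x))"
  have \<nu>: "real_distribution \<nu>"
    using c(2) by (auto simp: \<nu>_def real_distribution_def real_distribution_axioms_def)
  have \<mu>: "real_distribution \<mu>" and mom: "has_moments \<mu>"
    using M by (auto simp: standard_measure_def has_moments_def)
  have mom': "has_moments \<nu>" unfolding \<nu>_def by (rule has_moments_scaled_density[OF l e c(1)])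
  have "\<mu> = \<nu>"
  proof (rule bounded_support_moments_determine[OF \<mu> mom \<nu> mom'])
    show "AE x in \<nu>. \<bar>x\<bar> \<le> (1 + 2 * l) / sqrt (2 * l - 1)"
      using AE_scaled_density[OF l, of e c] unfolding \<nu>_def
      by eventually_elim (rule scaled_argument_bound[OF l e])
    show "(\<integral>x. x ^ k \<partial>\<mu>) = (\<integral>x. x ^ k \<partial>\<nu>)" for k
    proof -
      have "(\<integral>x. poly (monom 1 k) x \<partial>\<mu>) = (\<integral>x. poly (monom 1 k) x \<partial>\<nu>)"
      proof (rule monic_orthogonal_determines_integrals[OF mom _ mom' _ P])
        show "monic_orthogonal \<nu> P"
          unfolding \<nu>_def PQ by (rule monic_orthogonal_scaled_jacobi[OF l e c(1)])
      qed (use \<mu> \<nu> in \<open>auto simp: real_distribution_def\<close>)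
      then show ?thesis by (simp add: poly_monom)
    qed
  qed
  then show "\<exists>c>0. \<mu> = density lborel (\<lambda>x. ennreal (c * scaled_weight l e x))"
    using c(1) \<nu>_def by blast
qed

section \<open>From the Jacobi polynomials to the generating function\<close>

text \<open>After division by n + 2 the recurrence has coefficients of size at most 2 (1 + l) and 1
  + 2 l. The base B = 3 + 4 l is a convenient number with 2 (1 + l) B + (1 + 2 l) \<le> B^2, so
  geometric growth reproduces itself.\<close>

lemma gegenbauer_bound:
  assumes l: "l > 0" and t: "\<bar>t\<bar> \<le> 1"
  shows "\<bar>poly (gegenbauer l n) t\<bar> \<le> (3 + 4 * l) ^ n"
proof (induction n rule: induct_nat_012)
  case 1
  have "\<bar>t * (2 * l)\<bar> \<le> 1 * (2 * l)"
    unfolding abs_mult using t l by (intro mult_mono) auto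
  then show ?case using l by simp
next
  case (ge2 n)
  define B where "B = 3 + 4 * l"
  have B: "B > 0" using l by (simp add: B_def)
  have 1: "\<bar>2 * (real n + 1 + l) * t * poly (gegenbauer l (Suc n)) t\<bar> \<le> (real n + 2) * (2 * (1 + l)) * B ^ Suc n"
  proof -
    have "\<bar>2 * (real n + 1 + l)\<bar> \<le> (real n + 2) * (2 * (1 + l))" using l by (simp add: algebra_simps)
    then show ?thesis
      using mult_mono[of "\<bar>2 * (real n + 1 + l)\<bar> * \<bar>t\<bar>" "(real n + 2) * (2 * (1 + l)) * 1"
          "\<bar>poly (gegenbauer l (Suc n)) t\<bar>" "B ^ Suc n"] ge2.IH(2) t l
        mult_mono[of "\<bar>2 * (real n + 1 + l)\<bar>" "(real n + 2) * (2 * (1 + l))" "\<bar>t\<bar>" 1]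
      by (simp add: abs_mult B_def)
  qed
  have 2: "\<bar>(real n + 2 * l) * poly (gegenbauer l n) t\<bar> \<le> (real n + 2) * (1 + 2 * l) * B ^ n"
  proof -
    have "\<bar>real n + 2 * l\<bar> \<le> (real n + 2) * (1 + 2 * l)" using l by (simp add: algebra_simps)
    then show ?thesis
      using mult_mono[of "\<bar>real n + 2 * l\<bar>" "(real n + 2) * (1 + 2 * l)"
          "\<bar>poly (gegenbauer l n) t\<bar>" "B ^ n"] ge2.IH(1) l
      by (simp add: abs_mult B_def)
  qed
  have "2 * (1 + l) * B + (1 + 2 * l) \<le> B\<^sup>2"
    using l by (simp add: B_def power2_eq_square algebra_simps)
  then have 3: "(real n + 2) * B ^ n * (2 * (1 + l) * B + (1 + 2 * l)) \<le> (real n + 2) * B ^ n * B\<^sup>2"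
    using B by (intro mult_left_mono) auto
  have "(real n + 2) * \<bar>poly (gegenbauer l (Suc (Suc n))) t\<bar>
      = \<bar>2 * (real n + 1 + l) * t * poly (gegenbauer l (Suc n)) t - (real n + 2 * l) * poly (gegenbauer l n) t\<bar>"
    unfolding gegenbauer_rec[symmetric] by (simp add: abs_mult)
  also have "\<dots> \<le> (real n + 2) * (2 * (1 + l)) * B ^ Suc n + (real n + 2) * (1 + 2 * l) * B ^ n"
    using 1 2 by linarith
  also have "\<dots> = (real n + 2) * B ^ n * (2 * (1 + l) * B + (1 + 2 * l))"
    by (simp add: algebra_simps)
  also have "\<dots> \<le> (real n + 2) * B ^ Suc (Suc n)"
    using 3 by (simp only: power2_eq_square power_Suc ac_simps)
  finally show ?case by (simp add: B_def)
qed simp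

lemma gegenbauer_sum_bound:
  assumes l: "l > 0" and t: "\<bar>t\<bar> \<le> 1" and e: "e = 1 \<or> e = -1"
  shows "\<bar>poly (gegenbauer_sum l e n) t\<bar> \<le> 2 * (3 + 4 * l) ^ n"
proof (cases n)
  case (Suc m)
  have "\<bar>poly (gegenbauer_sum l e n) t\<bar> \<le> \<bar>poly (gegenbauer l (Suc m)) t\<bar> + \<bar>poly (gegenbauer l m) t\<bar>"
    using e by (auto simp: Suc)
  also have "\<dots> \<le> (3 + 4 * l) ^ Suc m + (3 + 4 * l) ^ m"
    by (intro add_mono gegenbauer_bound[OF l t])
  also have "(3 + 4 * l) ^ m \<le> (3 + 4 * l) ^ Suc m"
    using l by (intro power_increasing) auto
  finally show ?thesis using Suc by simp
qed simp

definition gegenbauer_fps :: "real \<Rightarrow> real \<Rightarrow> real \<Rightarrow> complex fps" where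
  "gegenbauer_fps l k t = Abs_fps (\<lambda>n. of_real (k ^ n * poly (gegenbauer l n) t))"

text \<open>The converse reading of \<open>gegenbauer_generating_function_unique\<close>: the
  recurrence, multiplied by k^(m+2), is the differential equation at coefficient m + 1.\<close>

lemma gegenbauer_fps_ode:
  "(1 - fps_const (of_real (2 * t * k)) * fps_X + fps_const (of_real (k\<^sup>2)) * fps_X\<^sup>2) * fps_deriv (gegenbauer_fps l k t)
      = fps_const (of_real l) * (fps_const (of_real (2 * t * k)) - fps_const (of_real (2 * k\<^sup>2)) * fps_X) * gegenbauer_fps l k t"
proof -
  define p q where "p = complex_of_real (2 * t * k)" and "q = complex_of_real (k\<^sup>2)"
  define G where "G = gegenbauer_fps l k t"
  have "fps_deriv G - fps_const p * (fps_X * fps_deriv G) + fps_const q * (fps_X * (fps_X * fps_deriv G))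
      = fps_const (of_real l) * (fps_const p * G - fps_const (2 * q) * (fps_X * G))"
  proof (rule fps_ext)
    fix n
    show "fps_nth (fps_deriv G - fps_const p * (fps_X * fps_deriv G) + fps_const q * (fps_X * (fps_X * fps_deriv G))) n
      = fps_nth (fps_const (of_real l) * (fps_const p * G - fps_const (2 * q) * (fps_X * G))) n"
    proof (cases n)
      case 0
      then show ?thesis by (simp add: G_def gegenbauer_fps_def p_def)
    next
      case (Suc m)
      define c0 c1 c2 where "c0 = poly (gegenbauer l m) t" and "c1 = poly (gegenbauer l (Suc m)) t"
        and "c2 = poly (gegenbauer l (Suc (Suc m))) t"
      have "(real m + 2) * c2 = 2 * (real m + 1 + l) * t * c1 - (real m + 2 * l) * c0"
        unfolding c0_def c1_def c2_def by (rule gegenbauer_rec)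
      then have "k ^ m * k * k * ((real m + 2) * c2) = k ^ m * k * k * (2 * (real m + 1 + l) * t * c1 - (real m + 2 * l) * c0)"
        by simp
      then have "(real m + 2) * (k ^ Suc (Suc m) * c2) - (2 * t * k) * ((real m + 1) * (k ^ Suc m * c1))
          + k\<^sup>2 * (real m * (k ^ m * c0)) = l * ((2 * t * k) * (k ^ Suc m * c1) - 2 * k\<^sup>2 * (k ^ m * c0))"
        by (simp add: power2_eq_square algebra_simps)
      from arg_cong[OF this, of complex_of_real] show ?thesis
        unfolding Suc by (cases m) (simp_all add: G_def gegenbauer_fps_def p_def q_def c0_def c1_def c2_def algebra_simps)
    qed
  qed
  moreover define PP QQ Q2 LL where "PP = fps_const p" and "QQ = fps_const q"
    and "Q2 = fps_const (2 * q)" and "LL = fps_const (complex_of_real l)"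
  ultimately have ode: "fps_deriv G - PP * (fps_X * fps_deriv G) + QQ * (fps_X * (fps_X * fps_deriv G))
      = LL * (PP * G - Q2 * (fps_X * G))"
    by (simp only:)
  have "(1 - PP * fps_X + QQ * fps_X\<^sup>2) * fps_deriv G = LL * (PP - Q2 * fps_X) * G"
    using ode by (simp add: power2_eq_square algebra_simps)
  moreover have "Q2 = fps_const (of_real (2 * k\<^sup>2))" by (simp add: Q2_def q_def)
  ultimately show ?thesis unfolding PP_def QQ_def LL_def G_def p_def q_def by (simp only:)
qed

text \<open>By the differential equation the sum of the series times R^l has derivative 0 on a disc
  where R has positive real part, so it keeps its value 1 from the centre. No choice of branch has
  to be compared.\<close>

lemma gegenbauer_generating_function:
  fixes z :: complex
  assumes l: "l > 0" and t: "\<bar>t\<bar> \<le> 1" and k: "k > 0"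
    and z: "norm z < 1 / (2 * k * (3 + 4 * l))"
  shows "(\<lambda>n. of_real (k ^ n * poly (gegenbauer l n) t) * z ^ n) sums
    (1 / (1 - of_real (2 * t * k) * z + of_real (k\<^sup>2) * z\<^sup>2) powr of_real l)"
proof -
  define B where "B = 3 + 4 * l"
  \<comment> \<open>Chosen so that k \<rho> B = 1/2, which makes the terms of the series at radius
    \<rho> at most 2^(-n).\<close>
  define \<rho> where "\<rho> = 1 / (2 * k * B)"
  have B: "B > 3" using l by (simp add: B_def)
  have \<rho>: "\<rho> > 0" using B k by (simp add: \<rho>_def)
  define G where "G = gegenbauer_fps l k t"
  have rad: "ereal \<rho> \<le> fps_conv_radius G"
  proof -
    have "norm (fps_nth G n * of_real \<rho> ^ n) \<le> (1/2) ^ n" for n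
    proof -
      have "norm (fps_nth G n * of_real \<rho> ^ n) = (k * \<rho>) ^ n * \<bar>poly (gegenbauer l n) t\<bar>"
        using k \<rho> by (simp add: G_def gegenbauer_fps_def norm_mult norm_power abs_mult power_mult_distrib del: of_real_mult of_real_power)
      also have "\<dots> \<le> (k * \<rho>) ^ n * B ^ n"
        unfolding B_def using k \<rho> by (intro mult_left_mono gegenbauer_bound[OF l t]) auto
      also have "\<dots> = (1/2) ^ n"
        using k B by (simp add: \<rho>_def flip: power_mult_distrib)
      finally show ?thesis .
    qed
    then have bound: "\<And>n. 0 \<le> n \<Longrightarrow> norm (fps_nth G n * of_real \<rho> ^ n) \<le> (1/2) ^ n" .
    have "summable (\<lambda>n. (1/2 :: real) ^ n)" by (rule summable_geometric) simp
    then have "summable (\<lambda>n. fps_nth G n * of_real \<rho> ^ n)"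
      by (rule summable_comparison_test'[OF _ bound])
    then have "ereal (norm (complex_of_real \<rho>)) \<le> conv_radius (fps_nth G)" by (rule conv_radius_geI)
    then show ?thesis using \<rho> by (simp add: fps_conv_radius_def)
  qed
  define R where "R w = 1 - of_real (2 * t * k) * w + of_real (k\<^sup>2) * w\<^sup>2" for w :: complex
  define R' where "R' w = - of_real (2 * t * k) + of_real (2 * k\<^sup>2) * w" for w :: complex
  have R: "R w \<notin> \<real>\<^sub>\<le>\<^sub>0" if "norm w < \<rho>" for w
  proof -
    \<comment> \<open>The bound 1/6 gives |R - 1| at most 1/3 + 1/36, which keeps R in the right
      half plane.\<close>
    have kw: "k * norm w < 1/6"
    proof -
      have "k * norm w < k * \<rho>" using that k by simp
      also have "\<dots> = 1 / (2 * B)" using k B by (simp add: \<rho>_def)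
      also have "\<dots> < 1/6" using B by (simp add: field_simps)
      finally show ?thesis .
    qed
    have "norm (R w - 1) \<le> norm (of_real (2 * t * k) * w) + norm (of_real (k\<^sup>2) * w\<^sup>2)"
      unfolding R_def using norm_triangle_ineq4[of "of_real (k\<^sup>2) * w\<^sup>2" "of_real (2 * t * k) * w"]
      by (simp add: algebra_simps)
    also have "\<dots> = 2 * \<bar>t\<bar> * (k * norm w) + (k * norm w)\<^sup>2"
      using k by (simp add: norm_mult norm_power power_mult_distrib)
    also have "\<dots> \<le> 2 * 1 * (1/6) + (1/6)\<^sup>2"
      using kw k t by (intro add_mono mult_mono power_mono) auto
    also have "\<dots> < 1" by (simp add: power2_eq_square)
    finally have "\<bar>Re (R w - 1)\<bar> < 1" using abs_Re_le_cmod[of "R w - 1"] by linarith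
    then have "Re (R w) > 0" by simp
    then show ?thesis by (auto simp: complex_nonpos_Reals_iff)
  qed
  have dR: "(R has_field_derivative R' w) (at w)" for w
    unfolding R_def[abs_def] R'_def by (auto intro!: derivative_eq_intros)
  have ode: "R w * eval_fps (fps_deriv G) w = - of_real l * R' w * eval_fps G w" if "norm w < \<rho>" for w
  proof -
    have 1: "ereal (norm w) < fps_conv_radius G" using that rad by (intro less_le_trans[OF _ rad]) simp
    then have 2: "ereal (norm w) < fps_conv_radius (fps_deriv G)"
      using fps_conv_radius_deriv by (rule less_le_trans)
    define A C where "A = fps_of_poly [:1, - complex_of_real (2 * t * k), of_real (k\<^sup>2):]"
      and "C = fps_of_poly [:complex_of_real (l * (2 * t * k)), - of_real (l * (2 * k\<^sup>2)):]"
    have "A * fps_deriv G = C * G"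
    proof -
      have neg: "fps_const (- c) = - fps_const c" for c :: complex by simp
      have "A = 1 - fps_const (of_real (2 * t * k)) * fps_X + fps_const (of_real (k\<^sup>2)) * fps_X\<^sup>2"
        unfolding A_def fps_of_poly_pCons neg
        by (simp add: power2_eq_square algebra_simps del: fps_const_neg of_real_mult)
      moreover have "C = fps_const (of_real l)
          * (fps_const (of_real (2 * t * k)) - fps_const (of_real (2 * k\<^sup>2)) * fps_X)"
        unfolding C_def fps_of_poly_pCons neg of_real_mult[of l] fps_const_mult[symmetric]
        by (simp add: algebra_simps del: fps_const_neg of_real_mult fps_const_mult)
      ultimately show ?thesis using gegenbauer_fps_ode[of t k l] by (simp only: G_def)
    qed
    then have "eval_fps (A * fps_deriv G) w = eval_fps (C * G) w" by simp
    then have "poly [:1, - complex_of_real (2 * t * k), of_real (k\<^sup>2):] w * eval_fps (fps_deriv G) w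
        = poly [:complex_of_real (l * (2 * t * k)), - of_real (l * (2 * k\<^sup>2)):] w * eval_fps G w"
      using 1 2 by (simp add: eval_fps_mult A_def C_def)
    then show ?thesis by (simp add: R_def R'_def power2_eq_square algebra_simps)
  qed
  define h where "h w = eval_fps G w * R w powr of_real l" for w
  have "\<exists>c. \<forall>w\<in>ball 0 \<rho>. h w = c"
  proof (rule has_field_derivative_zero_constant)
    fix w :: complex assume "w \<in> ball 0 \<rho>"
    then have w: "norm w < \<rho>" by simp
    have "ereal (norm w) < fps_conv_radius G" using w by (intro less_le_trans[OF _ rad]) simp
    then have dG: "(eval_fps G has_field_derivative eval_fps (fps_deriv G) w) (at w)"
      by (rule has_field_derivative_eval_fps)
    have "R w \<noteq> 0" using R[OF w] by auto
    have "(h has_field_derivative (eval_fps (fps_deriv G) w * R w powr of_real l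
        + eval_fps G w * (of_real l * R w powr (of_real l - 1) * R' w))) (at w)"
      unfolding h_def using R[OF w] by (auto intro!: derivative_eq_intros dG dR)
    also have "eval_fps (fps_deriv G) w * R w powr of_real l + eval_fps G w * (of_real l * R w powr (of_real l - 1) * R' w)
        = R w powr of_real l / R w * (R w * eval_fps (fps_deriv G) w + of_real l * R' w * eval_fps G w)"
      using \<open>R w \<noteq> 0\<close> by (simp add: powr_diff field_simps)
    also have "\<dots> = 0" unfolding ode[OF w] by simp
    finally show "(h has_field_derivative 0) (at w within ball 0 \<rho>)" by (rule has_field_derivative_at_within)
  qed simp
  then obtain c where c: "\<And>w. norm w < \<rho> \<Longrightarrow> h w = c" by auto
  have "c = 1" using c[of 0] \<rho> by (simp add: h_def R_def eval_fps_at_0 G_def gegenbauer_fps_def)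
  have z': "norm z < \<rho>" using z by (simp add: \<rho>_def B_def)
  then have "eval_fps G z * R z powr of_real l = 1" using c[of z] \<open>c = 1\<close> by (simp add: h_def)
  moreover have "R z \<noteq> 0" using R[OF z'] by auto
  ultimately have "eval_fps G z = 1 / R z powr of_real l" by (simp add: field_simps)
  moreover have "(\<lambda>n. fps_nth G n * z ^ n) sums eval_fps G z"
    using z' by (intro sums_eval_fps less_le_trans[OF _ rad]) simp
  ultimately show ?thesis by (simp add: G_def gegenbauer_fps_def R_def)
qed


section \<open>Analytic realisation on a half disc\<close>

lemma measure_support_subset:
  assumes "sets M = sets borel" "closed A" "AE x in M. x \<in> A"
  shows "measure_support M \<subseteq> A"
proof
  fix x assume x: "x \<in> measure_support M"
  show "x \<in> A"
  proof (rule ccontr)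
    assume "x \<notin> A"
    moreover have "open (- A)" using assms(2) by auto
    ultimately have "emeasure M (- A) > 0" using x by (auto simp: measure_support_def)
    moreover have "- A \<in> sets M" using \<open>open (- A)\<close> assms(1) by simp
    then have "- A \<in> null_sets M" using assms(3) by (subst AE_iff_null_sets) simp_all
    ultimately show False by (simp add: null_setsD1)
  qed
qed

lemma scaled_jacobi_generating_bound:
  assumes l: "l > 1/2" and e: "e = 1 \<or> e = -1"
    and x: "(sqrt (2 * l - 1) * x - e) / (2 * l) \<in> {-1..1}"
  shows "\<bar>pochhammer l n / fact n * poly (scaled_jacobi l e n) x\<bar>
    \<le> 2 * (l / sqrt (2 * l - 1) * (3 + 4 * l)) ^ n"
proof -
  have k: "l / sqrt (2 * l - 1) > 0" using l by simp
  have "l > 0" using l by simp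
  have "y \<in> {-1..1} \<Longrightarrow> \<bar>y\<bar> \<le> 1" for y :: real by auto
  from this[OF x] have t: "\<bar>(sqrt (2 * l - 1) * x - e) / (2 * l)\<bar> \<le> 1" .
  have "\<bar>(l / sqrt (2 * l - 1)) ^ n * poly (gegenbauer_sum l e n) ((sqrt (2 * l - 1) * x - e) / (2 * l))\<bar>
      \<le> (l / sqrt (2 * l - 1)) ^ n * (2 * (3 + 4 * l) ^ n)"
    unfolding abs_mult using k by (intro mult_mono gegenbauer_sum_bound[OF \<open>l > 0\<close> t e]) auto
  then show ?thesis
    unfolding poly_scaled_jacobi_gegenbauer_sum[OF l] by (simp only: power_mult_distrib ac_simps)
qed

lemma scaled_jacobi_generating_sums:
  fixes z :: complex
  assumes l: "l > 1/2" and e: "e = 1 \<or> e = -1"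
    and x: "(sqrt (2 * l - 1) * x - e) / (2 * l) \<in> {-1..1}"
    and z: "norm z < 1 / (2 * (l / sqrt (2 * l - 1)) * (3 + 4 * l))"
  defines "s \<equiv> sqrt (2 * l - 1)"
  shows "(\<lambda>n. of_real (pochhammer l n / fact n * poly (scaled_jacobi l e n) x) * z ^ n) sums
    ((1 + of_real (e * (l / s)) * z)
      / (1 + of_real (e / s - x) * z + of_real ((l / s)\<^sup>2) * z\<^sup>2) powr of_real l)"
proof -
  define k t where "k = l / s" and "t = (s * x - e) / (2 * l)"
  have s: "s > 0" using l by (simp add: s_def)
  have k: "k > 0" using l s by (simp add: k_def)
  define g where "g n = complex_of_real (k ^ n * poly (gegenbauer l n) t) * z ^ n" for n
  define V where "V = 1 / (1 - of_real (2 * t * k) * z + of_real (k\<^sup>2) * z\<^sup>2) powr complex_of_real l"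
  have g: "g sums V"
    unfolding g_def V_def
  proof (rule gegenbauer_generating_function)
    show "\<bar>t\<bar> \<le> 1"
      using x unfolding t_def[symmetric] s_def[symmetric] by auto
    show "norm z < 1 / (2 * k * (3 + 4 * l))" using z by (simp only: k_def s_def)
  qed (use l k in auto)
  \<comment> \<open>Multiplication by e k z shifts the series by one index; the 0 at
    \<open>n = 0\<close> matches the first clause of \<open>gegenbauer_sum\<close>.\<close>
  have "(\<lambda>n. of_real (e * k) * z * (case n of 0 \<Rightarrow> 0 | Suc m \<Rightarrow> g m)) sums (of_real (e * k) * z * V)"
    using g by (intro sums_mult) (simp add: sums_Suc_iff[of "\<lambda>n. case n of 0 \<Rightarrow> 0 | Suc m \<Rightarrow> g m", simplified])
  then have "(\<lambda>n. g n + of_real (e * k) * z * (case n of 0 \<Rightarrow> 0 | Suc m \<Rightarrow> g m)) sums (V + of_real (e * k) * z * V)"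
    by (intro sums_add g)
  moreover have "g n + of_real (e * k) * z * (case n of 0 \<Rightarrow> 0 | Suc m \<Rightarrow> g m)
      = of_real (pochhammer l n / fact n * poly (scaled_jacobi l e n) x) * z ^ n" for n
    unfolding poly_scaled_jacobi_gegenbauer_sum[OF l]
    unfolding s_def[symmetric] k_def[symmetric] t_def[symmetric]
    by (cases n) (simp_all add: g_def algebra_simps)
  moreover have tk: "2 * t * k = - (e / s - x)"
    using l s by (simp add: t_def k_def field_simps)
  have "1 - complex_of_real (2 * t * k) * z = 1 + of_real (e / s - x) * z"
    unfolding tk of_real_minus by (simp only: mult_minus_left diff_minus_eq_add)
  then have "V + of_real (e * k) * z * V = (1 + of_real (e * (l / s)) * z)
      / (1 + of_real (e / s - x) * z + of_real ((l / s)\<^sup>2) * z\<^sup>2) powr of_real l"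
    unfolding V_def k_def[symmetric] by (simp only: add_divide_distrib times_divide_eq_right mult_1_right)
  ultimately show ?thesis by (simp only:)
qed

text \<open>The witnesses are read off from the closed form (1 + e k z) (F - x z)^(-l) by writing F
  - x z = z (f - x). The set S must make this factorisation compatible with principal powers, which
  an upper half disc does: there f takes values in the lower half plane. For any a and c,
  subtracting a linear function of z from f still leaves a polynomial divided by z.\<close>

lemma scaled_jacobi_imp_generating:
  assumes l: "l > 1/2" and e: "e = 1 \<or> e = -1" and \<mu>: "real_distribution \<mu>" and mom: "has_moments \<mu>"
    and AE: "AE x in \<mu>. (sqrt (2 * l - 1) * x - e) / (2 * l) \<in> {-1..1}"
  shows "\<exists>S u f. ultraspherical_generating l \<mu> (scaled_jacobi l e) S u f \<and>
    interchange_condition l \<mu> (scaled_jacobi l e) S \<and>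
    (\<exists>E :: complex poly. \<forall>z\<in>S. f z - (of_real c * z + of_real a) / 2 = poly E z / z)"
proof -
  interpret real_distribution \<mu> by fact
  define s k where "s = sqrt (2 * l - 1)" and "k = l / s"
  have s: "s > 0" using l by (simp add: s_def)
  have k: "k > 0" using l s by (simp add: k_def)
  define B where "B = 3 + 4 * l"
  define \<rho> where "\<rho> = 1 / (2 * k * B)"
  have B: "B > 3" using l by (simp add: B_def)
  have \<rho>: "\<rho> > 0" using B k by (simp add: \<rho>_def)
  define S :: "complex set" where "S = {z. Im z > 0} \<inter> ball 0 \<rho>"
  have SD: "Im z > 0" "norm z < \<rho>" "z \<noteq> 0" "z \<notin> \<real>\<^sub>\<le>\<^sub>0" "k * norm z < 1 / 2" if "z \<in> S" for z
  proof -
    show "Im z > 0" "norm z < \<rho>" "z \<noteq> 0" "z \<notin> \<real>\<^sub>\<le>\<^sub>0"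
      using that by (auto simp: S_def complex_nonpos_Reals_iff)
    then have "k * norm z < k * \<rho>" using k by simp
    also have "\<dots> = 1 / (2 * B)" using k B by (simp add: \<rho>_def)
    also have "\<dots> < 1 / 2" using B by (simp add: field_simps)
    finally show "k * norm z < 1 / 2" .
  qed
  define q where "q z = 1 + complex_of_real (e * k) * z" for z
  have q: "q z \<noteq> 0" if "z \<in> S" for z
  proof
    assume "q z = 0"
    then have "complex_of_real (e * k) * z = - 1" by (simp add: q_def add_eq_0_iff)
    then have "norm (complex_of_real (e * k) * z) = 1" by simp
    then have "k * norm z = 1" using k e by (auto simp: norm_mult)
    then show False using SD(5)[OF that] by simp
  qed
  \<comment> \<open>The prefactor 1 + e k z is free of x and goes into u, together with the power of
    z split off from F - x z.\<close>
  define u f where "u z = z powr complex_of_real l / q z"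
    and "f z = 1 / z + complex_of_real (e / s) + complex_of_real (k\<^sup>2) * z" for z
  have zf: "z * f z = 1 + of_real (e / s) * z + of_real (k\<^sup>2) * z\<^sup>2" if "z \<noteq> 0" for z
    using that by (simp add: f_def distrib_left power2_eq_square ac_simps)
  \<comment> \<open>The terms 1/z and k^2 z pull in opposite directions; k |z| < 1 makes the first
    one win.\<close>
  have Imf: "Im (f z) < 0" if "z \<in> S" for z
  proof -
    have "(k * norm z)\<^sup>2 < 1\<^sup>2" using SD(5)[OF that] k by (intro power_strict_mono) auto
    then have "k\<^sup>2 < 1 / (norm z)\<^sup>2" using SD(3)[OF that] by (simp add: power_mult_distrib field_simps)
    moreover have "Im (f z) = Im z * (k\<^sup>2 - 1 / (norm z)\<^sup>2)"
      by (simp add: f_def Im_divide cmod_power2 algebra_simps)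
    ultimately show ?thesis using SD(1)[OF that] by (simp add: mult_pos_neg)
  qed
  define A where "A = {x. (s * x - e) / (2 * l) \<in> {-1..1}}"
  have "closed A"
    unfolding A_def s_def scaled_argument_iff_interval(1)[OF l] by (simp only: Collect_mem_eq closed_atLeastAtMost)
  have AE_A: "AE x in \<mu>. x \<in> A" using AE by (simp add: A_def s_def)
  have supp: "measure_support \<mu> \<subseteq> A"
    by (rule measure_support_subset[OF _ \<open>closed A\<close> AE_A]) simp
  have sums: "(\<lambda>n. of_real (pochhammer l n / fact n * poly (scaled_jacobi l e n) x) * z ^ n) sums
      (1 / (u z * (f z - of_real x) powr of_real l))" if "x \<in> A" "z \<in> S" for x z
  proof -
    have z: "z \<noteq> 0" using SD that by blast
    define w where "w = f z - of_real x"
    have "Im w < 0" using Imf[OF that(2)] by (simp add: w_def)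
    then have "w \<noteq> 0" by auto
    \<comment> \<open>The arguments of z and w lie in (0, pi) and (-pi, 0), so their sum stays in
      the principal range and the power of the product is the product of the powers.\<close>
    have "Im (Ln z) > 0" "Im (Ln z) < pi"
      using Im_Ln_pos_lt_imp[OF SD(1)[OF that(2)]] by auto
    moreover have "Im (Ln w) < 0" "Im (Ln w) > - pi"
      using Im_Ln_pos_le[OF \<open>w \<noteq> 0\<close>] Im_Ln_le_pi[OF \<open>w \<noteq> 0\<close>] mpi_less_Im_Ln[OF \<open>w \<noteq> 0\<close>] \<open>Im w < 0\<close>
      by linarith+
    ultimately have "Ln (z * w) = Ln z + Ln w"
      using z \<open>w \<noteq> 0\<close> by (intro Ln_times_simple) auto
    then have "(z * w) powr of_real l = z powr of_real l * w powr of_real l"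
      using z \<open>w \<noteq> 0\<close> by (simp add: powr_def distrib_left exp_add)
    moreover have "z * w = 1 + of_real (e / s - x) * z + of_real (k\<^sup>2) * z\<^sup>2"
      unfolding w_def right_diff_distrib zf[OF z] by (simp add: algebra_simps)
    ultimately have "q z / (1 + of_real (e / s - x) * z + of_real (k\<^sup>2) * z\<^sup>2) powr of_real l
        = 1 / (u z * (f z - of_real x) powr of_real l)"
      using q[OF that(2)] by (simp add: u_def w_def)
    moreover have "(\<lambda>n. of_real (pochhammer l n / fact n * poly (scaled_jacobi l e n) x) * z ^ n) sums
        (q z / (1 + of_real (e / s - x) * z + of_real (k\<^sup>2) * z\<^sup>2) powr of_real l)"
      unfolding q_def k_def s_def
      by (rule scaled_jacobi_generating_sums[OF l e])
        (use that SD(2)[OF that(2)] in \<open>auto simp: A_def s_def \<rho>_def k_def B_def\<close>)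
    ultimately show ?thesis by simp
  qed
  have S: "open S" "connected S" "S \<noteq> {}" "0 \<in> closure S" "S \<inter> \<real>\<^sub>\<le>\<^sub>0 = {}"
  proof -
    show "open S" unfolding S_def by (intro open_Int open_halfspace_Im_gt open_ball)
    show "connected S" unfolding S_def
      by (intro convex_connected convex_Int convex_halfspace_Im_gt convex_ball)
    have in_S: "\<i> * of_real r \<in> S" if "0 < r" "r < \<rho>" for r
      using that by (simp add: S_def norm_mult)
    from in_S[of "\<rho> / 2"] show "S \<noteq> {}" using \<rho> by auto
    show "0 \<in> closure S"
      unfolding closure_approachable
    proof (intro allI impI)
      fix d :: real assume "d > 0"
      have "\<i> * of_real (min (d / 2) (\<rho> / 2)) \<in> S" using \<open>d > 0\<close> \<rho> by (intro in_S) auto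
      moreover have "dist (\<i> * of_real (min (d / 2) (\<rho> / 2))) 0 < d"
        using \<open>d > 0\<close> \<rho> by (simp add: norm_mult min_def)
      ultimately show "\<exists>y\<in>S. dist y 0 < d" by blast
    qed
    show "S \<inter> \<real>\<^sub>\<le>\<^sub>0 = {}" using SD(4) by auto
  qed
  have not0: "eventually (\<lambda>z. z \<in> S) (at 0 within S)"
    by (simp add: eventually_at_filter)
  have an_u: "u analytic_on S"
    unfolding u_def[abs_def] q_def analytic_on_open[OF S(1)]
    using q SD(4) unfolding q_def by (intro holomorphic_intros) auto
  have an_f: "f analytic_on S"
    unfolding f_def[abs_def] analytic_on_open[OF S(1)]
    using SD(3) by (intro holomorphic_intros) auto
  have lim_f: "((\<lambda>z. z * f z) \<longlongrightarrow> 1) (at 0 within S)"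
  proof (rule Lim_transform_eventually)
    show "((\<lambda>z. 1 + of_real (e / s) * z + of_real (k\<^sup>2) * z\<^sup>2) \<longlongrightarrow> 1) (at 0 within S)"
      using s by (auto intro!: tendsto_eq_intros)
    show "eventually (\<lambda>z. 1 + of_real (e / s) * z + of_real (k\<^sup>2) * z\<^sup>2 = z * f z) (at 0 within S)"
      using not0 by eventually_elim (use zf SD(3) in auto)
  qed
  have lim_u: "((\<lambda>z. u z / z powr of_real l) \<longlongrightarrow> 1) (at 0 within S)"
  proof (rule Lim_transform_eventually)
    show "((\<lambda>z. 1 / q z) \<longlongrightarrow> 1) (at 0 within S)"
      unfolding q_def by (auto intro!: tendsto_eq_intros)
    show "eventually (\<lambda>z. 1 / q z = u z / z powr of_real l) (at 0 within S)"
      using not0 by eventually_elim (use SD(3) in \<open>simp add: u_def\<close>)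
  qed
  have gen: "ultraspherical_generating l \<mu> (scaled_jacobi l e) S u f"
    unfolding ultraspherical_generating_def
    using S an_u an_f lim_f lim_u sums supp q SD(3) Imf
    by (auto simp: u_def order_less_imp_not_eq)
  have inter: "interchange_condition l \<mu> (scaled_jacobi l e) S"
    unfolding interchange_condition_def
  proof (intro ballI)
    fix i :: nat and z assume z: "z \<in> S"
    define c where "c n = pochhammer l n / fact n" for n
    define Y where "Y = (1 + 2 * l) / s"
    have Y: "Y \<ge> 0" using l s by (simp add: Y_def)
    define g where "g n x = complex_of_real (c n * x ^ i * poly (scaled_jacobi l e n) x) * z ^ n" for n x
    have g_eq: "g n x = complex_of_real (poly (smult (c n) (monom 1 i * scaled_jacobi l e n)) x) * z ^ n" for n x
      by (simp add: g_def poly_monom)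
    have int: "integrable \<mu> (g n)" for n
      unfolding g_eq[abs_def] by (intro integrable_mult_left integrable_of_real integrable_poly[OF mom])
    \<comment> \<open>From |z| < \<rho> and k B \<rho> = 1/2 comes a geometric majorant that does
      not depend on x in A. It gives both the almost sure absolute convergence and the summable
      norms needed to exchange sum and integral.\<close>
    have bound: "norm (g n x) \<le> 2 * Y ^ i * (1 / 2) ^ n" if "x \<in> A" for n x
    proof -
      have x: "(sqrt (2 * l - 1) * x - e) / (2 * l) \<in> {-1..1}" using that by (simp add: A_def s_def)
      have "\<bar>x\<bar> ^ i \<le> Y ^ i"
        using scaled_argument_bound[OF l e x] by (intro power_mono) (auto simp: Y_def s_def)
      moreover have "\<bar>c n * poly (scaled_jacobi l e n) x\<bar> \<le> 2 * (k * B) ^ n"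
        using scaled_jacobi_generating_bound[OF l e x, of n] by (simp only: c_def k_def s_def B_def)
      ultimately have "\<bar>c n * poly (scaled_jacobi l e n) x\<bar> * \<bar>x\<bar> ^ i * norm z ^ n
          \<le> 2 * (k * B) ^ n * Y ^ i * \<rho> ^ n"
        using k B Y power_mono[OF less_imp_le[OF SD(2)[OF z]], of n] by (intro mult_mono) auto
      also have "\<dots> = 2 * Y ^ i * (k * B * \<rho>) ^ n" by (simp add: power_mult_distrib)
      also have "k * B * \<rho> = 1 / 2" using k B by (simp add: \<rho>_def)
      finally show ?thesis
        by (simp add: g_def norm_mult norm_power abs_mult power_abs ac_simps)
    qed
    have geo: "summable (\<lambda>n. 2 * Y ^ i * (1 / 2) ^ n)"
      by (intro summable_mult summable_geometric) simp
    have AEs: "AE x in \<mu>. summable (\<lambda>n. norm (g n x))"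
      using AE_A
    proof eventually_elim
      case (elim x)
      have "\<And>n. 0 \<le> n \<Longrightarrow> norm (norm (g n x)) \<le> 2 * Y ^ i * (1 / 2) ^ n" using bound[OF elim] by simp
      then show ?case by (rule summable_comparison_test'[OF geo])
    qed
    have "\<bar>\<integral>x. norm (g n x) \<partial>\<mu>\<bar> \<le> 2 * Y ^ i * (1 / 2) ^ n" for n
    proof -
      have "(\<integral>x. norm (g n x) \<partial>\<mu>) \<le> (\<integral>x. 2 * Y ^ i * (1 / 2) ^ n \<partial>\<mu>)"
      proof (rule integral_mono_AE)
        show "AE x in \<mu>. norm (g n x) \<le> 2 * Y ^ i * (1 / 2) ^ n"
          using AE_A by eventually_elim (rule bound)
      qed (use int in auto)
      moreover have "(\<integral>x. norm (g n x) \<partial>\<mu>) \<ge> 0" by simp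
      ultimately show ?thesis using prob_space by simp
    qed
    then have "\<And>n. 0 \<le> n \<Longrightarrow> norm (\<integral>x. norm (g n x) \<partial>\<mu>) \<le> 2 * Y ^ i * (1 / 2) ^ n" by simp
    then have sm: "summable (\<lambda>n. \<integral>x. norm (g n x) \<partial>\<mu>)" by (rule summable_comparison_test'[OF geo])
    have 1: "integrable \<mu> (\<lambda>x. \<Sum>n. g n x)"
      by (rule integrable_suminf[OF int AEs sm])
    have 2: "(\<lambda>n. \<integral>x. g n x \<partial>\<mu>) sums (\<integral>x. (\<Sum>n. g n x) \<partial>\<mu>)"
      by (rule sums_integral[OF int AEs sm])
    have "(\<integral>x. g n x \<partial>\<mu>) = of_real (c n * (\<integral>x. x ^ i * poly (scaled_jacobi l e n) x \<partial>\<mu>)) * z ^ n" for n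
    proof -
      have "(\<integral>x. g n x \<partial>\<mu>) = (\<integral>x. of_real (c n * (x ^ i * poly (scaled_jacobi l e n) x)) * z ^ n \<partial>\<mu>)"
        by (simp only: g_def mult.assoc)
      also have "\<dots> = (\<integral>x. of_real (c n * (x ^ i * poly (scaled_jacobi l e n) x)) \<partial>\<mu>) * z ^ n"
        by (rule integral_mult_left_zero)
      also have "(\<integral>x. complex_of_real (c n * (x ^ i * poly (scaled_jacobi l e n) x)) \<partial>\<mu>)
          = of_real (\<integral>x. c n * (x ^ i * poly (scaled_jacobi l e n) x) \<partial>\<mu>)"
        by (rule integral_complex_of_real)
      finally show ?thesis by (simp only: integral_mult_right_zero)
    qed
    with 1 2 show "integrable \<mu> (\<lambda>x. \<Sum>n. of_real (pochhammer l n / fact n * x ^ i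
          * poly (scaled_jacobi l e n) x) * z ^ n :: complex) \<and>
        (\<lambda>n. of_real (pochhammer l n / fact n * (\<integral>x. x ^ i * poly (scaled_jacobi l e n) x \<partial>\<mu>)) * z ^ n)
          sums (\<integral>x. (\<Sum>n. of_real (pochhammer l n / fact n * x ^ i * poly (scaled_jacobi l e n) x) * z ^ n) \<partial>\<mu>)"
      by (simp only: g_def c_def simp_thms)
  qed
  have "f z - (of_real c * z + of_real a) / 2
      = poly [:1, of_real (e / s - a / 2), of_real (k\<^sup>2 - c / 2):] z / z" if "z \<in> S" for z
    using SD(3)[OF that] by (simp add: f_def field_simps power2_eq_square)
  with gen inter show ?thesis by blast
qed

theorem mainTheorem4:
  fixes l :: real and \<mu> :: "real measure"
    and P :: "nat \<Rightarrow> real poly" and \<alpha> \<omega> :: "nat \<Rightarrow> real"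
  assumes "l > 0" and "l \<noteq> 1"
    and "standard_measure \<mu>"
    and "jacobi_szego \<mu> P \<alpha> \<omega>"
    and "\<alpha> 1 \<noteq> 0"
  shows
    "((\<exists>S u f.
          ultraspherical_generating l \<mu> P S u f \<and>
          interchange_condition l \<mu> P S \<and>
          (\<exists>E :: complex poly. \<forall>z\<in>S.
             f z - (of_real ((l + 1) * \<omega> 2) * z + of_real (\<alpha> 1)) / 2 = poly E z / z))
      \<longleftrightarrow>
      (l > 1/2 \<and>
        ((\<alpha> 1 > 0 \<and>
           (\<forall>n x. poly (P n) x = (2 * l / sqrt (2 * l - 1)) ^ n *
              poly (monic_jacobi_poly (l - 1/2) (l - 3/2) n)
                ((sqrt (2 * l - 1) * x - 1) / (2 * l))))
         \<or>
         (\<alpha> 1 < 0 \<and>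
           (\<forall>n x. poly (P n) x = (2 * l / sqrt (2 * l - 1)) ^ n *
              poly (monic_jacobi_poly (l - 3/2) (l - 1/2) n)
                ((sqrt (2 * l - 1) * x + 1) / (2 * l)))))))
     \<and>
     (l > 1/2 \<and> \<alpha> 1 > 0 \<longrightarrow>
        ((\<forall>n x. poly (P n) x = (2 * l / sqrt (2 * l - 1)) ^ n *
              poly (monic_jacobi_poly (l - 1/2) (l - 3/2) n)
                ((sqrt (2 * l - 1) * x - 1) / (2 * l)))
         \<longleftrightarrow>
         has_density_proportional_to \<mu>
           (\<lambda>x. (1 - (sqrt (2 * l - 1) * x - 1) / (2 * l)) powr (l - 1/2) *
                 (1 + (sqrt (2 * l - 1) * x - 1) / (2 * l)) powr (l - 3/2))
           {(1 - 2 * l) / sqrt (2 * l - 1) .. (1 + 2 * l) / sqrt (2 * l - 1)}))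
     \<and>
     (l > 1/2 \<and> \<alpha> 1 < 0 \<longrightarrow>
        ((\<forall>n x. poly (P n) x = (2 * l / sqrt (2 * l - 1)) ^ n *
              poly (monic_jacobi_poly (l - 3/2) (l - 1/2) n)
                ((sqrt (2 * l - 1) * x + 1) / (2 * l)))
         \<longleftrightarrow>
         has_density_proportional_to \<mu>
           (\<lambda>x. (1 - (sqrt (2 * l - 1) * x + 1) / (2 * l)) powr (l - 3/2) *
                 (1 + (sqrt (2 * l - 1) * x + 1) / (2 * l)) powr (l - 1/2))
           {- (1 + 2 * l) / sqrt (2 * l - 1) .. (2 * l - 1) / sqrt (2 * l - 1)}))"
proof -
  \<comment> \<open>With e as the sign of \<open>\<alpha> 1\<close>, the two alternatives of (B)
    become a single equation with \<open>scaled_jacobi l e\<close>.\<close>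
  define e where "e = sgn (\<alpha> 1)"
  have e: "e = 1 \<or> e = -1" using assms(5) by (auto simp: e_def sgn_if)
  note M = assms(3) and P = assms(4)
  note o = jacobi_szegoD(1)[OF P]
  have poly_iff: "(\<forall>n x. poly (P n) x = (2 * l / sqrt (2 * l - 1)) ^ n *
      poly (monic_jacobi_poly (l - 1/2) (l - 3/2) n) ((sqrt (2 * l - 1) * x - 1) / (2 * l)))
      \<longleftrightarrow> P = scaled_jacobi l 1"
    "(\<forall>n x. poly (P n) x = (2 * l / sqrt (2 * l - 1)) ^ n *
      poly (monic_jacobi_poly (l - 3/2) (l - 1/2) n) ((sqrt (2 * l - 1) * x + 1) / (2 * l)))
      \<longleftrightarrow> P = scaled_jacobi l (-1)" if "l > 1/2"
  proof -
    have ext: "(\<forall>n x. poly (P n) x = poly (Q n) x) \<longleftrightarrow> P = Q" for Q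
      by (metis ext poly_eq_poly_eq_iff)
    have "monic_jacobi_poly (l - 1/2) (l - 3/2) = jacobi_monic l 1"
      "monic_jacobi_poly (l - 3/2) (l - 1/2) = jacobi_monic l (-1)"
      using monic_jacobi_poly_eq[OF that, of 1] monic_jacobi_poly_eq[OF that, of "-1"] by simp_all
    then show "(\<forall>n x. poly (P n) x = (2 * l / sqrt (2 * l - 1)) ^ n *
      poly (monic_jacobi_poly (l - 1/2) (l - 3/2) n) ((sqrt (2 * l - 1) * x - 1) / (2 * l)))
      \<longleftrightarrow> P = scaled_jacobi l 1"
      "(\<forall>n x. poly (P n) x = (2 * l / sqrt (2 * l - 1)) ^ n *
      poly (monic_jacobi_poly (l - 3/2) (l - 1/2) n) ((sqrt (2 * l - 1) * x + 1) / (2 * l)))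
      \<longleftrightarrow> P = scaled_jacobi l (-1)"
      unfolding ext[symmetric] poly_scaled_jacobi by simp_all
  qed
  have density_iff: "has_density_proportional_to \<mu>
      (\<lambda>x. (1 - (sqrt (2 * l - 1) * x - 1) / (2 * l)) powr (l - 1/2) *
            (1 + (sqrt (2 * l - 1) * x - 1) / (2 * l)) powr (l - 3/2))
      {(1 - 2 * l) / sqrt (2 * l - 1) .. (1 + 2 * l) / sqrt (2 * l - 1)} \<longleftrightarrow> P = scaled_jacobi l 1"
    "has_density_proportional_to \<mu>
      (\<lambda>x. (1 - (sqrt (2 * l - 1) * x + 1) / (2 * l)) powr (l - 3/2) *
            (1 + (sqrt (2 * l - 1) * x + 1) / (2 * l)) powr (l - 1/2))
      {- (1 + 2 * l) / sqrt (2 * l - 1) .. (2 * l - 1) / sqrt (2 * l - 1)} \<longleftrightarrow> P = scaled_jacobi l (-1)"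
    if "l > 1/2"
  proof -
    have ind: "indicator {(e - 2 * l) / sqrt (2 * l - 1) .. (e + 2 * l) / sqrt (2 * l - 1)} x
        = (indicator {-1..1} ((sqrt (2 * l - 1) * x - e) / (2 * l)) :: real)" for e x
      using scaled_argument_iff_interval(1)[OF that, of x e] by (simp add: indicator_def)
    have 1: "c * ((1 - (sqrt (2 * l - 1) * x - 1) / (2 * l)) powr (l - 1/2) *
          (1 + (sqrt (2 * l - 1) * x - 1) / (2 * l)) powr (l - 3/2)) *
        indicator {(1 - 2 * l) / sqrt (2 * l - 1) .. (1 + 2 * l) / sqrt (2 * l - 1)} x
        = c * scaled_weight l 1 x" for c x
      unfolding ind by (simp add: scaled_weight_def jacobi_weight_def)
    have 2: "c * ((1 - (sqrt (2 * l - 1) * x + 1) / (2 * l)) powr (l - 3/2) *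
          (1 + (sqrt (2 * l - 1) * x + 1) / (2 * l)) powr (l - 1/2)) *
        indicator {- (1 + 2 * l) / sqrt (2 * l - 1) .. (2 * l - 1) / sqrt (2 * l - 1)} x
        = c * scaled_weight l (-1) x" for c x
    proof -
      have iv: "{- (1 + 2 * l) / sqrt (2 * l - 1) .. (2 * l - 1) / sqrt (2 * l - 1)}
          = {(-1 - 2 * l) / sqrt (2 * l - 1) .. (-1 + 2 * l) / sqrt (2 * l - 1)}"
        by simp
      show ?thesis unfolding iv ind by (simp add: scaled_weight_def jacobi_weight_def)
    qed
    show "has_density_proportional_to \<mu>
      (\<lambda>x. (1 - (sqrt (2 * l - 1) * x - 1) / (2 * l)) powr (l - 1/2) *
            (1 + (sqrt (2 * l - 1) * x - 1) / (2 * l)) powr (l - 3/2))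
      {(1 - 2 * l) / sqrt (2 * l - 1) .. (1 + 2 * l) / sqrt (2 * l - 1)} \<longleftrightarrow> P = scaled_jacobi l 1"
      unfolding has_density_proportional_to_def 1 scaled_jacobi_iff_density[OF that disjI1[OF refl] M o] ..
    show "has_density_proportional_to \<mu>
      (\<lambda>x. (1 - (sqrt (2 * l - 1) * x + 1) / (2 * l)) powr (l - 3/2) *
            (1 + (sqrt (2 * l - 1) * x + 1) / (2 * l)) powr (l - 1/2))
      {- (1 + 2 * l) / sqrt (2 * l - 1) .. (2 * l - 1) / sqrt (2 * l - 1)} \<longleftrightarrow> P = scaled_jacobi l (-1)"
      unfolding has_density_proportional_to_def 2 scaled_jacobi_iff_density[OF that disjI2[OF refl] M o] ..
  qed
  have generating_iff: "(\<exists>S u f. ultraspherical_generating l \<mu> P S u f \<and> interchange_condition l \<mu> P S \<and>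
      (\<exists>E :: complex poly. \<forall>z\<in>S. f z - (of_real ((l + 1) * \<omega> 2) * z + of_real (\<alpha> 1)) / 2 = poly E z / z))
    \<longleftrightarrow> l > 1/2 \<and> P = scaled_jacobi l e" (is "?L \<longleftrightarrow> ?R")
  proof
    assume ?L
    then show ?R
      unfolding e_def using ultraspherical_generating_imp_scaled_jacobi[OF assms(1,2) M P assms(5)] by blast
  next
    assume R: ?R
    \<comment> \<open>The passage through the density confines \<mu> to the interval, which the
      series estimates of the converse require.\<close>
    then obtain c where \<mu>: "\<mu> = density lborel (\<lambda>x. ennreal (c * scaled_weight l e x))"
      using scaled_jacobi_iff_density[OF _ e M o] by blast
    have "AE x in \<mu>. (sqrt (2 * l - 1) * x - e) / (2 * l) \<in> {-1..1}"
      unfolding \<mu> using R by (intro AE_scaled_density) simp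
    moreover have "real_distribution \<mu>" "has_moments \<mu>"
      using M by (auto simp: standard_measure_def has_moments_def)
    ultimately show ?L
      using R e scaled_jacobi_imp_generating[of l e \<mu> "(l + 1) * \<omega> 2" "\<alpha> 1"] by blast
  qed
  show ?thesis
    unfolding generating_iff
    using poly_iff density_iff assms(5) by (cases "l > 1/2"; cases "\<alpha> 1 > 0") (auto simp: e_def sgn_if)
qed

end
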